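(* Let $n\ge2$, $p>1$ and $q>p-1$. Let $f:[0,\infty)\to[0,\infty)$ be strictly positive and locally Lipschitz continuous on $(0,\infty)$, continuous at $0$, such that the limit $\ell=\lim_{t\to0^+}\frac{f(t)}{t^{p-1}}$ exists and belongs to $[0,+\infty)$, and such that there is a constant $c>0$ with $f(t)\ge c\,t^q$ for all $t>0$. Then the problem $$-\Delta_pu=f(u)\ \text{ in }\mathbb R^n_+,\qquad u=0\ \text{ on }\partial\mathbb R^n_+$$ has no non-negative nontrivial solution $u\in W^{1,p}_{loc}(\mathbb R^n_+)\cap L^q_{loc}(\mathbb R^n_+)$ with $|\nabla u|\in L^\infty(\mathbb R^n_+)$ for which $$\inf_{x'\in\mathbb R^{n-1}}u(x',y_0)>0\quad\text{for some }y_0>0.$$ Equivalently, every non-negative nontrivial solution $u$ in this class satisfies $\inf_{x'\in\mathbb R^{n-1}}u(x',y)=0$ for all $y>0$.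
   Context: $\mathbb R^n_+=\{x=(x',x_n)\in\mathbb R^{n-1}\times\mathbb R:x_n>0\}$ and $\Delta_pu=\operatorname{div}(|\nabla u|^{p-2}\nabla u)$. Solutions are understood in the distributional sense: $\int_{\mathbb R^n_+}|\nabla u|^{p-2}\nabla u\cdot\nabla\psi\,dx=\int_{\mathbb R^n_+}f(u)\psi\,dx$ for all $\psi\in C_0^\infty(\mathbb R^n_+)$; since $|\nabla u|\in L^\infty$, $u$ is identified with its Lipschitz representative, which extends continuously to $\overline{\mathbb R^n_+}$, and the boundary condition $u=0$ is imposed on this extension. *)

theory Defs
  imports "HOL-Analysis.Analysis"
begin

definition half_space :: "('a \<times> real) set"
  where "half_space = {x. snd x > 0}"

definition closed_half_space :: "('a \<times> real) set"
  where "closed_half_space = {x. snd x \<ge> 0}"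

definition gradient :: "('a::euclidean_space \<Rightarrow> real) \<Rightarrow> 'a \<Rightarrow> 'a"
  where "gradient f x = (THE D. GDERIV f x :> D)"

lemma gradient_eqI: "GDERIV f x :> D \<Longrightarrow> gradient f x = D"
  unfolding gradient_def
proof (rule the_equality)
  fix E assume D: "GDERIV f x :> D" and E: "GDERIV f x :> E"
  have "inner h E = inner h D" for h
    using has_derivative_unique[OF D[unfolded gderiv_def] E[unfolded gderiv_def]] by metis
  then show "E = D"
    by (metis vector_eq_rdot inner_commute)
qed

primrec C_k :: "nat \<Rightarrow> ('a::euclidean_space \<Rightarrow> real) \<Rightarrow> bool" where
  "C_k 0 f \<longleftrightarrow> continuous_on UNIV f"
| "C_k (Suc k) f \<longleftrightarrow>
     (\<forall>x. f differentiable (at x)) \<and>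
     (\<forall>b\<in>Basis. C_k k (\<lambda>x. frechet_derivative f (at x) b))"

definition test_functions :: "'a::euclidean_space set \<Rightarrow> ('a \<Rightarrow> real) set"
  where "test_functions \<Omega> =
    {\<psi>. (\<forall>k. C_k k \<psi>) \<and> compact (closure {x. \<psi> x \<noteq> 0}) \<and> closure {x. \<psi> x \<noteq> 0} \<subseteq> \<Omega>}"

definition Lp_loc ::
  "real \<Rightarrow> 'a::euclidean_space set \<Rightarrow> ('a \<Rightarrow> 'b::euclidean_space) set"
  where "Lp_loc p \<Omega> =
    {u. set_borel_measurable lebesgue \<Omega> u \<and>
        (\<forall>K. compact K \<and> K \<subseteq> \<Omega> \<longrightarrow> set_integrable lebesgue K (\<lambda>x. norm (u x) powr p))}"

definition weak_gradient ::
  "'a::euclidean_space set \<Rightarrow> ('a \<Rightarrow> real) \<Rightarrow> ('a \<Rightarrow> 'a) \<Rightarrow> bool"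
  where "weak_gradient \<Omega> u G \<longleftrightarrow>
    u \<in> Lp_loc 1 \<Omega> \<and> G \<in> Lp_loc 1 \<Omega> \<and>
    (\<forall>\<psi>\<in>test_functions \<Omega>.
       (LINT x:\<Omega>|lebesgue. u x *\<^sub>R gradient \<psi> x) = - (LINT x:\<Omega>|lebesgue. \<psi> x *\<^sub>R G x))"

text \<open>Membership of \<open>u\<close> in the local Sobolev space with exponent \<open>p\<close>, with \<open>G\<close> naming its
  (almost everywhere unique) weak gradient.\<close>

definition W1p_loc ::
  "real \<Rightarrow> 'a::euclidean_space set \<Rightarrow> ('a \<Rightarrow> real) \<Rightarrow> ('a \<Rightarrow> 'a) \<Rightarrow> bool"
  where "W1p_loc p \<Omega> u G \<longleftrightarrow> weak_gradient \<Omega> u G \<and> u \<in> Lp_loc p \<Omega> \<and> G \<in> Lp_loc p \<Omega>"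

definition essentially_bounded ::
  "'a::euclidean_space set \<Rightarrow> ('a \<Rightarrow> 'b::euclidean_space) \<Rightarrow> bool"
  where "essentially_bounded \<Omega> G \<longleftrightarrow>
    set_borel_measurable lebesgue \<Omega> G \<and> (\<exists>M. AE x in lebesgue. x \<in> \<Omega> \<longrightarrow> norm (G x) \<le> M)"

text \<open>The flux \<open>|G|\<^sup>p\<^sup>-\<^sup>2 G\<close> is read as \<open>0\<close> where \<open>G = 0\<close>, also for \<open>p < 2\<close>: the scalar factor
  is multiplied by the zero vector.\<close>

definition p_Laplace_solution ::
  "real \<Rightarrow> (real \<Rightarrow> real) \<Rightarrow> 'a::euclidean_space set \<Rightarrow> ('a \<Rightarrow> real) \<Rightarrow> ('a \<Rightarrow> 'a) \<Rightarrow> bool"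
  where "p_Laplace_solution p f \<Omega> u G \<longleftrightarrow>
    (\<forall>\<psi>\<in>test_functions \<Omega>.
       (LINT x:\<Omega>|lebesgue. (norm (G x) powr (p - 2) *\<^sub>R G x) \<bullet> gradient \<psi> x) =
       (LINT x:\<Omega>|lebesgue. f (u x) * \<psi> x))"

text \<open>The function \<open>u\<close> is the continuous representative, already extended to the closed half-space;
  it is Lipschitz because the half-space is convex and the weak gradient is essentially bounded.
  Values of \<open>u\<close> outside the closed half-space are irrelevant.\<close>

definition nonneg_nontrivial_solution ::
  "real \<Rightarrow> real \<Rightarrow> (real \<Rightarrow> real) \<Rightarrow> ((real^'m) \<times> real \<Rightarrow> real) \<Rightarrow> bool"
  where "nonneg_nontrivial_solution p q f u \<longleftrightarrow>
    continuous_on closed_half_space u \<and>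
    (\<forall>x'. u (x', 0) = 0) \<and>
    (\<forall>x\<in>half_space. u x \<ge> 0) \<and>
    (\<exists>x\<in>half_space. u x \<noteq> 0) \<and>
    u \<in> Lp_loc q half_space \<and>
    (\<exists>G. W1p_loc p half_space u G \<and> essentially_bounded half_space G \<and>
         p_Laplace_solution p f half_space u G)"

end

theory Submission
  imports Defs
begin

text \<open>
  Suppose \<open>u \<ge> 2 d\<close> on the hyperplane \<open>x\<^sub>n = y\<^sub>0\<close>. Since \<open>u\<close> is Lipschitz, \<open>u \<ge> d\<close> on a slab above
  it. Let \<open>\<Phi>\<close> be a smooth nonnegative decreasing function that vanishes on \<open>[d, \<infinity>)\<close> and put \<open>W = \<Phi>(u)\<close>,
  which measures where \<open>u\<close> lies below \<open>d\<close>. Testing the equation with \<open>\<zeta> \<Phi>(u)\<close>, where \<open>\<zeta>\<close> is a cutoff to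
  a cylinder of radius \<open>R\<close> and height \<open>L\<close> above the hyperplane, and discarding the nonnegative source
  gives the bound \<open>\<integral> |\<Phi>'(u)| |\<nabla>u|\<^sup>p \<zeta> \<le> \<integral> W |\<nabla>u|\<^sup>p\<^sup>-\<^sup>1 |\<nabla>\<zeta>|\<close>; as \<open>W = 0\<close> on the slab, only the upper and
  lateral parts of \<open>\<nabla>\<zeta>\<close> matter. Because \<open>|\<nabla>u|\<close> is bounded, the energy is at most a constant times the
  volume of the base; feeding this back through Young's inequality shows that the energy per unit of
  base tends to zero when \<open>L\<close> and \<open>R / L\<close> tend to infinity. Integrating vertically from the slab, where
  \<open>W = 0\<close>, the mean of \<open>W\<close> over a cylinder of fixed height \<open>T\<close> tends to zero as well, so \<open>u \<ge> d / 2\<close> and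
  \<open>f(u) \<ge> k > 0\<close> on most of it. Testing with \<open>\<zeta>\<close> alone bounds the integral of \<open>f(u)\<close> by a constant times
  the volume of the base, independently of \<open>T\<close>, which is absurd for large \<open>T\<close>.

  The test functions \<open>\<zeta> \<Phi>(u)\<close> are not smooth; they are approximated by \<open>\<zeta> \<Phi>(v)\<close> with mollifications \<open>v\<close>
  of \<open>u\<close>. The gradients of \<open>v\<close> stay bounded and converge weakly, which suffices because the flux is a
  fixed bounded field.
\<close>

section \<open>Smooth functions\<close>

definition smooth :: "('a::euclidean_space \<Rightarrow> real) \<Rightarrow> bool"
  where "smooth f \<longleftrightarrow> (\<forall>k. C_k k f)"

lemma smooth_differentiable: "smooth f \<Longrightarrow> f differentiable (at x)"
  unfolding smooth_def by (metis C_k.simps(2))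

lemma smooth_continuous_on: "smooth f \<Longrightarrow> continuous_on S f"
  unfolding smooth_def by (metis C_k.simps(1) continuous_on_subset subset_UNIV)

lemma smooth_frechet_derivative:
  "smooth f \<Longrightarrow> b \<in> Basis \<Longrightarrow> smooth (\<lambda>x. frechet_derivative f (at x) b)"
  unfolding smooth_def by (metis C_k.simps(2))

lemma C_k_add: "C_k k f \<Longrightarrow> C_k k g \<Longrightarrow> C_k k (\<lambda>x. f x + g x)"
proof (induction k arbitrary: f g)
  case 0
  then show ?case by (auto intro: continuous_intros)
next
  case (Suc k)
  have d: "(f has_derivative frechet_derivative f (at x)) (at x)"
    "(g has_derivative frechet_derivative g (at x)) (at x)" for x
    using Suc.prems by (simp_all add: frechet_derivative_works[symmetric])
  have "frechet_derivative (\<lambda>x. f x + g x) (at x) =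
      (\<lambda>b. frechet_derivative f (at x) b + frechet_derivative g (at x) b)" for x
    by (rule frechet_derivative_at[symmetric]) (rule has_derivative_add[OF d])
  with Suc show ?case by auto
qed

lemma C_k_const: "C_k k (\<lambda>x. c)"
  by (induction k arbitrary: c) auto

lemma C_k_bounded_linear:
  assumes "bounded_linear f" shows "C_k k f"
proof (cases k)
  case 0
  then show ?thesis
    using assms by (simp add: linear_continuous_on)
next
  case (Suc n)
  have "frechet_derivative f (at x) = f" for x
    using assms by (metis bounded_linear_imp_has_derivative frechet_derivative_at)
  with Suc assms show ?thesis
    by (auto simp: C_k_const bounded_linear_imp_differentiable)
qed

lemma C_k_Suc_imp: "C_k (Suc k) f \<Longrightarrow> C_k k f"
  by (induction k arbitrary: f)
    (auto simp: continuous_at_imp_continuous_on differentiable_imp_continuous_within)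

text \<open>Each summand of the product rule leaves one factor undifferentiated, so the induction
  step also needs \<open>C_k k\<close> of \<open>f\<close> and \<open>g\<close> themselves;
  \<open>C_k_Suc_imp\<close> supplies it.\<close>

lemma C_k_mult: "C_k k f \<Longrightarrow> C_k k g \<Longrightarrow> C_k k (\<lambda>x. f x * g x)"
proof (induction k arbitrary: f g)
  case 0
  then show ?case by (auto intro: continuous_intros)
next
  case (Suc k)
  have d: "(f has_derivative frechet_derivative f (at x)) (at x)"
    "(g has_derivative frechet_derivative g (at x)) (at x)" for x
    using Suc.prems by (simp_all add: frechet_derivative_works[symmetric])
  have eq: "frechet_derivative (\<lambda>x. f x * g x) (at x) =
      (\<lambda>b. f x * frechet_derivative g (at x) b + frechet_derivative f (at x) b * g x)" for x
    by (rule frechet_derivative_at[symmetric]) (rule has_derivative_mult[OF d])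
  show ?case
    using Suc.prems C_k_Suc_imp[OF Suc.prems(1)] C_k_Suc_imp[OF Suc.prems(2)]
    by (auto simp: eq intro!: C_k_add Suc.IH differentiable_mult)
qed

lemma smooth_const: "smooth (\<lambda>x. c)"
  by (simp add: smooth_def C_k_const)

lemma smooth_add: "smooth f \<Longrightarrow> smooth g \<Longrightarrow> smooth (\<lambda>x. f x + g x)"
  by (simp add: smooth_def C_k_add)

lemma smooth_mult: "smooth f \<Longrightarrow> smooth g \<Longrightarrow> smooth (\<lambda>x. f x * g x)"
  by (simp add: smooth_def C_k_mult)

lemma smooth_bounded_linear: "bounded_linear f \<Longrightarrow> smooth f"
  by (simp add: smooth_def C_k_bounded_linear)

lemma smooth_cmult: "smooth f \<Longrightarrow> smooth (\<lambda>x. c * f x)"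
  by (intro smooth_mult smooth_const)

lemma smooth_diff:
  assumes "smooth f" "smooth g" shows "smooth (\<lambda>x. f x - g x)"
  using smooth_add[OF assms(1) smooth_cmult[OF assms(2), of "-1"]] by simp

lemma smooth_divide: "smooth f \<Longrightarrow> smooth (\<lambda>x. f x / c)"
  using smooth_cmult[of f "1/c"] by simp

lemma smooth_sum:
  "finite I \<Longrightarrow> (\<And>i. i \<in> I \<Longrightarrow> smooth (f i)) \<Longrightarrow> smooth (\<lambda>x. \<Sum>i\<in>I. f i x)"
  by (induction I rule: finite_induct) (auto intro: smooth_const smooth_add)

text \<open>Unlike the norm, its square is a sum of squares of affine functions of
  \<open>x\<close>.\<close>

lemma smooth_norm_sq_bounded_linear:
  fixes f :: "'a::euclidean_space \<Rightarrow> 'b::euclidean_space"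
  assumes "bounded_linear f"
  shows "smooth (\<lambda>x. (norm (f x - c))\<^sup>2)"
proof -
  have "smooth (\<lambda>x. (f x - c) \<bullet> b)" for b
    unfolding inner_diff_left
    by (intro smooth_diff smooth_const smooth_bounded_linear
        bounded_linear_inner_left_comp assms)
  then have "smooth (\<lambda>x. \<Sum>b\<in>Basis. ((f x - c) \<bullet> b) * ((f x - c) \<bullet> b))"
    by (intro smooth_sum smooth_mult) auto
  then show ?thesis
    by (simp add: power2_norm_eq_inner euclidean_inner[symmetric])
qed

lemma frechet_derivative_real: "(h has_real_derivative d) (at x) \<Longrightarrow> frechet_derivative h (at x) = (*) d"
  by (metis frechet_derivative_at has_field_derivative_def)

text \<open>The derivative is \<open>h'\<close> composed with \<open>f\<close>, times a derivative
  of \<open>f\<close>. Requiring all orders of \<open>h\<close> and \<open>f\<close> lets the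
  induction hypothesis apply to \<open>h'\<close> without counting orders.\<close>

lemma C_k_compose:
  fixes h :: "real \<Rightarrow> real"
  shows "smooth h \<Longrightarrow> smooth f \<Longrightarrow> C_k k (\<lambda>x. h (f x))"
proof (induction k arbitrary: h f)
  case 0
  then show ?case
    using continuous_on_compose2[OF smooth_continuous_on[of h UNIV] smooth_continuous_on[of f UNIV]]
    by simp
next
  case (Suc k)
  define h' where "h' = (\<lambda>x. frechet_derivative h (at x) 1)"
  have sh': "smooth h'"
    unfolding h'_def using Suc.prems by (simp add: smooth_frechet_derivative)
  have dh: "(h has_derivative (\<lambda>y. h' x * y)) (at x)" for x
  proof -
    have *: "(h has_derivative frechet_derivative h (at x)) (at x)"
      using Suc.prems smooth_differentiable frechet_derivative_works by blast
    then have "linear (frechet_derivative h (at x))"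
      by (simp add: has_derivative_linear)
    then have "frechet_derivative h (at x) = (\<lambda>y. h' x * y)"
      unfolding h'_def by (metis linear_iff mult.commute mult.right_neutral real_scaleR_def)
    with * show ?thesis by simp
  qed
  have df: "(f has_derivative frechet_derivative f (at x)) (at x)" for x
    using Suc.prems smooth_differentiable frechet_derivative_works by blast
  have dhf: "((\<lambda>x. h (f x)) has_derivative (\<lambda>b. h' (f x) * frechet_derivative f (at x) b)) (at x)" for x
    by (rule has_derivative_compose[OF df dh])
  have eq: "frechet_derivative (\<lambda>x. h (f x)) (at x) b = h' (f x) * frechet_derivative f (at x) b"
    for x b
    using frechet_derivative_at[OF dhf] by metis
  have "C_k k (\<lambda>x. h' (f x) * frechet_derivative f (at x) b)" if "b \<in> Basis" for b
    using Suc.IH[OF sh' Suc.prems(2)] smooth_frechet_derivative[OF Suc.prems(2) that]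
    by (auto simp: smooth_def intro: C_k_mult)
  then show ?case
    using dhf unfolding C_k.simps eq differentiable_def by blast
qed

lemma smooth_compose:
  fixes h :: "real \<Rightarrow> real"
  shows "smooth h \<Longrightarrow> smooth f \<Longrightarrow> smooth (\<lambda>x. h (f x))"
  by (simp add: smooth_def[of "\<lambda>x. h (f x)"] C_k_compose)

lemma smooth_real_polynomial_function:
  "real_polynomial_function f \<Longrightarrow> smooth f"
  by (induction rule: real_polynomial_function.induct)
    (auto intro: smooth_bounded_linear smooth_const smooth_add smooth_mult)

section \<open>Gradients of smooth functions and membership in the test functions\<close>

lemma GDERIV_imp_frechet_derivative:
  "GDERIV f x :> D \<Longrightarrow> frechet_derivative f (at x) b = b \<bullet> D"
  unfolding gderiv_def by (metis frechet_derivative_at)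

lemma smooth_GDERIV:
  assumes "smooth f" shows "GDERIV f x :> gradient f x"
proof -
  have d: "(f has_derivative frechet_derivative f (at x)) (at x)"
    using assms smooth_differentiable frechet_derivative_works by blast
  have "\<exists>D. \<forall>h. frechet_derivative f (at x) h = h \<bullet> D"
  proof (intro exI allI)
    have "linear (frechet_derivative f (at x))"
      using d has_derivative_linear by blast
    then show "frechet_derivative f (at x) h =
        h \<bullet> (\<Sum>b\<in>Basis. frechet_derivative f (at x) b *\<^sub>R b)" for h
      by (subst euclidean_representation[of h, symmetric])
        (simp add: linear_sum linear_cmul inner_sum_right mult.commute
          del: euclidean_representation)
  qed
  then obtain D where "frechet_derivative f (at x) = (\<lambda>h. h \<bullet> D)" by blast
  with d have "GDERIV f x :> D" by (simp add: gderiv_def)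
  then show ?thesis by (simp add: gradient_eqI)
qed

lemma frechet_derivative_eq_gradient:
  "smooth f \<Longrightarrow> frechet_derivative f (at x) b = b \<bullet> gradient f x"
  using smooth_GDERIV GDERIV_imp_frechet_derivative by blast

lemma smooth_gradient_inner_Basis:
  "smooth f \<Longrightarrow> b \<in> Basis \<Longrightarrow> smooth (\<lambda>x. b \<bullet> gradient f x)"
  using smooth_frechet_derivative by (fastforce simp: frechet_derivative_eq_gradient)

lemma continuous_on_gradient:
  assumes "smooth f" shows "continuous_on S (gradient f)"
  by (subst continuous_on_componentwise)
    (use assms in \<open>auto simp: inner_commute intro: smooth_continuous_on smooth_gradient_inner_Basis\<close>)

lemma gradient_zero_outside:
  assumes "closure {x. f x \<noteq> 0} \<subseteq> K" "x \<notin> K"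
  shows "gradient f x = (0::'a::euclidean_space)"
proof (rule gradient_eqI)
  have *: "x \<in> - closure {x. f x \<noteq> 0}" "open (- closure {x. f x \<noteq> 0})"
    using assms by auto
  show "GDERIV f x :> 0"
    unfolding gderiv_def
    by (rule has_derivative_transform_within_open[OF _ *(2,1), of "\<lambda>x. 0"])
      (use closure_subset[of "{x. f x \<noteq> 0}"] in auto)
qed

lemma test_functionsD:
  assumes "\<psi> \<in> test_functions \<Omega>"
  shows "smooth \<psi>" "compact (closure {x. \<psi> x \<noteq> 0})" "closure {x. \<psi> x \<noteq> 0} \<subseteq> \<Omega>"
  using assms by (auto simp: test_functions_def smooth_def)

lemma test_functionsI:
  assumes "smooth \<psi>" "{x. \<psi> x \<noteq> 0} \<subseteq> K" "compact K" "K \<subseteq> \<Omega>"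
  shows "\<psi> \<in> test_functions \<Omega>"
proof -
  have "closure {x. \<psi> x \<noteq> 0} \<subseteq> K"
    using assms closure_minimal compact_imp_closed by blast
  then show ?thesis
    using assms unfolding test_functions_def smooth_def
    by (auto simp: compact_closure intro: bounded_subset[of K] compact_imp_bounded
        dest: order_trans[OF closure_subset])
qed

lemma GDERIV_compose:
  fixes h :: "real \<Rightarrow> real"
  assumes "GDERIV f x :> D" "(h has_real_derivative d) (at (f x))"
  shows "GDERIV (\<lambda>x. h (f x)) x :> d *\<^sub>R D"
  using has_derivative_compose[OF assms(1)[unfolded gderiv_def] assms(2)[unfolded has_field_derivative_def]]
  by (simp add: gderiv_def)

section \<open>A flat function and a smooth step\<close>

text \<open>For \<open>k = 0\<close> this is the classical function exp(-1/t). The extra powers of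
  \<open>1 / t\<close> make the span of the family closed under differentiation, which reduces
  smoothness to one derivative formula.\<close>

definition flat :: "nat \<Rightarrow> real \<Rightarrow> real"
  where "flat k t = (if t > 0 then (1 / t) ^ k * exp (- (1 / t)) else 0)"

lemma flat_nonneg [simp]: "0 \<le> flat k t"
  by (simp add: flat_def)

lemma flat_nonpos_arg [simp]: "t \<le> 0 \<Longrightarrow> flat k t = 0"
  by (simp add: flat_def)

lemma flat_pos [simp]: "0 < t \<Longrightarrow> 0 < flat k t"
  by (simp add: flat_def)

lemma power_div_fact_le_exp:
  assumes "(0::real) \<le> x" shows "x ^ k / fact k \<le> exp x"
proof -
  have "(\<Sum>n\<in>{k}. x ^ n /\<^sub>R fact n) \<le> (\<Sum>n. x ^ n /\<^sub>R fact n)"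
    by (rule sum_le_suminf) (use assms summable_exp_generic[of x] in auto)
  then show ?thesis by (simp add: exp_def divide_inverse mult.commute)
qed

lemma flat_le_fact: "flat k t \<le> fact k"
proof (cases "t > 0")
  case True
  then have "(1 / t) ^ k \<le> fact k * exp (1 / t)"
    using power_div_fact_le_exp[of "1/t" k] by (simp add: field_simps)
  with True show ?thesis by (simp add: flat_def exp_minus field_simps)
qed simp

lemma flat_Suc: "t > 0 \<Longrightarrow> flat k t = t * flat (Suc k) t"
  by (simp add: flat_def)

lemma flat_has_real_derivative:
  "(flat k has_real_derivative flat (k + 2) t - real k * flat (k + 1) t) (at t)"
proof -
  consider "t > 0" | "t < 0" | "t = 0" by linarith
  then show ?thesis
  proof cases
    case 1
    have "((\<lambda>t. (1 / t) ^ k * exp (- (1 / t))) has_real_derivative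
        (1 / t) ^ k * (exp (- (1 / t)) * (1 / t^2)) + real k * (1 / t) ^ (k - 1) * (- (1 / t^2)) * exp (- (1 / t))) (at t)"
    proof -
      have d: "((\<lambda>t. 1 / t) has_real_derivative - (1 / t\<^sup>2)) (at t)"
        using 1 by (auto intro!: derivative_eq_intros simp: power2_eq_square)
      have "((\<lambda>t. exp (- (1 / t))) has_real_derivative exp (- (1 / t)) * (1 / t\<^sup>2)) (at t)"
        by (rule DERIV_chain2[OF DERIV_exp]) (use DERIV_minus[OF d] in simp)
      from DERIV_mult[OF DERIV_power[OF d, of k] this] show ?thesis
        by (simp add: algebra_simps)
    qed
    moreover have "(1 / t) ^ k * (exp (- (1 / t)) * (1 / t^2)) + real k * (1 / t) ^ (k - 1) * (- (1 / t^2)) * exp (- (1 / t))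
       = flat (k + 2) t - real k * flat (k + 1) t"
      using 1 by (cases k) (auto simp: flat_def power2_eq_square field_simps)
    ultimately have "((\<lambda>t. (1 / t) ^ k * exp (- (1 / t))) has_real_derivative
        flat (k + 2) t - real k * flat (k + 1) t) (at t)" by simp
    then show ?thesis
      by (rule has_field_derivative_transform_within_open[of _ _ _ "{0<..}"])
        (use 1 in \<open>auto simp: flat_def\<close>)
  next
    case 2
    have "((\<lambda>t. 0) has_real_derivative flat (k + 2) t - real k * flat (k + 1) t) (at t)"
      using 2 by simp
    then show ?thesis
      by (rule has_field_derivative_transform_within_open[of _ _ _ "{..<0}"])
        (use 2 in \<open>auto simp: flat_def\<close>)
  next
    case 3
    \<comment> \<open>Two factors \<open>h\<close> taken out of \<open>flat (k + 2)\<close> give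
      quadratic decay at 0, so the difference quotient tends to 0, which is also the value of the
      claimed derivative there.\<close>
    have le: "flat k h \<le> fact (k + 2) * h\<^sup>2" for h
    proof (cases "h > 0")
      case True
      then have "flat k h = h\<^sup>2 * flat (k + 2) h"
        using flat_Suc[of h k] flat_Suc[of h "Suc k"] by (simp add: power2_eq_square)
      also have "\<dots> \<le> h\<^sup>2 * fact (k + 2)"
        by (intro mult_left_mono flat_le_fact) auto
      finally show ?thesis by (simp add: mult.commute)
    qed simp
    have "((\<lambda>h. flat k h / h) \<longlongrightarrow> 0) (at 0)"
    proof (rule Lim_null_comparison)
      have "norm (flat k h / h) \<le> fact (k + 2) * \<bar>h\<bar>" if "h \<noteq> 0" for h
        using le[of h] that by (simp add: divide_le_eq power2_eq_square abs_mult mult.assoc)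
      then show "\<forall>\<^sub>F h in at 0. norm (flat k h / h) \<le> fact (k + 2) * \<bar>h\<bar>"
        by (auto simp: eventually_at_filter)
      show "((\<lambda>h. fact (k + 2) * \<bar>h\<bar>) \<longlongrightarrow> (0::real)) (at 0)"
        by (auto intro!: tendsto_eq_intros)
    qed
    then show ?thesis
      using 3 by (simp add: has_field_derivative_iff)
  qed
qed

lemma C_k_flat: "C_k n (flat k)"
proof (induction n arbitrary: k)
  case 0
  show ?case
    by (auto intro!: continuous_at_imp_continuous_on DERIV_isCont[OF flat_has_real_derivative])
next
  case (Suc n)
  have eq: "frechet_derivative (flat k) (at t) 1 = flat (k + 2) t + - real k * flat (k + 1) t" for t
    using frechet_derivative_real[OF flat_has_real_derivative] by simp
  have "C_k n (\<lambda>t. flat (k + 2) t + - real k * flat (k + 1) t)"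
    by (intro C_k_add C_k_mult C_k_const Suc.IH)
  then show ?case
    using flat_has_real_derivative[of k] real_differentiable_def unfolding C_k.simps Basis_real_def
    by (auto simp: eq)
qed

lemma smooth_flat: "smooth (flat k)"
  by (simp add: smooth_def C_k_flat)

lemma flat0_has_real_derivative: "(flat 0 has_real_derivative flat 2 t) (at t)"
  using flat_has_real_derivative[of 0 t] by (simp add: numeral_2_eq_2)

lemma flat0_le_1: "flat 0 t \<le> 1"
  using flat_le_fact[of 0 t] by simp

lemma flat2_le_2: "flat 2 t \<le> 2"
  using flat_le_fact[of 2 t] by (simp add: fact_2)

lemma flat0_mono: "s \<le> t \<Longrightarrow> flat 0 s \<le> flat 0 t"
  by (auto simp: flat_def frac_le)

text \<open>Since \<open>flat 2\<close> is the derivative of \<open>flat 0\<close>, this controls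
  the function by its own derivative on bounded sets. Both \<open>W\<close> and the decay of the
  cutoff are later estimated this way.\<close>

lemma flat0_eq_square_flat2: "t \<ge> 0 \<Longrightarrow> flat 0 t = t\<^sup>2 * flat 2 t"
  by (cases "t = 0") (auto simp: flat_def field_simps)

text \<open>The inner difference is nonpositive for \<open>t \<le> 0\<close> and constant for
  \<open>t \<ge> 1\<close>. The plateau height is the positive number
  \<open>flat 0 (flat 0 1)\<close>, not 1.\<close>

definition smooth_step :: "real \<Rightarrow> real"
  where "smooth_step t = flat 0 (flat 0 1 - flat 0 (1 - t))"

lemma smooth_smooth_step: "smooth smooth_step"
  unfolding smooth_step_def
  by (intro smooth_compose[OF smooth_flat] smooth_diff smooth_const smooth_bounded_linear
      bounded_linear_ident)

lemma smooth_step_nonneg: "0 \<le> smooth_step t" and smooth_step_le_1: "smooth_step t \<le> 1"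
  by (simp_all add: smooth_step_def flat0_le_1)

lemma smooth_step_eq_0: "t \<le> 0 \<Longrightarrow> smooth_step t = 0"
  using flat0_mono[of 1 "1 - t"] by (simp add: smooth_step_def)

lemma smooth_step_ge_1: "t \<ge> 1 \<Longrightarrow> smooth_step t = smooth_step 1"
  by (simp add: smooth_step_def)

lemma smooth_step_1_pos: "0 < smooth_step 1"
  by (simp add: smooth_step_def)

lemma smooth_step_has_real_derivative:
  "(smooth_step has_real_derivative
     flat 2 (flat 0 1 - flat 0 (1 - t)) * flat 2 (1 - t)) (at t)"
proof -
  have "((\<lambda>t. flat 0 (1 - t)) has_real_derivative flat 2 (1 - t) * (0 - 1)) (at t)"
    by (rule DERIV_chain2[OF flat0_has_real_derivative]) (auto intro!: derivative_eq_intros)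
  then have "((\<lambda>t. flat 0 1 - flat 0 (1 - t)) has_real_derivative flat 2 (1 - t)) (at t)"
    by (auto intro!: derivative_eq_intros)
  from DERIV_chain2[OF flat0_has_real_derivative this] show ?thesis
    by (simp add: smooth_step_def[abs_def])
qed

section \<open>Integrals of compactly supported functions\<close>

lemma integrable_indicator_cbox: "integrable lebesgue (\<lambda>x. C * indicator (cbox a b) x :: real)"
  by (intro integrable_mult_right integrable_real_indicator) (use emeasure_lborel_cbox_finite[of a b] in \<open>auto simp: infinity_ennreal_def\<close>)

lemma integrable_AE_bounded_cbox:
  fixes f :: "'a::euclidean_space \<Rightarrow> 'b::euclidean_space"
  assumes "f \<in> borel_measurable lebesgue"
    and "AE x in lebesgue. norm (f x) \<le> C * indicator (cbox a b) x"
  shows "integrable lebesgue f"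
  by (rule Bochner_Integration.integrable_bound[OF integrable_indicator_cbox[of C a b] assms(1)])
    (use assms(2) in eventually_elim, auto)

lemma integrable_continuous_supported_cbox:
  fixes f :: "'a::euclidean_space \<Rightarrow> 'b::euclidean_space"
  assumes "continuous_on UNIV f" "\<And>x. x \<notin> cbox a b \<Longrightarrow> f x = 0"
  shows "integrable lebesgue f"
proof -
  have "bounded (f ` cbox a b)"
    using assms(1) by (intro compact_imp_bounded compact_continuous_image)
      (auto intro: continuous_on_subset)
  then obtain C where "\<forall>x\<in>cbox a b. norm (f x) \<le> C"
    by (auto simp: bounded_iff)
  then have "norm (f x) \<le> C * indicator (cbox a b) x" for x
    using assms(2) by (auto simp: indicator_def)
  moreover have "f \<in> borel_measurable lebesgue"
    using assms(1) by (simp add: borel_measurable_continuous_onI measurable_completion)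
  ultimately show ?thesis
    by (intro integrable_AE_bounded_cbox) auto
qed

lemma gradient_zero_outside_cbox:
  assumes "\<And>x. x \<notin> cbox a b \<Longrightarrow> f x = 0" "x \<notin> cbox a b"
  shows "gradient f x = 0"
proof (rule gradient_zero_outside)
  show "closure {x. f x \<noteq> 0} \<subseteq> cbox a b"
    using assms(1) by (intro closure_minimal) auto
qed fact

text \<open>Differentiate the translation-invariant integral of \<open>f (x + s *\<^sub>R v)\<close> at \<open>s = 0\<close>.\<close>

lemma integral_gradient_eq_0:
  fixes f :: "'a::euclidean_space \<Rightarrow> real"
  assumes f: "smooth f" and supp: "\<And>x. x \<notin> cbox a b \<Longrightarrow> f x = 0"
  shows "(\<integral>x. gradient f x \<bullet> v \<partial>lebesgue) = 0"
proof -
  \<comment> \<open>Every coordinate of \<open>c\<close> equals \<open>norm v\<close>, so the box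
    from \<open>A\<close> to \<open>B\<close> still contains \<open>cbox a b\<close> after a shift
    by \<open>s *\<^sub>R v\<close> with \<open>\<bar>s\<bar> \<le> 1\<close>.\<close>
  define c :: 'a where "c = (\<Sum>i\<in>Basis. norm v *\<^sub>R i)"
  define A B where "A = a - c" and "B = b + c"
  have c_i: "c \<bullet> i = norm v" if "i \<in> Basis" for i
    using that by (simp add: c_def inner_sum_left_Basis)
  have sub: "cbox a b \<subseteq> cbox (A + s *\<^sub>R v) (B + s *\<^sub>R v)" if "s \<in> {-1..1}" for s
  proof
    fix x assume x: "x \<in> cbox a b"
    have "A \<bullet> i + s * (v \<bullet> i) \<le> x \<bullet> i \<and> x \<bullet> i \<le> B \<bullet> i + s * (v \<bullet> i)" if i: "i \<in> Basis" for i
    proof -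
      have "\<bar>s * (v \<bullet> i)\<bar> \<le> 1 * norm v"
        unfolding abs_mult using \<open>s \<in> {-1..1}\<close> Basis_le_norm[OF i, of v]
        by (intro mult_mono) auto
      then show ?thesis
        using x i c_i[OF i] by (auto simp: A_def B_def mem_box inner_simps abs_le_iff dest!: bspec[OF _ i])
    qed
    then show "x \<in> cbox (A + s *\<^sub>R v) (B + s *\<^sub>R v)"
      by (auto simp: mem_box inner_simps)
  qed
  have int_f: "(f has_integral I) T" if "cbox a b \<subseteq> T" "I = integral UNIV f" for T I
  proof -
    have "f integrable_on cbox a b"
      by (intro integrable_continuous smooth_continuous_on f)
    then have *: "(f has_integral integral (cbox a b) f) S" if "cbox a b \<subseteq> S" for S
      using supp that by (intro has_integral_on_superset[OF integrable_integral]) auto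
    from *[OF that(1)] *[of UNIV] that(2) show ?thesis
      by (simp add: integral_unique)
  qed
  define g where "g = (\<lambda>s x. gradient f (x + s *\<^sub>R v) \<bullet> v)"
  have d: "((\<lambda>s. integral (cbox A B) (\<lambda>x. f (x + s *\<^sub>R v))) has_field_derivative
      integral (cbox A B) (g 0)) (at 0 within {-1..1})"
  proof (rule leibniz_rule_field_derivative)
    fix s :: real and x
    have "((\<lambda>s. x + s *\<^sub>R v) has_derivative (\<lambda>h. h *\<^sub>R v)) (at s)"
      by (auto intro!: derivative_eq_intros)
    from has_derivative_compose[OF this smooth_GDERIV[OF f, unfolded gderiv_def]]
    have *: "((\<lambda>s. f (x + s *\<^sub>R v)) has_derivative
        (\<lambda>h. (h *\<^sub>R v) \<bullet> gradient f (x + s *\<^sub>R v))) (at s)" .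
    show "((\<lambda>s. f (x + s *\<^sub>R v)) has_field_derivative g s x) (at s within {-1..1})"
    proof (rule has_field_derivative_at_within)
      have "(\<lambda>h. (h *\<^sub>R v) \<bullet> gradient f (x + s *\<^sub>R v)) = (*) (g s x)"
        unfolding g_def by (subst inner_commute) (simp add: fun_eq_iff mult.commute)
      with * show "((\<lambda>s. f (x + s *\<^sub>R v)) has_field_derivative g s x) (at s)"
        unfolding has_field_derivative_def by metis
    qed
  next
    fix s
    show "(\<lambda>x. f (x + s *\<^sub>R v)) integrable_on cbox A B"
      by (intro integrable_continuous continuous_on_compose2[OF smooth_continuous_on[OF f, of UNIV]]
          continuous_intros) auto
  next
    show "continuous_on ({- 1..1} \<times> cbox A B) (\<lambda>(s, x). g s x)"
      unfolding g_def split_beta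
      by (intro continuous_intros continuous_on_compose2[OF continuous_on_gradient[OF f, of UNIV]]) auto
  qed auto
  have const: "integral (cbox A B) (\<lambda>x. f (x + s *\<^sub>R v)) = integral UNIV f" if "s \<in> {-1..1}" for s
    using integral_shift_cbox_plus[of A B f "s *\<^sub>R v"] int_f[OF sub[OF that] refl]
    by (simp add: integral_unique o_def add.commute)
  have "((\<lambda>s. integral UNIV f) has_field_derivative integral (cbox A B) (g 0))
      (at 0 within {-1..1})"
    by (rule has_field_derivative_transform_within[OF d zero_less_one]) (use const in auto)
  moreover have "at (0::real) within {-1..1} = at 0"
    by (intro at_within_interior) auto
  ultimately have "integral (cbox A B) (g 0) = 0"
    using DERIV_unique[OF _ DERIV_const[of "integral UNIV f" "at 0"]] by simp
  moreover have g0: "integrable lebesgue (g 0)"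
    unfolding g_def using f
    by (intro integrable_continuous_supported_cbox[of _ a b])
      (auto intro!: continuous_intros continuous_on_gradient simp: gradient_zero_outside_cbox[OF supp])
  moreover have "integral UNIV (g 0) = integral (cbox A B) (g 0)"
  proof -
    have "g 0 x = 0" if "x \<notin> cbox A B" for x
      using that sub[of 0] gradient_zero_outside_cbox[of a b f x, OF supp]
      by (cases "x \<in> cbox a b") (auto simp: g_def)
    moreover have "g 0 integrable_on cbox A B"
      unfolding g_def
      by (intro integrable_continuous continuous_intros
          continuous_on_compose2[OF continuous_on_gradient[OF f, of UNIV]]) auto
    ultimately have "(g 0 has_integral integral (cbox A B) (g 0)) UNIV"
      by (intro has_integral_on_superset[OF integrable_integral]) auto
    then show ?thesis by (rule integral_unique)
  qed
  ultimately show ?thesis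
    using integral_lebesgue[OF g0] by (simp add: g_def)
qed

section \<open>Mean approximation of bounded measurable functions on a box\<close>

text \<open>A measurable function is an a.e. limit of continuous ones; dominated convergence makes
  this a limit in the mean on the box, and Stone-Weierstrass replaces the continuous function by a
  polynomial, which is smooth.\<close>

lemma L1_approximation_by_polynomials:
  fixes h :: "'a::euclidean_space \<Rightarrow> real"
  assumes h: "h \<in> borel_measurable lebesgue" and bd: "\<And>x. \<bar>h x\<bar> \<le> N" and "e > 0"
  obtains P where "real_polynomial_function P"
    "(\<integral>x. indicator (cbox a b) x * \<bar>h x - P x\<bar> \<partial>lebesgue) < e"
proof -
  have "h measurable_on UNIV"
    using lebesgue_measurable_imp_measurable_on[of h UNIV] h by simp
  then obtain Z g where Z: "negligible Z" and g: "\<And>n. continuous_on UNIV (g n)"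
    and lim: "\<And>x. x \<notin> Z \<Longrightarrow> (\<lambda>n. g n x) \<longlonglongrightarrow> h x"
    unfolding measurable_on_def by auto
  \<comment> \<open>Truncation at level \<open>N\<close> provides the dominating constant and leaves
    the limit unchanged, since \<open>\<bar>h x\<bar> \<le> N\<close>.\<close>
  define k where "k = (\<lambda>n x. max (- N) (min N (g n x)))"
  have k: "continuous_on UNIV (k n)" for n
    unfolding k_def by (intro continuous_intros g)
  have N: "0 \<le> N" using bd[of 0] by linarith
  have kN: "\<bar>k n x\<bar> \<le> N" for n x using N by (auto simp: k_def)
  have [measurable]: "cbox a b \<in> sets lebesgue" by simp
  have [measurable]: "h \<in> borel_measurable lebesgue" "k n \<in> borel_measurable lebesgue" for n
    using h k[of n] by (auto simp: borel_measurable_continuous_onI measurable_completion)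
  have "(\<lambda>n. \<integral>x. indicator (cbox a b) x * \<bar>h x - k n x\<bar> \<partial>lebesgue) \<longlonglongrightarrow> (\<integral>x. 0 \<partial>(lebesgue :: 'a measure))"
  proof (rule integral_dominated_convergence)
    show "integrable lebesgue (\<lambda>x. 2 * N * indicator (cbox a b) x)"
      by (rule integrable_indicator_cbox)
    show "AE x in lebesgue. (\<lambda>n. indicator (cbox a b) x * \<bar>h x - k n x\<bar>) \<longlonglongrightarrow> 0"
    proof (rule AE_I')
      show "Z \<in> null_sets lebesgue" using Z by (simp add: negligible_iff_null_sets)
      have "(\<lambda>n. indicator (cbox a b) x * \<bar>h x - k n x\<bar>) \<longlonglongrightarrow> 0" if "x \<notin> Z" for x
      proof -
        have "(\<lambda>n. k n x) \<longlonglongrightarrow> max (- N) (min N (h x))"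
          unfolding k_def by (intro tendsto_intros lim that)
        moreover have "max (- N) (min N (h x)) = h x" using bd[of x] by auto
        ultimately have "(\<lambda>n. indicator (cbox a b) x * \<bar>h x - k n x\<bar>) \<longlonglongrightarrow> indicator (cbox a b) x * \<bar>h x - h x\<bar>"
          by (intro tendsto_intros) auto
        then show ?thesis by simp
      qed
      then show "{x \<in> space lebesgue. \<not> (\<lambda>n. indicator (cbox a b) x * \<bar>h x - k n x\<bar>) \<longlonglongrightarrow> 0} \<subseteq> Z"
        by auto
    qed
    fix n
    have "\<bar>h x - k n x\<bar> \<le> 2 * N" for x using kN[of n x] bd[of x] by linarith
    then show "AE x in lebesgue. norm (indicator (cbox a b) x * \<bar>h x - k n x\<bar>) \<le> 2 * N * indicator (cbox a b) x"
      by (auto simp: indicator_def)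
  qed auto
  then have "(\<lambda>n. \<integral>x. indicator (cbox a b) x * \<bar>h x - k n x\<bar> \<partial>lebesgue) \<longlonglongrightarrow> 0" by simp
  then have "\<forall>\<^sub>F n in sequentially. (\<integral>x. indicator (cbox a b) x * \<bar>h x - k n x\<bar> \<partial>lebesgue) < e / 2"
    using \<open>e > 0\<close> by (intro order_tendstoD(2)) auto
  then obtain n where n: "(\<integral>x. indicator (cbox a b) x * \<bar>h x - k n x\<bar> \<partial>lebesgue) < e / 2"
    by (auto simp: eventually_sequentially)
  define m where "m = measure lebesgue (cbox a b)"
  have m: "m \<ge> 0" by (simp add: m_def)
  \<comment> \<open>A uniform error \<open>e'\<close> costs at most
    \<open>e' * m \<le> e / 2\<close> on the box; the summand 1 keeps the denominator positive when
    \<open>m = 0\<close>.\<close>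
  define e' where "e' = e / (2 * (m + 1))"
  have e': "0 < e'" using \<open>e > 0\<close> m by (simp add: e'_def)
  obtain P where P: "real_polynomial_function P" and Pk: "\<And>x. x \<in> cbox a b \<Longrightarrow> \<bar>k n x - P x\<bar> < e'"
    using Stone_Weierstrass_real_polynomial_function[OF compact_cbox continuous_on_subset[OF k subset_UNIV] e']
    by blast
  have cP: "continuous_on UNIV P"
    using P smooth_real_polynomial_function smooth_continuous_on by blast
  have [measurable]: "P \<in> borel_measurable lebesgue"
    using cP by (simp add: borel_measurable_continuous_onI measurable_completion)
  have i1: "integrable lebesgue (\<lambda>x. indicator (cbox a b) x * \<bar>h x - k n x\<bar>)"
    using kN[of n] bd by (intro integrable_AE_bounded_cbox[where C = "2 * N" and a = a and b = b])
      (auto simp: indicator_def intro!: AE_I2 order_trans[OF abs_triangle_ineq4] add_mono[of _ N _ N, simplified mult_2[symmetric]])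
  have "(\<integral>x. indicator (cbox a b) x * \<bar>h x - P x\<bar> \<partial>lebesgue)
      \<le> (\<integral>x. indicator (cbox a b) x * \<bar>h x - k n x\<bar> + e' * indicator (cbox a b) x \<partial>lebesgue)"
  proof (rule integral_mono')
    show "integrable lebesgue (\<lambda>x. indicator (cbox a b) x * \<bar>h x - k n x\<bar> + e' * indicator (cbox a b) x)"
      by (intro Bochner_Integration.integrable_add i1 integrable_indicator_cbox)
    fix x
    show "indicator (cbox a b) x * \<bar>h x - P x\<bar> \<le> indicator (cbox a b) x * \<bar>h x - k n x\<bar> + e' * indicator (cbox a b) x"
      using Pk[of x] by (auto simp: indicator_def)
    show "0 \<le> indicator (cbox a b) x * \<bar>h x - k n x\<bar> + e' * indicator (cbox a b) x"
      using e' by simp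
  qed
  also have "\<dots> = (\<integral>x. indicator (cbox a b) x * \<bar>h x - k n x\<bar> \<partial>lebesgue) + e' * m"
    by (subst Bochner_Integration.integral_add[OF i1 integrable_indicator_cbox]) (simp add: m_def)
  also have "\<dots> < e / 2 + e / 2"
  proof (rule add_less_le_mono[OF n])
    have "m / (m + 1) \<le> 1" using m by (simp add: divide_le_eq_1)
    then have "e / 2 * (m / (m + 1)) \<le> e / 2 * 1"
      using \<open>e > 0\<close> by (intro mult_left_mono) auto
    then show "e' * m \<le> e / 2" by (simp add: e'_def)
  qed
  finally show thesis using that[OF P] by simp
qed

section \<open>Mollification\<close>

text \<open>Differentiation under the integral sign. The Leibniz rule takes derivatives as bounded
  linear maps, hence the passage through \<open>blinfun_inner_left\<close>.\<close>

lemma GDERIV_convolution: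
  fixes k :: "'a::euclidean_space \<Rightarrow> real"
  assumes g: "continuous_on (cbox a b) g" and k: "smooth k"
  shows "GDERIV (\<lambda>x. integral (cbox a b) (\<lambda>y. g y * k (x - y))) x :>
    integral (cbox a b) (\<lambda>y. g y *\<^sub>R gradient k (x - y))"
proof -
  let ?F = "\<lambda>x y. g y *\<^sub>R gradient k (x - y)"
  have cF: "continuous_on (cbox a b) (?F x)" for x
    by (intro continuous_intros g continuous_on_compose2[OF continuous_on_gradient[OF k, of UNIV]]) auto
  have "((\<lambda>x. integral (cbox a b) (\<lambda>y. g y * k (x - y))) has_derivative
      blinfun_apply (integral (cbox a b) (\<lambda>y. blinfun_inner_left (?F x y)))) (at x within UNIV)"
  proof (rule leibniz_rule)
    fix x y :: 'a
    have d: "((\<lambda>x. x - y) has_derivative (\<lambda>h. h)) (at x)"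
      by (auto intro!: derivative_eq_intros)
    have "((\<lambda>x. k (x - y)) has_derivative (\<lambda>h. h \<bullet> gradient k (x - y))) (at x)"
      using has_derivative_compose[OF d smooth_GDERIV[OF k, unfolded gderiv_def]] .
    then have "((\<lambda>x. g y * k (x - y)) has_derivative (\<lambda>h. g y * (h \<bullet> gradient k (x - y)))) (at x)"
      by (intro derivative_intros)
    then show "((\<lambda>x. g y * k (x - y)) has_derivative blinfun_apply (blinfun_inner_left (?F x y)))
        (at x within UNIV)" by simp
  next
    fix x
    show "(\<lambda>y. g y * k (x - y)) integrable_on cbox a b"
      by (intro integrable_continuous continuous_intros g
          continuous_on_compose2[OF smooth_continuous_on[OF k, of UNIV]]) auto
  next
    show "continuous_on (UNIV \<times> cbox a b) (\<lambda>(x, y). blinfun_inner_left (?F x y))"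
      unfolding split_beta
      by (intro bounded_linear.continuous_on[OF bounded_linear_blinfun_inner_left] continuous_intros
          continuous_on_compose2[OF g] continuous_on_compose2[OF continuous_on_gradient[OF k, of UNIV]]) auto
  qed auto
  moreover have "integral (cbox a b) (\<lambda>y. blinfun_inner_left (?F x y)) =
      blinfun_inner_left (integral (cbox a b) (?F x))"
    using integral_linear[OF integrable_continuous[OF cF] bounded_linear_blinfun_inner_left]
    by (simp add: o_def)
  ultimately show ?thesis
    by (simp add: gderiv_def)
qed

text \<open>A partial derivative of the convolution is the convolution with a partial derivative of
  \<open>k\<close>, so the induction generalises over the kernel while \<open>g\<close> stays merely
  continuous.\<close>

lemma smooth_convolution:
  fixes k :: "'a::euclidean_space \<Rightarrow> real"
  assumes g: "continuous_on (cbox a b) g" and k: "smooth k"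
  shows "smooth (\<lambda>x. integral (cbox a b) (\<lambda>y. g y * k (x - y)))"
proof -
  have "C_k n (\<lambda>x. integral (cbox a b) (\<lambda>y. g y * k (x - y)))" for n
    using k
  proof (induction n arbitrary: k)
    case 0
    show ?case
      unfolding C_k.simps
      by (intro continuous_at_imp_continuous_on ballI)
        (rule has_derivative_continuous[OF GDERIV_convolution[OF g 0, unfolded gderiv_def]])
  next
    case (Suc n)
    let ?u = "\<lambda>x. integral (cbox a b) (\<lambda>y. g y * k (x - y))"
    have "frechet_derivative ?u (at x) h = integral (cbox a b) (\<lambda>y. g y * (h \<bullet> gradient k (x - y)))"
      for x h
    proof -
      have "(\<lambda>y. g y *\<^sub>R gradient k (x - y)) integrable_on cbox a b"
        by (intro integrable_continuous continuous_intros g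
            continuous_on_compose2[OF continuous_on_gradient[OF Suc.prems, of UNIV]]) auto
      from integral_linear[OF this bounded_linear_inner_right[of h]]
      show ?thesis
        by (simp add: GDERIV_imp_frechet_derivative[OF GDERIV_convolution[OF g Suc.prems]] o_def)
    qed
    moreover have "?u differentiable (at x)" for x
      using GDERIV_convolution[OF g Suc.prems] unfolding gderiv_def differentiable_def by blast
    ultimately show ?case
      using Suc.IH[OF smooth_gradient_inner_Basis[OF Suc.prems]] by auto
  qed
  then show ?thesis by (simp add: smooth_def)
qed

lemma cball_subset_enlarged_cbox:
  assumes "x \<in> cbox a b" "s \<le> r"
  shows "cball x s \<subseteq> cbox (a - r *\<^sub>R One) (b + r *\<^sub>R One)"
proof
  fix y assume "y \<in> cball x s"
  then have n: "norm (y - x) \<le> r" using assms(2) by (simp add: dist_norm norm_minus_commute)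
  have "\<bar>(y - x) \<bullet> i\<bar> \<le> r" if "i \<in> Basis" for i
    using Basis_le_norm[OF that, of "y - x"] n by linarith
  then show "y \<in> cbox (a - r *\<^sub>R One) (b + r *\<^sub>R One)"
    using assms(1) by (fastforce simp: mem_box inner_simps abs_le_iff)
qed

text \<open>Averaging \<open>u\<close> against a smooth bump of small radius approximates it
  uniformly. With the bump as test function, \<open>gradient v\<close> turns out to be the same
  average of \<open>G\<close> and so inherits the bound \<open>M\<close>.\<close>

lemma mollification:
  fixes u :: "'a::euclidean_space \<Rightarrow> real"
  assumes wg: "weak_gradient \<Omega> u G" and u: "continuous_on \<Omega> u"
    and M: "AE x in lebesgue. x \<in> \<Omega> \<longrightarrow> norm (G x) \<le> M" "0 \<le> M"
    and sub: "cbox (a - r *\<^sub>R One) (b + r *\<^sub>R One) \<subseteq> \<Omega>" and r: "r > 0" and e: "e > 0"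
  obtains v where "smooth v" "\<And>x. x \<in> cbox a b \<Longrightarrow> \<bar>v x - u x\<bar> \<le> e"
    "\<And>x. x \<in> cbox a b \<Longrightarrow> norm (gradient v x) \<le> M"
proof -
  define A B where "A = a - r *\<^sub>R One" and "B = b + r *\<^sub>R One"
  let ?K = "cbox A B"
  have uK: "continuous_on ?K u"
    using u sub continuous_on_subset by (auto simp: A_def B_def)
  then have "uniformly_continuous_on ?K u"
    by (simp add: compact_uniformly_continuous)
  then obtain d where d: "d > 0" "\<And>x y. x \<in> ?K \<Longrightarrow> y \<in> ?K \<Longrightarrow> dist y x < d \<Longrightarrow> dist (u y) (u x) < e"
    unfolding uniformly_continuous_on_def using e by metis
  \<comment> \<open>\<open>s \<le> r\<close> keeps the balls around points of
    \<open>cbox a b\<close> inside \<open>\<Omega>\<close>; \<open>s \<le> d\<close> keeps them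
    within reach of the uniform continuity of \<open>u\<close>.\<close>
  define s where "s = min r d"
  have s: "0 < s" "s \<le> r" "s \<le> d" using r d by (auto simp: s_def)
  \<comment> \<open>Dependence on the squared norm makes the bump smooth at 0. Its mass
    \<open>c\<close> is divided out in \<open>v\<close>.\<close>
  define k :: "'a \<Rightarrow> real" where "k z = flat 0 (s\<^sup>2 - (norm z)\<^sup>2)" for z
  have k_eq: "k = (\<lambda>z. flat 0 (s\<^sup>2 - (norm (z - 0))\<^sup>2))" by (simp add: k_def fun_eq_iff)
  have k: "smooth k"
    unfolding k_eq
    by (intro smooth_compose[OF smooth_flat] smooth_diff smooth_const
        smooth_norm_sq_bounded_linear[OF bounded_linear_ident])
  have k0: "k z = 0" if "norm z \<ge> s" for z
    using that s(1) by (simp add: k_def power_mono)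
  have kn: "0 \<le> k z" for z by (simp add: k_def)
  have k_sym: "k (x - y) = k (y - x)" for x y by (simp add: k_def norm_minus_commute)
  have ck: "continuous_on S (\<lambda>y. k (x - y))" for x S
    by (intro continuous_on_compose2[OF smooth_continuous_on[OF k, of UNIV]] continuous_intros) auto
  define c where "c = integral UNIV k"
  have int_k: "(k has_integral c) T" if "cball 0 s \<subseteq> T" "T = cbox p q" for T p q
  proof -
    have "k integrable_on T"
      unfolding that by (intro integrable_continuous smooth_continuous_on k)
    moreover have "k x = 0" if "x \<notin> T" for x
      using k0[of x] \<open>cball 0 s \<subseteq> T\<close> that by (auto simp: subset_iff dest!: spec[of _ x])
    ultimately have "(k has_integral integral T k) UNIV"
      by (intro has_integral_on_superset[OF integrable_integral]) auto
    then have "c = integral T k" by (simp add: c_def integral_unique)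
    then show ?thesis using \<open>k integrable_on T\<close> by (simp add: integrable_integral)
  qed
  have "c > 0"
  proof -
    let ?T = "cbox (0 - s *\<^sub>R One) (0 + s *\<^sub>R One) :: 'a set"
    have T: "(k has_integral c) ?T"
      by (rule int_k[OF _ refl], rule cball_subset_enlarged_cbox) auto
    have "c \<ge> 0" using has_integral_nonneg[OF T] kn by blast
    moreover have "c \<noteq> 0"
    proof
      \<comment> \<open>A continuous nonnegative function with integral 0 vanishes inside the box,
        but the bump is positive at 0.\<close>
      assume "c = 0"
      have "k 0 = 0"
      proof (rule has_integral_0_cbox_imp_0[of _ _ k])
        show "(k has_integral 0) ?T" using T \<open>c = 0\<close> by simp
        show "box (0 - s *\<^sub>R One) (0 + s *\<^sub>R One :: 'a) \<noteq> {}"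
          using s by (auto simp: box_ne_empty inner_simps)
      qed (use s kn in \<open>auto intro: smooth_continuous_on k simp: mem_box inner_simps\<close>)
      then show False using s by (simp add: k_def flat_def)
    qed
    ultimately show ?thesis by simp
  qed
  have int_kx: "((\<lambda>y. k (x - y)) has_integral c) ?K" if x: "x \<in> cbox a b" for x
  proof -
    have "cball 0 s \<subseteq> cbox (A + - x) (B + - x)"
    proof
      fix z :: 'a assume "z \<in> cball 0 s"
      then have "x + z \<in> cball x s" by (simp add: dist_norm)
      then have "x + z \<in> ?K"
        using cball_subset_enlarged_cbox[OF x s(2)] unfolding A_def B_def by blast
      then show "z \<in> cbox (A + - x) (B + - x)"
        by (fastforce simp: mem_box inner_simps)
    qed
    from int_k[OF this refl] have "((k \<circ> (+) (- x)) has_integral c) ?K"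
      using has_integral_shift_cbox_iff[of k "- x" c A B] by simp
    then show ?thesis by (simp add: o_def k_sym[of x])
  qed
  define v where "v x = (1 / c) * integral ?K (\<lambda>y. u y * k (x - y))" for x
  have v: "smooth v"
    unfolding v_def by (intro smooth_cmult smooth_convolution uK k)
  have close: "\<bar>v x - u x\<bar> \<le> e" if x: "x \<in> cbox a b" for x
  proof -
    have xK: "x \<in> ?K"
      using cball_subset_enlarged_cbox[OF x s(2)] s(1) unfolding A_def B_def by auto
    have i1: "(\<lambda>y. u y * k (x - y)) integrable_on ?K"
      by (intro integrable_continuous continuous_intros uK ck)
    have i2: "((\<lambda>y. u x * k (x - y)) has_integral u x * c) ?K"
      using int_kx[OF x] by (rule has_integral_mult_right)
    have i3: "((\<lambda>y. e * k (x - y)) has_integral e * c) ?K"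
      using int_kx[OF x] by (rule has_integral_mult_right)
    have h: "((\<lambda>y. u y * k (x - y) - u x * k (x - y)) has_integral
        integral ?K (\<lambda>y. u y * k (x - y)) - u x * c) ?K"
      by (intro has_integral_diff integrable_integral i1 i2)
    have "norm (integral ?K (\<lambda>y. u y * k (x - y) - u x * k (x - y))) \<le> integral ?K (\<lambda>y. e * k (x - y))"
    proof (rule integral_norm_bound_integral)
      fix y assume y: "y \<in> ?K"
      show "norm (u y * k (x - y) - u x * k (x - y)) \<le> e * k (x - y)"
      proof (cases "norm (x - y) < s")
        case True
        then have "dist (u y) (u x) < e"
          using d(2)[OF xK y] s by (simp add: dist_norm norm_minus_commute)
        then have "\<bar>u y - u x\<bar> * k (x - y) \<le> e * k (x - y)"
          using kn by (intro mult_right_mono) (auto simp: dist_real_def)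
        then show ?thesis using kn by (simp add: left_diff_distrib[symmetric] abs_mult)
      qed (use k0 in auto)
    qed (use h i3 in \<open>auto simp: integrable_on_def\<close>)
    then have *: "\<bar>integral ?K (\<lambda>y. u y * k (x - y)) - u x * c\<bar> \<le> e * c"
      unfolding integral_unique[OF h] integral_unique[OF i3] real_norm_def .
    have "v x - u x = (integral ?K (\<lambda>y. u y * k (x - y)) - u x * c) / c"
      using \<open>c > 0\<close> by (simp add: v_def field_simps)
    then show ?thesis using * \<open>c > 0\<close> by (simp add: divide_le_eq)
  qed
  have grad: "norm (gradient v x) \<le> M" if x: "x \<in> cbox a b" for x
  proof -
    have sK: "cball x s \<subseteq> ?K"
      using cball_subset_enlarged_cbox[OF x s(2)] by (simp add: A_def B_def)
    have KO: "?K \<subseteq> \<Omega>" using sub by (simp add: A_def B_def)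
    define \<psi> where "\<psi> = (\<lambda>y. k (x - y))"
    have \<psi>_eq: "\<psi> = (\<lambda>y. flat 0 (s\<^sup>2 - (norm (y - x))\<^sup>2))"
      by (simp add: \<psi>_def k_def fun_eq_iff norm_minus_commute)
    have \<psi>0: "\<psi> y = 0" if "y \<notin> cball x s" for y
      using that k0[of "x - y"] by (auto simp: \<psi>_def dist_norm)
    have sm: "smooth \<psi>"
      unfolding \<psi>_eq
      by (intro smooth_compose[OF smooth_flat] smooth_diff smooth_const
          smooth_norm_sq_bounded_linear[OF bounded_linear_ident])
    have supp: "{y. \<psi> y \<noteq> 0} \<subseteq> cball x s" using \<psi>0 by blast
    have test: "\<psi> \<in> test_functions \<Omega>"
      by (rule test_functionsI[OF sm supp compact_cball]) (use sK KO in blast)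
    have g\<psi>: "gradient \<psi> y = - gradient k (x - y)" for y
    proof (rule gradient_eqI)
      have d: "((\<lambda>y. x - y) has_derivative (\<lambda>h. - h)) (at y)"
        by (auto intro!: derivative_eq_intros)
      show "GDERIV \<psi> y :> - gradient k (x - y)"
        using has_derivative_compose[OF d smooth_GDERIV[OF k, unfolded gderiv_def]]
        by (simp add: gderiv_def \<psi>_def)
    qed
    have g\<psi>0: "gradient \<psi> y = 0" if "y \<notin> ?K" for y
      by (rule gradient_zero_outside[OF closure_minimal[OF supp closed_cball]]) (use that sK in blast)
    have "GDERIV v x :> (1 / c) *\<^sub>R integral ?K (\<lambda>y. u y *\<^sub>R gradient k (x - y))"
      unfolding v_def using GDERIV_convolution[OF uK k, of x]
      using \<open>c > 0\<close> by (auto simp: gderiv_def intro!: derivative_eq_intros)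
    then have "gradient v x = (1 / c) *\<^sub>R integral ?K (\<lambda>y. u y *\<^sub>R gradient k (x - y))"
      by (rule gradient_eqI)
    also have "integral ?K (\<lambda>y. u y *\<^sub>R gradient k (x - y)) = - integral ?K (\<lambda>y. u y *\<^sub>R gradient \<psi> y)"
      by (simp add: g\<psi>)
    also have "integral ?K (\<lambda>y. u y *\<^sub>R gradient \<psi> y) = (LINT y:?K|lebesgue. u y *\<^sub>R gradient \<psi> y)"
      by (intro set_lebesgue_integral_eq_integral(2)[symmetric] absolutely_integrable_continuous
          continuous_intros uK continuous_on_gradient sm)
    also have "\<dots> = (LINT y:\<Omega>|lebesgue. u y *\<^sub>R gradient \<psi> y)"
      unfolding set_lebesgue_integral_def using KO g\<psi>0
      by (intro Bochner_Integration.integral_cong) (auto simp: indicator_def)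
    \<comment> \<open>The definition of the weak gradient moves the derivative from the bump to
      \<open>u\<close>.\<close>
    also have "\<dots> = - (LINT y:\<Omega>|lebesgue. \<psi> y *\<^sub>R G y)"
      using wg test by (simp add: weak_gradient_def)
    finally have eq: "gradient v x = (1 / c) *\<^sub>R (LINT y:\<Omega>|lebesgue. \<psi> y *\<^sub>R G y)" by simp
    have int: "set_integrable lebesgue ?K (\<lambda>y. M * \<psi> y)"
      unfolding \<psi>_def by (intro absolutely_integrable_continuous continuous_intros ck)
    have "norm (LINT y:\<Omega>|lebesgue. \<psi> y *\<^sub>R G y) \<le> (LINT y:?K|lebesgue. M * \<psi> y)"
      unfolding set_lebesgue_integral_def
    proof (rule order_trans[OF integral_norm_bound], rule integral_mono_AE')
      show "integrable lebesgue (\<lambda>y. indicat_real ?K y *\<^sub>R (M * \<psi> y))"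
        using int by (simp add: set_integrable_def)
      show "AE y in lebesgue. norm (indicat_real \<Omega> y *\<^sub>R \<psi> y *\<^sub>R G y) \<le> indicat_real ?K y *\<^sub>R (M * \<psi> y)"
        using M(1)
      proof eventually_elim
        case (elim y)
        show ?case
        proof (cases "y \<in> ?K")
          case True
          with elim KO have "norm (G y) \<le> M" by auto
          then have "\<psi> y * norm (G y) \<le> M * \<psi> y"
            using kn[of "x - y"] by (simp add: \<psi>_def mult.commute mult_right_mono)
          with True KO kn[of "x - y"] show ?thesis by (auto simp: \<psi>_def)
        next
          case False
          then have "\<psi> y = 0" using \<psi>0 sK by blast
          with False show ?thesis by simp
        qed
      qed
      show "AE y in lebesgue. 0 \<le> indicat_real ?K y *\<^sub>R (M * \<psi> y)"
        using M(2) kn by (simp add: \<psi>_def)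
    qed
    also have "\<dots> = M * c"
    proof -
      have "((\<lambda>y. M * \<psi> y) has_integral M * c) ?K"
        unfolding \<psi>_def by (rule has_integral_mult_right[OF int_kx[OF x]])
      then show ?thesis
        unfolding set_lebesgue_integral_eq_integral(2)[OF int] by (rule integral_unique)
    qed
    finally show ?thesis
      using \<open>c > 0\<close> by (simp add: eq divide_le_eq)
  qed
  show thesis using that[OF v close grad] .
qed

section \<open>Testing with compositions of the weakly differentiable function\<close>

lemma borel_measurable_lebesgue_continuous:
  "continuous_on UNIV f \<Longrightarrow> f \<in> borel_measurable lebesgue"
  by (simp add: borel_measurable_continuous_onI measurable_completion)

lemma continuous_supported_cbox_bounded:
  fixes f :: "'a::euclidean_space \<Rightarrow> 'b::euclidean_space"
  assumes "continuous_on (cbox a b) f" "\<And>x. x \<notin> cbox a b \<Longrightarrow> f x = 0"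
  obtains C where "0 \<le> C" "\<And>x. norm (f x) \<le> C" "\<And>x. norm (f x) \<le> C * indicator (cbox a b) x"
proof -
  have "bounded (f ` cbox a b)"
    using assms(1) by (intro compact_imp_bounded compact_continuous_image) auto
  then obtain C where "C > 0" "\<forall>x\<in>cbox a b. norm (f x) \<le> C"
    by (auto simp: bounded_pos)
  then have "norm (f x) \<le> C * indicator (cbox a b) x" "norm (f x) \<le> C" for x
    using assms(2)[of x] by (auto simp: indicator_def)
  with \<open>C > 0\<close> show thesis by (intro that[of C]) auto
qed

text \<open>For a smooth weight, integration by parts moves the derivative off \<open>v n\<close>,
  and uniform convergence to \<open>u\<close> suffices. The merely measurable weight
  \<open>h\<close> is replaced by a polynomial at a cost uniform in \<open>n\<close>, because all
  fields are bounded by \<open>M\<close>.\<close>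

lemma weak_convergence_gradients:
  fixes h u :: "'a::euclidean_space \<Rightarrow> real" and G :: "'a \<Rightarrow> 'a"
  assumes \<zeta>: "smooth \<zeta>" and supp: "\<And>x. x \<notin> cbox a b \<Longrightarrow> \<zeta> x = 0"
    and h [measurable]: "h \<in> borel_measurable lebesgue" and hN: "\<And>x. \<bar>h x\<bar> \<le> N"
    and u [measurable]: "u \<in> borel_measurable lebesgue" and uU: "\<And>x. \<bar>u x\<bar> \<le> U"
    and G [measurable]: "G \<in> borel_measurable lebesgue" and GM: "\<And>x. norm (G x) \<le> M"
    and parts: "\<And>g. smooth g \<Longrightarrow> (\<And>x. x \<notin> cbox a b \<Longrightarrow> g x = 0) \<Longrightarrow>
      (\<integral>x. u x * (gradient g x \<bullet> w) \<partial>lebesgue) = - (\<integral>x. g x * (G x \<bullet> w) \<partial>lebesgue)"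
    and v: "\<And>n. smooth (v n)" and vM: "\<And>n x. x \<in> cbox a b \<Longrightarrow> norm (gradient (v n) x) \<le> M"
    and vu: "\<And>n x. x \<in> cbox a b \<Longrightarrow> \<bar>v n x - u x\<bar> \<le> 1 / real (Suc n)"
  shows "(\<lambda>n. \<integral>x. \<zeta> x * h x * (gradient (v n) x \<bullet> w) \<partial>lebesgue)
      \<longlonglongrightarrow> (\<integral>x. \<zeta> x * h x * (G x \<bullet> w) \<partial>lebesgue)"
proof (rule LIMSEQ_I)
  fix e :: real assume e: "e > 0"
  let ?K = "cbox a b"
  have [measurable]: "?K \<in> sets lebesgue" by simp
  have M: "0 \<le> M" using GM[of 0] norm_ge_zero order_trans by blast
  obtain Z where Z: "0 \<le> Z" "\<And>x. norm (\<zeta> x) \<le> Z" "\<And>x. norm (\<zeta> x) \<le> Z * indicator ?K x"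
    using continuous_supported_cbox_bounded[OF smooth_continuous_on[OF \<zeta>] supp] by blast
  define Q where "Q = Z * M * norm w"
  have Q: "0 \<le> Q" using Z M by (simp add: Q_def)
  \<comment> \<open>Two replacements of \<open>h\<close> cost \<open>2 * (Q * e')\<close>, at most
    \<open>e / 2\<close>; the other half is left for the convergence in \<open>n\<close>.\<close>
  define e' where "e' = e / (4 * (Q + 1))"
  have e': "e' > 0" using e Q by (simp add: e'_def)
  obtain P where P: "real_polynomial_function P"
    and hP: "(\<integral>x. indicator ?K x * \<bar>h x - P x\<bar> \<partial>lebesgue) < e'"
    using L1_approximation_by_polynomials[OF h hN e'] by blast
  define g where "g x = \<zeta> x * P x" for x
  have sP: "smooth P" by (rule smooth_real_polynomial_function[OF P])
  have g: "smooth g" unfolding g_def by (intro smooth_mult \<zeta> sP)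
  have g0: "g x = 0" if "x \<notin> ?K" for x using supp[OF that] by (simp add: g_def)
  have [measurable]: "\<zeta> \<in> borel_measurable lebesgue" "P \<in> borel_measurable lebesgue"
    "g \<in> borel_measurable lebesgue" "v n \<in> borel_measurable lebesgue"
    "gradient (v n) \<in> borel_measurable lebesgue" "gradient g \<in> borel_measurable lebesgue" for n
    by (intro borel_measurable_lebesgue_continuous smooth_continuous_on continuous_on_gradient
        \<zeta> sP g v)+
  have P_bd: "\<exists>C. \<forall>x\<in>?K. \<bar>P x\<bar> \<le> C"
    using compact_imp_bounded[OF compact_continuous_image[OF smooth_continuous_on[OF sP] compact_cbox]]
    by (auto simp: bounded_iff)
  then obtain CP where CP: "\<And>x. x \<in> ?K \<Longrightarrow> \<bar>P x\<bar> \<le> CP" by blast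
  obtain Cg where Cg: "0 \<le> Cg" "\<And>x. norm (gradient g x) \<le> Cg" "\<And>x. norm (gradient g x) \<le> Cg * indicator ?K x"
    using continuous_supported_cbox_bounded[OF continuous_on_gradient[OF g], of a b]
      gradient_zero_outside_cbox[of a b g, OF g0] by blast
  have int_hP: "integrable lebesgue (\<lambda>x. indicator ?K x * \<bar>h x - P x\<bar>)"
    using hN CP by (intro integrable_AE_bounded_cbox[where C = "N + CP" and a = a and b = b])
      (auto simp: indicator_def intro!: AE_I2 order_trans[OF abs_triangle_ineq4] add_mono)
  text \<open>Replacing \<open>h\<close> by the polynomial \<open>P\<close> costs little, uniformly over fields bounded by \<open>M\<close>.\<close>
  have swap: "\<bar>(\<integral>x. \<zeta> x * h x * (F x \<bullet> w) \<partial>lebesgue) - (\<integral>x. g x * (F x \<bullet> w) \<partial>lebesgue)\<bar> \<le> Q * e'"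
    if F [measurable]: "F \<in> borel_measurable lebesgue" and FM: "\<And>x. x \<in> ?K \<Longrightarrow> norm (F x) \<le> M" for F :: "'a \<Rightarrow> 'a"
  proof -
    have bd: "\<bar>\<zeta> x * t * (F x \<bullet> w)\<bar> \<le> Q * (indicator ?K x * \<bar>t\<bar>)" for x t
    proof (cases "x \<in> ?K")
      case True
      have "\<bar>F x \<bullet> w\<bar> \<le> M * norm w"
        using Cauchy_Schwarz_ineq2[of "F x" w] FM[OF True] mult_right_mono[of "norm (F x)" M "norm w"]
        by fastforce
      then have "\<bar>\<zeta> x\<bar> * \<bar>F x \<bullet> w\<bar> * \<bar>t\<bar> \<le> Z * (M * norm w) * \<bar>t\<bar>"
        using Z M by (intro mult_right_mono mult_mono) auto
      with True show ?thesis by (simp add: Q_def abs_mult mult_ac)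
    qed (simp add: supp)
    have i1: "integrable lebesgue (\<lambda>x. \<zeta> x * h x * (F x \<bullet> w))"
    proof (rule integrable_AE_bounded_cbox[where C = "Q * N" and a = a and b = b])
      have "\<bar>\<zeta> x * h x * (F x \<bullet> w)\<bar> \<le> Q * N * indicator ?K x" for x
        using bd[of x "h x"] mult_left_mono[OF hN[of x] Q] by (auto simp: indicator_def split: if_splits)
      then show "AE x in lebesgue. norm (\<zeta> x * h x * (F x \<bullet> w)) \<le> Q * N * indicator ?K x" by simp
    qed measurable
    have i2: "integrable lebesgue (\<lambda>x. g x * (F x \<bullet> w))"
    proof (rule integrable_AE_bounded_cbox[where C = "Q * CP" and a = a and b = b])
      have "\<bar>g x * (F x \<bullet> w)\<bar> \<le> Q * CP * indicator ?K x" for x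
        using bd[of x "P x"] mult_left_mono[OF CP[of x] Q]
        by (auto simp: indicator_def g_def split: if_splits)
      then show "AE x in lebesgue. norm (g x * (F x \<bullet> w)) \<le> Q * CP * indicator ?K x" by simp
    qed measurable
    have "(\<integral>x. \<zeta> x * h x * (F x \<bullet> w) \<partial>lebesgue) - (\<integral>x. g x * (F x \<bullet> w) \<partial>lebesgue)
        = (\<integral>x. \<zeta> x * (h x - P x) * (F x \<bullet> w) \<partial>lebesgue)"
      by (subst Bochner_Integration.integral_diff[OF i1 i2, symmetric]) (simp add: g_def algebra_simps)
    also have "\<bar>\<dots>\<bar> \<le> (\<integral>x. Q * (indicator ?K x * \<bar>h x - P x\<bar>) \<partial>lebesgue)"
      unfolding real_norm_def[symmetric]
      by (rule order_trans[OF integral_norm_bound], rule integral_mono')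
        (use bd int_hP Q in auto)
    also have "\<dots> \<le> Q * e'"
      using hP Q int_hP by (simp add: mult_left_mono)
    finally show ?thesis .
  qed
  define I where "I = (\<integral>x. norm (gradient g x) \<partial>lebesgue)"
  have iI: "integrable lebesgue (\<lambda>x. norm (gradient g x))"
    by (rule integrable_AE_bounded_cbox[where C = Cg and a = a and b = b]) (use Cg in auto)
  have I: "0 \<le> I" by (simp add: I_def)
  have diff: "\<bar>(\<integral>x. g x * (gradient (v n) x \<bullet> w) \<partial>lebesgue) - (\<integral>x. g x * (G x \<bullet> w) \<partial>lebesgue)\<bar>
      \<le> norm w * I / real (Suc n)" for n
  proof -
    have gv: "gradient (\<lambda>x. g x * v n x) x = g x *\<^sub>R gradient (v n) x + v n x *\<^sub>R gradient g x" for x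
      by (rule gradient_eqI)
        (rule GDERIV_mult[OF smooth_GDERIV[OF g] smooth_GDERIV[OF v]])
    have j1: "integrable lebesgue (\<lambda>x. g x * (gradient (v n) x \<bullet> w))"
      using g0 by (intro integrable_continuous_supported_cbox[of _ a b] continuous_intros
          smooth_continuous_on[OF g] continuous_on_gradient[OF v]) auto
    have j2: "integrable lebesgue (\<lambda>x. v n x * (gradient g x \<bullet> w))"
      using gradient_zero_outside_cbox[of a b g, OF g0]
      by (intro integrable_continuous_supported_cbox[of _ a b] continuous_intros
          smooth_continuous_on[OF v] continuous_on_gradient[OF g]) auto
    have gw: "\<bar>gradient g x \<bullet> w\<bar> \<le> norm w * norm (gradient g x)" for x
      using Cauchy_Schwarz_ineq2[of "gradient g x" w] by (simp add: mult.commute)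
    have j3: "integrable lebesgue (\<lambda>x. u x * (gradient g x \<bullet> w))"
    proof (rule integrable_AE_bounded_cbox[where C = "U * (norm w * Cg)" and a = a and b = b])
      have "\<bar>u x * (gradient g x \<bullet> w)\<bar> \<le> U * (norm w * Cg) * indicator ?K x" for x
      proof -
        have "\<bar>u x\<bar> * \<bar>gradient g x \<bullet> w\<bar> \<le> U * (norm w * (Cg * indicator ?K x))"
          using uU[of x] gw[of x] mult_left_mono[OF Cg(3)[of x], of "norm w"]
          by (intro mult_mono) (auto intro: order_trans[OF abs_ge_zero])
        then show ?thesis by (simp add: abs_mult mult_ac)
      qed
      then show "AE x in lebesgue. norm (u x * (gradient g x \<bullet> w)) \<le> U * (norm w * Cg) * indicator ?K x" by simp
    qed measurable
    \<comment> \<open>The gradient of the compactly supported \<open>g * v n\<close> has integral 0,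
      which is integration by parts for \<open>v n\<close>. Together with \<open>parts\<close> for
      \<open>u\<close>, only the difference \<open>u - v n\<close> remains.\<close>
    have "0 = (\<integral>x. gradient (\<lambda>x. g x * v n x) x \<bullet> w \<partial>lebesgue)"
      using integral_gradient_eq_0[OF smooth_mult[OF g v[of n]], of a b w] g0 by simp
    also have "\<dots> = (\<integral>x. g x * (gradient (v n) x \<bullet> w) \<partial>lebesgue) + (\<integral>x. v n x * (gradient g x \<bullet> w) \<partial>lebesgue)"
      unfolding gv inner_add_left inner_scaleR_left
      by (rule Bochner_Integration.integral_add[OF j1 j2])
    finally have "(\<integral>x. g x * (gradient (v n) x \<bullet> w) \<partial>lebesgue) - (\<integral>x. g x * (G x \<bullet> w) \<partial>lebesgue)
       = (\<integral>x. u x * (gradient g x \<bullet> w) \<partial>lebesgue) - (\<integral>x. v n x * (gradient g x \<bullet> w) \<partial>lebesgue)"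
      using parts[OF g g0] by simp
    also have "\<dots> = (\<integral>x. (u x - v n x) * (gradient g x \<bullet> w) \<partial>lebesgue)"
      by (subst Bochner_Integration.integral_diff[OF j3 j2, symmetric]) (simp add: algebra_simps)
    also have "\<bar>\<dots>\<bar> \<le> (\<integral>x. norm w / real (Suc n) * norm (gradient g x) \<partial>lebesgue)"
      unfolding real_norm_def[symmetric]
    proof (rule order_trans[OF integral_norm_bound], rule integral_mono')
      show "integrable lebesgue (\<lambda>x. norm w / real (Suc n) * norm (gradient g x))"
        by (intro integrable_mult_right iI)
      fix x
      show "norm ((u x - v n x) * (gradient g x \<bullet> w)) \<le> norm w / real (Suc n) * norm (gradient g x)"
      proof (cases "x \<in> ?K")
        case True
        have "\<bar>u x - v n x\<bar> * \<bar>gradient g x \<bullet> w\<bar> \<le> 1 / real (Suc n) * (norm w * norm (gradient g x))"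
          using vu[OF True, of n] gw[of x] by (intro mult_mono) (auto simp: abs_minus_commute)
        then show ?thesis by (simp add: abs_mult)
      qed (simp add: gradient_zero_outside_cbox[of a b g, OF g0])
    qed auto
    finally show ?thesis by (simp add: I_def)
  qed
  have "(\<lambda>n. norm w * I / real (Suc n)) \<longlonglongrightarrow> 0"
    by (rule LIMSEQ_Suc[OF tendsto_divide_0[OF tendsto_const]]) (simp add: filterlim_at_infinity_imp_norm_at_top filterlim_real_sequentially filterlim_at_top_imp_at_infinity)
  then have "\<forall>\<^sub>F n in sequentially. norm w * I / real (Suc n) < e / 2"
    using e by (intro order_tendstoD(2)) auto
  then obtain n0 where n0: "\<And>n. n \<ge> n0 \<Longrightarrow> norm w * I / real (Suc n) < e / 2"
    by (auto simp: eventually_sequentially)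
  have Qe: "2 * (Q * e') \<le> e / 2"
  proof -
    have "Q / (Q + 1) \<le> 1" using Q by (simp add: divide_le_eq_1)
    then have "e / 2 * (Q / (Q + 1)) \<le> e / 2 * 1"
      using e by (intro mult_left_mono) auto
    moreover have "2 * (Q * e') = e / 2 * (Q / (Q + 1))"
      using Q by (simp add: e'_def divide_simps)
    ultimately show ?thesis by simp
  qed
  show "\<exists>n0. \<forall>n\<ge>n0. norm ((\<integral>x. \<zeta> x * h x * (gradient (v n) x \<bullet> w) \<partial>lebesgue)
      - (\<integral>x. \<zeta> x * h x * (G x \<bullet> w) \<partial>lebesgue)) < e"
  proof (intro exI allI impI)
    fix n assume "n \<ge> n0"
    have "\<bar>(\<integral>x. \<zeta> x * h x * (gradient (v n) x \<bullet> w) \<partial>lebesgue) - (\<integral>x. g x * (gradient (v n) x \<bullet> w) \<partial>lebesgue)\<bar> \<le> Q * e'"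
      "\<bar>(\<integral>x. \<zeta> x * h x * (G x \<bullet> w) \<partial>lebesgue) - (\<integral>x. g x * (G x \<bullet> w) \<partial>lebesgue)\<bar> \<le> Q * e'"
      by (rule swap; use vM GM in simp)+
    with diff[of n] n0[OF \<open>n \<ge> n0\<close>] Qe show "norm ((\<integral>x. \<zeta> x * h x * (gradient (v n) x \<bullet> w) \<partial>lebesgue)
      - (\<integral>x. \<zeta> x * h x * (G x \<bullet> w) \<partial>lebesgue)) < e"
      unfolding real_norm_def by linarith
  qed
qed

text \<open>\<open>pos\<close> says that the divergence of \<open>B\<close> is nonpositive as a
  distribution; the claim is what testing with \<zeta> \<Phi>(u) should give. The test function
  \<zeta> \<Phi>(v) is admissible for smooth \<open>v\<close>; in its gradient only
  \<open>gradient v\<close> converges weakly, everything else strongly.\<close>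

lemma nonneg_flux_composition:
  fixes u :: "'a::euclidean_space \<Rightarrow> real" and B G :: "'a \<Rightarrow> 'a"
  assumes \<Omega>: "open \<Omega>"
    and wg: "weak_gradient \<Omega> u G" and u: "continuous_on \<Omega> u"
    and M: "AE x in lebesgue. x \<in> \<Omega> \<longrightarrow> norm (G x) \<le> M" "0 \<le> M"
    and B: "set_borel_measurable lebesgue \<Omega> B" "AE x in lebesgue. x \<in> \<Omega> \<longrightarrow> norm (B x) \<le> N" "0 \<le> N"
    and pos: "\<And>\<psi>. \<psi> \<in> test_functions \<Omega> \<Longrightarrow> (\<And>x. 0 \<le> \<psi> x) \<Longrightarrow>
      0 \<le> (LINT x:\<Omega>|lebesgue. B x \<bullet> gradient \<psi> x)"
    and sub: "cbox (a - r *\<^sub>R One) (b + r *\<^sub>R One) \<subseteq> \<Omega>" and r: "r > 0"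
    and \<zeta>: "smooth \<zeta>" and supp: "\<And>x. x \<notin> cbox a b \<Longrightarrow> \<zeta> x = 0" and \<zeta>_nn: "\<And>x. 0 \<le> \<zeta> x"
    and \<Phi>: "smooth \<Phi>" "\<And>s. 0 \<le> \<Phi> s" and \<Phi>': "\<And>s. (\<Phi> has_real_derivative \<Phi>' s) (at s)"
    and c\<Phi>': "continuous_on UNIV \<Phi>'"
  shows "0 \<le> (LINT x:\<Omega>|lebesgue. \<Phi> (u x) * (B x \<bullet> gradient \<zeta> x) + \<zeta> x * \<Phi>' (u x) * (B x \<bullet> G x))"
proof -
  let ?K = "cbox a b"
  have KO: "?K \<subseteq> \<Omega>"
    using cball_subset_enlarged_cbox[of _ a b 0 r] r sub by fastforce
  have [measurable]: "?K \<in> sets lebesgue" "\<Omega> \<in> sets lebesgue" using \<Omega> by auto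
  \<comment> \<open>Changing values off the box, off \<open>\<Omega>\<close> or on a null set makes
    the three functions bounded and measurable everywhere.\<close>
  define u1 where "u1 x = indicator ?K x * (indicator \<Omega> x *\<^sub>R u x)" for x
  define G0 B0 where "G0 x = indicator \<Omega> x *\<^sub>R G x" and "B0 x = indicator \<Omega> x *\<^sub>R B x" for x
  define G1 where "G1 x = (if norm (G0 x) \<le> M then G0 x else 0)" for x
  define B1 where "B1 x = (if norm (B0 x) \<le> N then B0 x else 0)" for x
  have u1_eq: "u1 x = u x" if "x \<in> ?K" for x using that KO by (auto simp: u1_def)
  have mu: "(\<lambda>x. indicator \<Omega> x *\<^sub>R u x) \<in> borel_measurable lebesgue"
    and mG [measurable]: "G0 \<in> borel_measurable lebesgue"
    using wg unfolding weak_gradient_def Lp_loc_def set_borel_measurable_def G0_def by auto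
  have [measurable]: "u1 \<in> borel_measurable lebesgue"
    unfolding u1_def by (intro borel_measurable_times borel_measurable_indicator mu) measurable
  have mB [measurable]: "B0 \<in> borel_measurable lebesgue"
    using B(1) unfolding set_borel_measurable_def B0_def[abs_def] .
  have [measurable]: "G1 \<in> borel_measurable lebesgue" "B1 \<in> borel_measurable lebesgue"
    unfolding G1_def B1_def by measurable
  have G1M: "norm (G1 x) \<le> M" and B1N: "norm (B1 x) \<le> N" for x
    using M(2) B(3) by (auto simp: G1_def B1_def)
  have AEeq: "AE x in lebesgue. G0 x = G1 x \<and> B0 x = B1 x"
    using M(1) B(2)
    by eventually_elim (use M(2) B(3) in \<open>auto simp: G0_def B0_def G1_def B1_def indicator_def\<close>)
  have \<zeta>g0: "gradient \<zeta> x = 0" if "x \<notin> ?K" for x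
    using gradient_zero_outside_cbox[of a b \<zeta> x] supp that by blast
  obtain U where U: "0 \<le> U" "\<And>x. norm (u1 x) \<le> U"
  proof (rule continuous_supported_cbox_bounded[of a b u1])
    show "continuous_on ?K u1"
      using continuous_on_subset[OF u KO] u1_eq by (simp cong: continuous_on_cong)
  qed (auto simp: u1_def)
  have parts: "(\<integral>x. u1 x * (gradient g x \<bullet> w) \<partial>lebesgue) = - (\<integral>x. g x * (G1 x \<bullet> w) \<partial>lebesgue)"
    if g: "smooth g" and g0: "\<And>x. x \<notin> ?K \<Longrightarrow> g x = 0" for g w
  proof -
    have [measurable]: "g \<in> borel_measurable lebesgue" "gradient g \<in> borel_measurable lebesgue"
      by (intro borel_measurable_lebesgue_continuous smooth_continuous_on continuous_on_gradient g)+
    have gg0: "gradient g x = 0" if "x \<notin> ?K" for x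
      using gradient_zero_outside_cbox[of a b g x] g0 that by blast
    obtain Cg where Cg: "0 \<le> Cg" "\<And>x. norm (gradient g x) \<le> Cg" "\<And>x. norm (gradient g x) \<le> Cg * indicator ?K x"
      using continuous_supported_cbox_bounded[OF continuous_on_gradient[OF g] gg0] by blast
    obtain Dg where Dg: "0 \<le> Dg" "\<And>x. norm (g x) \<le> Dg" "\<And>x. norm (g x) \<le> Dg * indicator ?K x"
      using continuous_supported_cbox_bounded[OF smooth_continuous_on[OF g] g0] by blast
    have i1: "integrable lebesgue (\<lambda>x. u1 x *\<^sub>R gradient g x)"
    proof (rule integrable_AE_bounded_cbox[where C = "U * Cg" and a = a and b = b])
      have "norm (u1 x *\<^sub>R gradient g x) \<le> U * (Cg * indicator ?K x)" for x
        unfolding norm_scaleR using U Cg by (intro mult_mono) auto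
      then show "AE x in lebesgue. norm (u1 x *\<^sub>R gradient g x) \<le> U * Cg * indicator ?K x"
        by (simp add: mult.assoc)
    qed measurable
    have i2: "integrable lebesgue (\<lambda>x. g x *\<^sub>R G1 x)"
    proof (rule integrable_AE_bounded_cbox[where C = "Dg * M" and a = a and b = b])
      have "norm (g x *\<^sub>R G1 x) \<le> (Dg * indicator ?K x) * M" for x
        unfolding norm_scaleR using Dg(1) Dg(3)[of x] G1M[of x] by (intro mult_mono) auto
      then show "AE x in lebesgue. norm (g x *\<^sub>R G1 x) \<le> Dg * M * indicator ?K x"
        by (simp add: mult_ac)
    qed measurable
    have "g \<in> test_functions \<Omega>"
      by (rule test_functionsI[OF g _ compact_cbox KO]) (use g0 in blast)
    then have "(LINT x:\<Omega>|lebesgue. u x *\<^sub>R gradient g x) = - (LINT x:\<Omega>|lebesgue. g x *\<^sub>R G x)"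
      using wg by (simp add: weak_gradient_def)
    moreover have "(LINT x:\<Omega>|lebesgue. u x *\<^sub>R gradient g x) = (\<integral>x. u1 x *\<^sub>R gradient g x \<partial>lebesgue)"
      unfolding set_lebesgue_integral_def
    proof (rule Bochner_Integration.integral_cong[OF refl])
      show "indicat_real \<Omega> x *\<^sub>R u x *\<^sub>R gradient g x = u1 x *\<^sub>R gradient g x" for x
        using KO gg0[of x] by (cases "x \<in> ?K") (auto simp: u1_def)
    qed
    moreover have "(LINT x:\<Omega>|lebesgue. g x *\<^sub>R G x) = (\<integral>x. g x *\<^sub>R G1 x \<partial>lebesgue)"
    proof -
      have "(LINT x:\<Omega>|lebesgue. g x *\<^sub>R G x) = (\<integral>x. g x *\<^sub>R G0 x \<partial>lebesgue)"
        unfolding set_lebesgue_integral_def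
        by (rule Bochner_Integration.integral_cong[OF refl]) (simp add: G0_def)
      also have "\<dots> = (\<integral>x. g x *\<^sub>R G1 x \<partial>lebesgue)"
        by (rule integral_cong_AE) (use AEeq in \<open>auto elim: eventually_mono\<close>)
      finally show ?thesis .
    qed
    ultimately have "(\<integral>x. u1 x *\<^sub>R gradient g x \<partial>lebesgue) \<bullet> w = - ((\<integral>x. g x *\<^sub>R G1 x \<partial>lebesgue) \<bullet> w)"
      by simp
    then show ?thesis
      by (simp add: Bochner_Integration.integral_inner_left[OF i1, symmetric]
          Bochner_Integration.integral_inner_left[OF i2, symmetric])
  qed
  have "\<exists>v. smooth v \<and> (\<forall>x\<in>?K. \<bar>v x - u1 x\<bar> \<le> 1 / real (Suc n) \<and> norm (gradient v x) \<le> M)" for n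
  proof -
    have "0 < 1 / real (Suc n)" by simp
    from mollification[OF wg u M sub r this]
    obtain v where "smooth v" "\<And>x. x \<in> ?K \<Longrightarrow> \<bar>v x - u x\<bar> \<le> 1 / real (Suc n)"
      "\<And>x. x \<in> ?K \<Longrightarrow> norm (gradient v x) \<le> M" by blast
    then show ?thesis by (intro exI[of _ v]) (simp add: u1_eq)
  qed
  then obtain v where v: "\<And>n. smooth (v n)"
    and vu: "\<And>n x. x \<in> ?K \<Longrightarrow> \<bar>v n x - u1 x\<bar> \<le> 1 / real (Suc n)"
    and vM: "\<And>n x. x \<in> ?K \<Longrightarrow> norm (gradient (v n) x) \<le> M"
    by metis
  have c\<Phi>: "continuous_on UNIV \<Phi>" by (rule smooth_continuous_on[OF \<Phi>(1)])
  have [measurable]: "\<zeta> \<in> borel_measurable lebesgue" "gradient \<zeta> \<in> borel_measurable lebesgue"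
    "v n \<in> borel_measurable lebesgue" "gradient (v n) \<in> borel_measurable lebesgue" for n
    by (intro borel_measurable_lebesgue_continuous smooth_continuous_on continuous_on_gradient \<zeta> v)+
  have [measurable]: "\<Phi> \<in> borel_measurable borel" "\<Phi>' \<in> borel_measurable borel"
    using c\<Phi> c\<Phi>' by (simp_all add: borel_measurable_continuous_onI)
  \<comment> \<open>One compact interval holds all values of \<open>u1\<close> and, because
    \<open>1 / Suc n \<le> 1\<close>, those of every \<open>v n\<close> on the box, so
    \<open>\<Phi>\<close> and \<open>\<Phi>'\<close> are bounded uniformly.\<close>
  define S where "S = {- (U + 1)..U + 1}"
  have u1S: "u1 x \<in> S" for x using U(2)[of x] by (auto simp: S_def)
  have vS: "v n x \<in> S" if "x \<in> ?K" for n x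
  proof -
    have "1 / real (Suc n) \<le> 1" by simp
    then have "\<bar>v n x - u1 x\<bar> \<le> 1" using vu[OF that, of n] by linarith
    then show ?thesis using U(2)[of x] unfolding S_def by (auto simp: abs_le_iff)
  qed
  have "bounded (\<Phi> ` S)" "bounded (\<Phi>' ` S)"
    unfolding S_def
    by (intro compact_imp_bounded compact_continuous_image continuous_on_subset[OF c\<Phi>]
        continuous_on_subset[OF c\<Phi>'] compact_Icc subset_UNIV)+
  then obtain C C' where C: "\<And>s. s \<in> S \<Longrightarrow> \<bar>\<Phi> s\<bar> \<le> C" and C': "\<And>s. s \<in> S \<Longrightarrow> \<bar>\<Phi>' s\<bar> \<le> C'"
    unfolding bounded_iff real_norm_def by blast
  have C0: "0 \<le> C" "0 \<le> C'" using order_trans[OF abs_ge_zero C[OF u1S[of 0]]] order_trans[OF abs_ge_zero C'[OF u1S[of 0]]]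
    by auto
  obtain Z where Z: "0 \<le> Z" "\<And>x. norm (\<zeta> x) \<le> Z" "\<And>x. norm (\<zeta> x) \<le> Z * indicator ?K x"
    using continuous_supported_cbox_bounded[OF smooth_continuous_on[OF \<zeta>] supp] by blast
  obtain Zg where Zg: "0 \<le> Zg" "\<And>x. norm (gradient \<zeta> x) \<le> Zg"
      "\<And>x. norm (gradient \<zeta> x) \<le> Zg * indicator ?K x"
    using continuous_supported_cbox_bounded[OF continuous_on_gradient[OF \<zeta>] \<zeta>g0] by blast
  have BI: "\<bar>B1 x \<bullet> y\<bar> \<le> N * T" if "norm y \<le> T" for x y T
    by (rule order_trans[OF Cauchy_Schwarz_ineq2]) (use B1N[of x] B(3) that in \<open>auto intro: mult_mono\<close>)
  have b1: "norm (\<Phi> s * (B1 x \<bullet> gradient \<zeta> x)) \<le> C * (N * Zg) * indicator ?K x"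
    if "x \<in> ?K \<Longrightarrow> s \<in> S" for s x
  proof (cases "x \<in> ?K")
    case True
    with that C BI[OF Zg(2)] C0 show ?thesis by (auto simp: abs_mult intro!: mult_mono)
  qed (simp add: \<zeta>g0)
  have b2: "norm (\<zeta> x * t * (B1 x \<bullet> y)) \<le> Z * T * (N * M) * indicator ?K x"
    if "x \<in> ?K \<Longrightarrow> \<bar>t\<bar> \<le> T" "x \<in> ?K \<Longrightarrow> norm y \<le> M" for t y x T
  proof (cases "x \<in> ?K")
    case True
    have "norm (\<zeta> x) * \<bar>t\<bar> * \<bar>B1 x \<bullet> y\<bar> \<le> Z * T * (N * M)"
      using that(1)[OF True] BI[OF that(2)[OF True]] Z by (intro mult_mono) auto
    with True show ?thesis by (simp add: abs_mult)
  qed (simp add: supp)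
  have vlim: "(\<lambda>n. v n x) \<longlonglongrightarrow> u1 x" if "x \<in> ?K" for x
  proof -
    have "(\<lambda>n. v n x - u1 x) \<longlonglongrightarrow> 0"
      by (rule Lim_null_comparison[OF _ LIMSEQ_Suc[OF lim_1_over_n]])
        (use vu[OF that] in auto)
    then show ?thesis by (simp add: LIM_zero_iff)
  qed
  have \<Phi>lim: "(\<lambda>n. F (v n x)) \<longlonglongrightarrow> F (u1 x)" if "x \<in> ?K" "continuous_on UNIV F" for F :: "real \<Rightarrow> real" and x
    using continuous_on_tendsto_compose[OF that(2) vlim[OF that(1)]] by simp
  have L1: "(\<lambda>n. \<integral>x. \<Phi> (v n x) * (B1 x \<bullet> gradient \<zeta> x) \<partial>lebesgue) \<longlonglongrightarrow>
      (\<integral>x. \<Phi> (u1 x) * (B1 x \<bullet> gradient \<zeta> x) \<partial>lebesgue)"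
  proof (rule integral_dominated_convergence[OF _ _ integrable_indicator_cbox])
    show "AE x in lebesgue. (\<lambda>n. \<Phi> (v n x) * (B1 x \<bullet> gradient \<zeta> x)) \<longlonglongrightarrow> \<Phi> (u1 x) * (B1 x \<bullet> gradient \<zeta> x)"
    proof (rule AE_I2)
      fix x
      show "(\<lambda>n. \<Phi> (v n x) * (B1 x \<bullet> gradient \<zeta> x)) \<longlonglongrightarrow> \<Phi> (u1 x) * (B1 x \<bullet> gradient \<zeta> x)"
        by (cases "x \<in> ?K") (simp_all add: \<zeta>g0 tendsto_mult[OF \<Phi>lim[OF _ c\<Phi>] tendsto_const])
    qed
    show "AE x in lebesgue. norm (\<Phi> (v n x) * (B1 x \<bullet> gradient \<zeta> x)) \<le> C * (N * Zg) * indicator ?K x" for n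
      using b1 vS by blast
  qed measurable
  \<comment> \<open>Here the nonlinear factor tends to 0 pointwise and the gradients need only be
    bounded.\<close>
  have L2: "(\<lambda>n. \<integral>x. \<zeta> x * (\<Phi>' (v n x) - \<Phi>' (u1 x)) * (B1 x \<bullet> gradient (v n) x) \<partial>lebesgue) \<longlonglongrightarrow>
      (\<integral>x. 0 \<partial>(lebesgue :: 'a measure))"
  proof (rule integral_dominated_convergence[OF _ _ integrable_indicator_cbox])
    show "AE x in lebesgue. (\<lambda>n. \<zeta> x * (\<Phi>' (v n x) - \<Phi>' (u1 x)) * (B1 x \<bullet> gradient (v n) x)) \<longlonglongrightarrow> 0"
    proof (rule AE_I2)
      fix x
      show "(\<lambda>n. \<zeta> x * (\<Phi>' (v n x) - \<Phi>' (u1 x)) * (B1 x \<bullet> gradient (v n) x)) \<longlonglongrightarrow> 0"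
      proof (cases "x \<in> ?K")
        case True
        show ?thesis
        proof (rule Lim_null_comparison)
          show "\<forall>\<^sub>F n in sequentially. norm (\<zeta> x * (\<Phi>' (v n x) - \<Phi>' (u1 x)) * (B1 x \<bullet> gradient (v n) x))
            \<le> Z * \<bar>\<Phi>' (v n x) - \<Phi>' (u1 x)\<bar> * (N * M)"
          proof (rule always_eventually, rule allI)
            fix n
            show "norm (\<zeta> x * (\<Phi>' (v n x) - \<Phi>' (u1 x)) * (B1 x \<bullet> gradient (v n) x))
              \<le> Z * \<bar>\<Phi>' (v n x) - \<Phi>' (u1 x)\<bar> * (N * M)"
              using b2[of x "\<Phi>' (v n x) - \<Phi>' (u1 x)" "\<bar>\<Phi>' (v n x) - \<Phi>' (u1 x)\<bar>" "gradient (v n) x"]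
                vM[of x n] True by simp
          qed
          have "(\<lambda>n. Z * \<bar>\<Phi>' (v n x) - \<Phi>' (u1 x)\<bar> * (N * M)) \<longlonglongrightarrow> Z * \<bar>\<Phi>' (u1 x) - \<Phi>' (u1 x)\<bar> * (N * M)"
            by (intro tendsto_intros \<Phi>lim[OF True c\<Phi>'])
          then show "(\<lambda>n. Z * \<bar>\<Phi>' (v n x) - \<Phi>' (u1 x)\<bar> * (N * M)) \<longlonglongrightarrow> 0" by simp
        qed
      qed (simp add: supp)
    qed
    show "AE x in lebesgue. norm (\<zeta> x * (\<Phi>' (v n x) - \<Phi>' (u1 x)) * (B1 x \<bullet> gradient (v n) x)) \<le> Z * (2 * C') * (N * M) * indicator ?K x" for n
    proof (rule AE_I2, rule b2)
      fix x assume "x \<in> ?K"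
      then show "\<bar>\<Phi>' (v n x) - \<Phi>' (u1 x)\<bar> \<le> 2 * C'"
        using C'[OF vS[of x n]] C'[OF u1S[of x]] by linarith
    qed (rule vM)
  qed measurable
  have iF: "integrable lebesgue (\<lambda>x. \<zeta> x * \<Phi>' (u1 x) * (B1 x \<bullet> i) * (F x \<bullet> i))"
    if [measurable]: "F \<in> borel_measurable lebesgue" and "\<And>x. x \<in> ?K \<Longrightarrow> norm (F x) \<le> M" "i \<in> Basis" for i F
  proof (rule integrable_AE_bounded_cbox[where C = "Z * C' * (N * M)" and a = a and b = b])
    show "AE x in lebesgue. norm (\<zeta> x * \<Phi>' (u1 x) * (B1 x \<bullet> i) * (F x \<bullet> i)) \<le> Z * C' * (N * M) * indicator ?K x"
    proof (rule AE_I2)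
      fix x
      have "norm (\<zeta> x * \<Phi>' (u1 x) * (B1 x \<bullet> ((F x \<bullet> i) *\<^sub>R i))) \<le> Z * C' * (N * M) * indicator ?K x"
      proof (rule b2)
        assume "x \<in> ?K"
        show "norm ((F x \<bullet> i) *\<^sub>R i) \<le> M"
          using Basis_le_norm[OF that(3), of "F x"] that(2)[OF \<open>x \<in> ?K\<close>] that(3) by simp
      qed (rule C'[OF u1S])
      then show "norm (\<zeta> x * \<Phi>' (u1 x) * (B1 x \<bullet> i) * (F x \<bullet> i)) \<le> Z * C' * (N * M) * indicator ?K x"
        by (simp add: mult_ac)
    qed
  qed measurable
  \<comment> \<open>Weak convergence is available for one fixed direction at a time, so the inner
    product is split into coordinates.\<close>
  have sumF: "(\<integral>x. \<zeta> x * \<Phi>' (u1 x) * (B1 x \<bullet> F x) \<partial>lebesgue) =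
      (\<Sum>i\<in>Basis. \<integral>x. \<zeta> x * (\<Phi>' (u1 x) * (B1 x \<bullet> i)) * (F x \<bullet> i) \<partial>lebesgue)"
    if "F \<in> borel_measurable lebesgue" "\<And>x. x \<in> ?K \<Longrightarrow> norm (F x) \<le> M" for F
  proof -
    have "(\<integral>x. \<zeta> x * \<Phi>' (u1 x) * (B1 x \<bullet> F x) \<partial>lebesgue) =
        (\<integral>x. (\<Sum>i\<in>Basis. \<zeta> x * \<Phi>' (u1 x) * (B1 x \<bullet> i) * (F x \<bullet> i)) \<partial>lebesgue)"
      by (rule Bochner_Integration.integral_cong[OF refl])
        (subst euclidean_inner, simp add: sum_distrib_left mult.assoc)
    also have "\<dots> = (\<Sum>i\<in>Basis. \<integral>x. \<zeta> x * \<Phi>' (u1 x) * (B1 x \<bullet> i) * (F x \<bullet> i) \<partial>lebesgue)"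
      by (rule Bochner_Integration.integral_sum) (use iF that in auto)
    finally show ?thesis by (simp add: mult.assoc)
  qed
  have L3: "(\<lambda>n. \<integral>x. \<zeta> x * \<Phi>' (u1 x) * (B1 x \<bullet> gradient (v n) x) \<partial>lebesgue) \<longlonglongrightarrow>
      (\<integral>x. \<zeta> x * \<Phi>' (u1 x) * (B1 x \<bullet> G1 x) \<partial>lebesgue)"
  proof -
    have *: "(\<lambda>n. \<integral>x. \<zeta> x * (\<Phi>' (u1 x) * (B1 x \<bullet> i)) * (gradient (v n) x \<bullet> i) \<partial>lebesgue) \<longlonglongrightarrow>
        (\<integral>x. \<zeta> x * (\<Phi>' (u1 x) * (B1 x \<bullet> i)) * (G1 x \<bullet> i) \<partial>lebesgue)" if "i \<in> Basis" for i
    proof (rule weak_convergence_gradients[OF \<zeta> supp _ _ _ _ _ G1M parts v vM vu, where U = U])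
      show "\<bar>\<Phi>' (u1 x) * (B1 x \<bullet> i)\<bar> \<le> C' * (N * 1)" for x
        unfolding abs_mult using C'[OF u1S[of x]] BI[of i 1 x] that C0 by (intro mult_mono) auto
    qed (use U in auto)
    have "(\<integral>x. \<zeta> x * \<Phi>' (u1 x) * (B1 x \<bullet> gradient (v n) x) \<partial>lebesgue) =
        (\<Sum>i\<in>Basis. \<integral>x. \<zeta> x * (\<Phi>' (u1 x) * (B1 x \<bullet> i)) * (gradient (v n) x \<bullet> i) \<partial>lebesgue)" for n
      by (rule sumF) (simp_all add: vM)
    then show ?thesis
      unfolding sumF[OF \<open>G1 \<in> borel_measurable lebesgue\<close> G1M]
      by (simp only:) (rule tendsto_sum, rule *)
  qed
  \<comment> \<open>Writing \<open>\<Phi>' (v n x)\<close> as its difference to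
    \<open>\<Phi>' (u1 x)\<close> plus \<open>\<Phi>' (u1 x)\<close> separates dominated convergence
    from weak convergence.\<close>
  have "0 \<le> (\<integral>x. \<Phi> (v n x) * (B1 x \<bullet> gradient \<zeta> x) \<partial>lebesgue)
     + (\<integral>x. \<zeta> x * (\<Phi>' (v n x) - \<Phi>' (u1 x)) * (B1 x \<bullet> gradient (v n) x) \<partial>lebesgue)
     + (\<integral>x. \<zeta> x * \<Phi>' (u1 x) * (B1 x \<bullet> gradient (v n) x) \<partial>lebesgue)" for n
  proof -
    define \<psi> where "\<psi> x = \<zeta> x * \<Phi> (v n x)" for x
    have \<psi>: "smooth \<psi>" unfolding \<psi>_def by (rule smooth_mult[OF \<zeta> smooth_compose[OF \<Phi>(1) v]])
    have [measurable]: "gradient \<psi> \<in> borel_measurable lebesgue"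
      by (intro borel_measurable_lebesgue_continuous continuous_on_gradient \<psi>)
    have g\<psi>: "gradient \<psi> x = \<zeta> x *\<^sub>R (\<Phi>' (v n x) *\<^sub>R gradient (v n) x) + \<Phi> (v n x) *\<^sub>R gradient \<zeta> x" for x
      unfolding \<psi>_def
      by (rule gradient_eqI, rule GDERIV_mult[OF smooth_GDERIV[OF \<zeta>]],
          rule GDERIV_compose[OF smooth_GDERIV[OF v] \<Phi>'])
    have "\<psi> \<in> test_functions \<Omega>"
      by (rule test_functionsI[OF \<psi> _ compact_cbox KO]) (use supp in \<open>auto simp: \<psi>_def\<close>)
    then have "0 \<le> (LINT x:\<Omega>|lebesgue. B x \<bullet> gradient \<psi> x)"
      by (rule pos) (simp add: \<psi>_def \<zeta>_nn \<Phi>)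
    also have "\<dots> = (\<integral>x. B0 x \<bullet> gradient \<psi> x \<partial>lebesgue)"
      unfolding set_lebesgue_integral_def B0_def by simp
    also have "\<dots> = (\<integral>x. B1 x \<bullet> gradient \<psi> x \<partial>lebesgue)"
      by (rule integral_cong_AE) (use AEeq in \<open>auto elim: eventually_mono\<close>)
    also have "\<dots> = (\<integral>x. \<Phi> (v n x) * (B1 x \<bullet> gradient \<zeta> x)
           + \<zeta> x * (\<Phi>' (v n x) - \<Phi>' (u1 x)) * (B1 x \<bullet> gradient (v n) x)
           + \<zeta> x * \<Phi>' (u1 x) * (B1 x \<bullet> gradient (v n) x) \<partial>lebesgue)"
      by (rule Bochner_Integration.integral_cong[OF refl]) (simp add: g\<psi> inner_add_right algebra_simps)
    also have "\<dots> = (\<integral>x. \<Phi> (v n x) * (B1 x \<bullet> gradient \<zeta> x) \<partial>lebesgue)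
     + (\<integral>x. \<zeta> x * (\<Phi>' (v n x) - \<Phi>' (u1 x)) * (B1 x \<bullet> gradient (v n) x) \<partial>lebesgue)
     + (\<integral>x. \<zeta> x * \<Phi>' (u1 x) * (B1 x \<bullet> gradient (v n) x) \<partial>lebesgue)"
    proof -
      have k1: "integrable lebesgue (\<lambda>x. \<Phi> (v n x) * (B1 x \<bullet> gradient \<zeta> x))"
        by (rule integrable_AE_bounded_cbox[OF _ AE_I2[OF b1]]) (use vS in auto)
      have k2: "integrable lebesgue (\<lambda>x. \<zeta> x * (\<Phi>' (v n x) - \<Phi>' (u1 x)) * (B1 x \<bullet> gradient (v n) x))"
      proof (rule integrable_AE_bounded_cbox[OF _ AE_I2[OF b2]])
        fix x assume "x \<in> ?K"
        then show "\<bar>\<Phi>' (v n x) - \<Phi>' (u1 x)\<bar> \<le> 2 * C'"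
          using C'[OF vS[of x n]] C'[OF u1S[of x]] by linarith
      qed (use vM in auto)
      have k3: "integrable lebesgue (\<lambda>x. \<zeta> x * \<Phi>' (u1 x) * (B1 x \<bullet> gradient (v n) x))"
        by (rule integrable_AE_bounded_cbox[OF _ AE_I2[OF b2[where T = C']]]) (use vM C' u1S in auto)
      show ?thesis
        by (simp only: Bochner_Integration.integral_add k1 k2 k3 Bochner_Integration.integrable_add)
    qed
    finally show ?thesis .
  qed
  then have "0 \<le> (\<integral>x. \<Phi> (u1 x) * (B1 x \<bullet> gradient \<zeta> x) \<partial>lebesgue) + (\<integral>x. 0 \<partial>(lebesgue :: 'a measure))
     + (\<integral>x. \<zeta> x * \<Phi>' (u1 x) * (B1 x \<bullet> G1 x) \<partial>lebesgue)"
    by (intro LIMSEQ_le_const[OF tendsto_add[OF tendsto_add[OF L1 L2] L3]]) auto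
  also have "\<dots> = (\<integral>x. \<Phi> (u1 x) * (B1 x \<bullet> gradient \<zeta> x) + \<zeta> x * \<Phi>' (u1 x) * (B1 x \<bullet> G1 x) \<partial>lebesgue)"
  proof -
    have k1: "integrable lebesgue (\<lambda>x. \<Phi> (u1 x) * (B1 x \<bullet> gradient \<zeta> x))"
      by (rule integrable_AE_bounded_cbox[OF _ AE_I2[OF b1]]) (use u1S in auto)
    have k3: "integrable lebesgue (\<lambda>x. \<zeta> x * \<Phi>' (u1 x) * (B1 x \<bullet> G1 x))"
      by (rule integrable_AE_bounded_cbox[OF _ AE_I2[OF b2[where T = C']]]) (use G1M C' u1S in auto)
    show ?thesis using k1 k3 by simp
  qed
  also have "\<dots> = (\<integral>x. \<Phi> (u1 x) * (B0 x \<bullet> gradient \<zeta> x) + \<zeta> x * \<Phi>' (u1 x) * (B0 x \<bullet> G0 x) \<partial>lebesgue)"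
    by (rule integral_cong_AE) (use AEeq in \<open>auto elim: eventually_mono\<close>)
  also have "\<dots> = (LINT x:\<Omega>|lebesgue. \<Phi> (u x) * (B x \<bullet> gradient \<zeta> x) + \<zeta> x * \<Phi>' (u x) * (B x \<bullet> G x))"
    unfolding set_lebesgue_integral_def
  proof (rule Bochner_Integration.integral_cong[OF refl])
    fix x
    show "\<Phi> (u1 x) * (B0 x \<bullet> gradient \<zeta> x) + \<zeta> x * \<Phi>' (u1 x) * (B0 x \<bullet> G0 x) =
       indicat_real \<Omega> x *\<^sub>R (\<Phi> (u x) * (B x \<bullet> gradient \<zeta> x) + \<zeta> x * \<Phi>' (u x) * (B x \<bullet> G x))"
    proof (cases "x \<in> ?K")
      case True
      with KO have "x \<in> \<Omega>" by blast
      with True show ?thesis by (simp add: u1_eq B0_def G0_def)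
    qed (simp add: supp \<zeta>g0)
  qed
  finally show ?thesis .
qed

text \<open>The mean value inequality holds for the mollifications on the convex box and passes to
  their uniform limit.\<close>

lemma weak_gradient_Lipschitz:
  fixes u :: "'a::euclidean_space \<Rightarrow> real"
  assumes wg: "weak_gradient \<Omega> u G" and u: "continuous_on \<Omega> u"
    and M: "AE x in lebesgue. x \<in> \<Omega> \<longrightarrow> norm (G x) \<le> M" "0 \<le> M"
    and sub: "cbox (a - r *\<^sub>R One) (b + r *\<^sub>R One) \<subseteq> \<Omega>" and r: "r > 0"
    and x: "x \<in> cbox a b" and y: "y \<in> cbox a b"
  shows "\<bar>u x - u y\<bar> \<le> M * norm (x - y)"
proof (rule field_le_epsilon)
  fix e :: real assume "e > 0"
  then have "e / 2 > 0" by simp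
  from mollification[OF wg u M sub r this]
  obtain v where v: "smooth v" "\<And>x. x \<in> cbox a b \<Longrightarrow> \<bar>v x - u x\<bar> \<le> e / 2"
    "\<And>x. x \<in> cbox a b \<Longrightarrow> norm (gradient v x) \<le> M" by blast
  have "norm (v x - v y) \<le> M * norm (x - y)"
  proof (rule differentiable_bound[OF convex_box(1)[of a b] _ _ x y])
    fix z assume z: "z \<in> cbox a b"
    show "(v has_derivative (\<lambda>h. h \<bullet> gradient v z)) (at z within cbox a b)"
      using smooth_GDERIV[OF v(1)] by (simp add: gderiv_def has_derivative_at_withinI)
    show "onorm (\<lambda>h. h \<bullet> gradient v z) \<le> M"
    proof (rule onorm_le)
      fix h
      have "norm (h \<bullet> gradient v z) \<le> norm h * norm (gradient v z)"
        using Cauchy_Schwarz_ineq2[of h] by simp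
      also have "\<dots> \<le> norm h * M" using v(3)[OF z] by (intro mult_left_mono) auto
      finally show "norm (h \<bullet> gradient v z) \<le> M * norm h" by (simp add: mult.commute)
    qed
  qed
  with v(2)[OF x] v(2)[OF y] show "\<bar>u x - u y\<bar> \<le> M * norm (x - y) + e"
    unfolding real_norm_def by linarith
qed

section \<open>Cutoff functions on cylinders\<close>

lemma measure_ball_half:
  "measure lborel (ball (0::'b::euclidean_space) (R / 2)) = measure lborel (ball (0::'b) R) / 2 ^ DIM('b)"
  if "R > 0"
  using that content_ball_conv_unit_ball[of "R/2" "0::'b"] content_ball_conv_unit_ball[of R "0::'b"]
  by (simp add: power_divide)

lemma emeasure_Times_lborel:
  fixes A :: "'b::euclidean_space set" and B :: "'c::euclidean_space set"
  assumes "A \<in> sets borel" "B \<in> sets borel"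
  shows "emeasure lborel (A \<times> B) = emeasure lborel A * emeasure lborel B"
  using assms by (simp add: lborel_prod[symmetric] lborel.emeasure_pair_measure_Times)

lemma
  fixes A :: "'b::euclidean_space set" and s t :: real
  assumes "A \<in> sets borel" "bounded A" "s \<le> t"
  shows measure_cylinder: "measure lebesgue (A \<times> {s..t}) = measure lborel A * (t - s)"
    and emeasure_cylinder: "emeasure lebesgue (A \<times> {s..t}) < \<infinity>"
    and sets_cylinder: "A \<times> {s..t} \<in> sets lebesgue"
proof -
  have fA: "emeasure lborel A < \<infinity>" using assms(2) emeasure_bounded_finite by blast
  have b: "A \<times> {s..t} \<in> sets borel"
    using assms(1) by (simp add: borel_Times)
  have eq: "emeasure lborel (A \<times> {s..t}) = emeasure lborel A * ennreal (t - s)"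
    using assms by (simp add: emeasure_Times_lborel)
  show "A \<times> {s..t} \<in> sets lebesgue" using b by (simp add: sets_completionI_sets)
  show "measure lebesgue (A \<times> {s..t}) = measure lborel A * (t - s)"
    using b assms(3) by (simp add: measure_completion measure_def eq enn2real_mult)
  show "emeasure lebesgue (A \<times> {s..t}) < \<infinity>"
    using b fA by (simp add: emeasure_completion eq ennreal_mult_less_top)
qed

text \<open>Use of the squared norm keeps the function smooth on the axis. For \<open>R > 0\<close>
  it is positive exactly where \<open>norm (fst x) < R\<close>.\<close>

definition hcut :: "real \<Rightarrow> 'b::euclidean_space \<times> real \<Rightarrow> real"
  where "hcut R x = flat 0 (1 - (norm (fst x))\<^sup>2 / R\<^sup>2)"

text \<open>A rise over the fixed slab from \<open>y0\<close> to \<open>y0 + h\<close>, where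
  \<open>u \<ge> d\<close> will hold, times a slow decay that reaches 0 at
  \<open>y0 + 2 * L\<close>.\<close>

definition vcut :: "real \<Rightarrow> real \<Rightarrow> real \<Rightarrow> real \<Rightarrow> real"
  where "vcut y0 h L t = smooth_step ((t - y0) / h) * flat 0 (2 - (t - y0) / L)"

text \<open>The derivative of \<open>vcut\<close>: the first summand comes from the rise, the second
  from the decay. They are treated separately because \<open>W\<close> vanishes where the first one
  lives.\<close>

definition vcut' :: "real \<Rightarrow> real \<Rightarrow> real \<Rightarrow> real \<Rightarrow> real"
  where "vcut' y0 h L t = flat 2 (flat 0 1 - flat 0 (1 - (t - y0) / h)) * flat 2 (1 - (t - y0) / h) / h
    * flat 0 (2 - (t - y0) / L) - smooth_step ((t - y0) / h) * flat 2 (2 - (t - y0) / L) / L"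

definition cutoff :: "real \<Rightarrow> real \<Rightarrow> real \<Rightarrow> real \<Rightarrow> 'b::euclidean_space \<times> real \<Rightarrow> real"
  where "cutoff y0 h R L x = hcut R x * vcut y0 h L (snd x)"

lemma hcut_nonneg: "0 \<le> hcut R x" and hcut_le_1: "hcut R x \<le> 1"
  by (simp_all add: hcut_def flat0_le_1)

lemma vcut_nonneg: "0 \<le> vcut y0 h L t" and vcut_le_1: "vcut y0 h L t \<le> 1"
  by (auto simp: vcut_def smooth_step_nonneg smooth_step_le_1 flat0_le_1 intro!: mult_le_one)

lemma hcut_zero: "R > 0 \<Longrightarrow> norm (fst x) \<ge> R \<Longrightarrow> hcut R x = 0"
  by (simp add: hcut_def power_mono)

lemma vcut_zero:
  assumes "h > 0" "L > 0" "t \<notin> {y0..y0 + 2 * L}"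
  shows "vcut y0 h L t = 0"
proof (cases "t < y0")
  case True
  then show ?thesis using assms(1) by (simp add: vcut_def smooth_step_eq_0 divide_le_0_iff)
next
  case False
  with assms have "(t - y0) / L \<ge> 2" by (auto simp: field_simps)
  then show ?thesis by (simp add: vcut_def)
qed

lemma vcut_has_real_derivative:
  assumes "h \<noteq> 0" "L \<noteq> 0"
  shows "(vcut y0 h L has_real_derivative vcut' y0 h L t) (at t)"
proof -
  have 1: "((\<lambda>t. smooth_step ((t - y0) / h)) has_real_derivative
      flat 2 (flat 0 1 - flat 0 (1 - (t - y0) / h)) * flat 2 (1 - (t - y0) / h) * (1 / h)) (at t)"
    by (rule DERIV_chain2[OF smooth_step_has_real_derivative])
      (use assms in \<open>auto intro!: derivative_eq_intros\<close>)
  have 2: "((\<lambda>t. flat 0 (2 - (t - y0) / L)) has_real_derivative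
      flat 2 (2 - (t - y0) / L) * (- (1 / L))) (at t)"
    by (rule DERIV_chain2[OF flat0_has_real_derivative])
      (use assms in \<open>auto intro!: derivative_eq_intros\<close>)
  show ?thesis
    using DERIV_mult[OF 1 2] by (simp add: vcut_def[abs_def] vcut'_def algebra_simps)
qed

lemma smooth_cutoff: "smooth (cutoff y0 h R L :: 'b::euclidean_space \<times> real \<Rightarrow> real)"
proof -
  have n: "smooth (\<lambda>x :: 'b \<times> real. (norm (fst x))\<^sup>2)"
    using smooth_norm_sq_bounded_linear[OF bounded_linear_fst, of 0] by simp
  have s: "smooth (\<lambda>x :: 'b \<times> real. snd x)"
    by (rule smooth_bounded_linear[OF bounded_linear_snd])
  have "smooth (\<lambda>x :: 'b \<times> real. flat 0 (1 - (norm (fst x))\<^sup>2 / R\<^sup>2))"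
    by (rule smooth_compose[OF smooth_flat]) (intro smooth_diff smooth_const smooth_divide n)
  moreover have "smooth (\<lambda>x :: 'b \<times> real. smooth_step ((snd x - y0) / h))"
    by (rule smooth_compose[OF smooth_smooth_step]) (intro smooth_diff smooth_const smooth_divide s)
  moreover have "smooth (\<lambda>x :: 'b \<times> real. flat 0 (2 - (snd x - y0) / L))"
    by (rule smooth_compose[OF smooth_flat]) (intro smooth_diff smooth_const smooth_divide s)
  ultimately show ?thesis
    unfolding cutoff_def[abs_def] hcut_def vcut_def by (intro smooth_mult)
qed

definition hcut_grad :: "real \<Rightarrow> 'b::euclidean_space \<times> real \<Rightarrow> 'b \<times> real"
  where "hcut_grad R x = (flat 2 (1 - (norm (fst x))\<^sup>2 / R\<^sup>2) * (- (2 / R\<^sup>2))) *\<^sub>R (fst x, 0)"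

lemma gradient_cutoff:
  fixes x :: "'b::euclidean_space \<times> real"
  assumes "h \<noteq> 0" "L \<noteq> 0"
  shows "gradient (cutoff y0 h R L) x =
    (hcut R x * vcut' y0 h L (snd x)) *\<^sub>R (0, 1) + vcut y0 h L (snd x) *\<^sub>R hcut_grad R x"
proof (rule gradient_eqI)
  have "GDERIV (\<lambda>x :: 'b \<times> real. (norm (fst x))\<^sup>2) x :> 2 *\<^sub>R (fst x, 0)"
    unfolding gderiv_def power2_norm_eq_inner
    by (auto intro!: derivative_eq_intros simp: inner_prod_def inner_commute)
  from GDERIV_compose[OF this DERIV_diff[OF DERIV_const[of 1] DERIV_cdivide[OF DERIV_ident, of "R\<^sup>2"]]]
  have 1: "GDERIV (\<lambda>x :: 'b \<times> real. 1 - (norm (fst x))\<^sup>2 / R\<^sup>2) x :> (- (2 / R\<^sup>2)) *\<^sub>R (fst x, 0)"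
    by simp
  have 2: "GDERIV (hcut R) x :> hcut_grad R x"
    using GDERIV_compose[OF 1 flat0_has_real_derivative]
    by (simp add: hcut_def[abs_def] hcut_grad_def)
  have 3: "GDERIV (\<lambda>x :: 'b \<times> real. snd x) x :> (0, 1)"
    unfolding gderiv_def by (auto intro!: derivative_eq_intros simp: inner_prod_def)
  have 4: "GDERIV (\<lambda>x. vcut y0 h L (snd x)) x :> vcut' y0 h L (snd x) *\<^sub>R (0, 1)"
    by (rule GDERIV_compose[OF 3 vcut_has_real_derivative[OF assms]])
  show "GDERIV (cutoff y0 h R L) x :>
    (hcut R x * vcut' y0 h L (snd x)) *\<^sub>R (0, 1) + vcut y0 h L (snd x) *\<^sub>R hcut_grad R x"
    using GDERIV_mult[OF 2 4] by (simp add: cutoff_def[abs_def])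
qed

lemma norm_hcut_grad_le:
  assumes "R > 0"
  shows "norm (hcut_grad R x) \<le> 4 / R * indicator (ball 0 R) (fst x)"
proof (cases "norm (fst x) < R")
  case True
  have "norm (hcut_grad R x) = flat 2 (1 - (norm (fst x))\<^sup>2 / R\<^sup>2) * (2 / R\<^sup>2) * norm (fst x)"
    by (simp add: hcut_grad_def norm_Pair)
  also have "\<dots> \<le> 2 * (2 / R\<^sup>2) * R"
    using True assms by (intro mult_mono flat2_le_2) auto
  also have "\<dots> = 4 / R" using assms by (simp add: power2_eq_square)
  finally show ?thesis using True by simp
next
  case False
  then have "R\<^sup>2 \<le> (norm (fst x))\<^sup>2" using assms by (simp add: power_mono)
  with False assms show ?thesis by (simp add: hcut_grad_def)
qed

section \<open>Energy estimates\<close>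

lemma open_half_space: "open (half_space :: ('b::euclidean_space \<times> real) set)"
  unfolding half_space_def by (intro open_Collect_less continuous_intros)

lemma
  fixes x :: "'b::euclidean_space \<times> real"
  assumes "h > 0" "R > 0" "L > 0"
  shows cutoff_zero: "x \<notin> ball 0 R \<times> {y0..y0 + 2 * L} \<Longrightarrow> cutoff y0 h R L x = 0"
    and cutoff_zero_cbox: "x \<notin> cbox (- R *\<^sub>R One, y0) (R *\<^sub>R One, y0 + 2 * L) \<Longrightarrow> cutoff y0 h R L x = 0"
proof -
  show *: "cutoff y0 h R L x = 0" if "x \<notin> ball 0 R \<times> {y0..y0 + 2 * L}"
    using that hcut_zero[OF assms(2), of x] vcut_zero[OF assms(1,3), of "snd x" y0]
    by (cases x) (auto simp: cutoff_def)
  show "cutoff y0 h R L x = 0" if out: "x \<notin> cbox (- R *\<^sub>R One, y0) (R *\<^sub>R One, y0 + 2 * L)"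
  proof (rule *)
    have "fst x \<in> cbox (- R *\<^sub>R One) (R *\<^sub>R One)" if "norm (fst x) < R"
    proof -
      have "\<bar>fst x \<bullet> i\<bar> \<le> R" if "i \<in> Basis" for i
        using Basis_le_norm[OF that, of "fst x"] \<open>norm (fst x) < R\<close> by linarith
      then show ?thesis by (auto simp: mem_box abs_le_iff minus_le_iff)
    qed
    with out show "x \<notin> ball 0 R \<times> {y0..y0 + 2 * L}"
      by (cases x) (auto simp: cbox_Pair_eq)
  qed
qed

text \<open>The margin \<open>y0 / 2\<close> is the room for mollification: the last coordinate
  stays at least \<open>y0 / 2\<close>.\<close>

lemma enlarged_cbox_half_space:
  assumes "y0 > 0"
  shows "cbox ((a, y0) - (y0 / 2) *\<^sub>R One) ((b, t) + (y0 / 2) *\<^sub>R One)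
    \<subseteq> (half_space :: ('b::euclidean_space \<times> real) set)"
proof
  fix x :: "'b \<times> real"
  have i: "(0, 1) \<in> (Basis :: ('b \<times> real) set)" by (simp add: Basis_prod_def)
  assume "x \<in> cbox ((a, y0) - (y0 / 2) *\<^sub>R One) ((b, t) + (y0 / 2) *\<^sub>R One)"
  then have "((a, y0) - (y0 / 2) *\<^sub>R One) \<bullet> (0, 1) \<le> x \<bullet> (0, 1)"
    using i unfolding mem_box by blast
  moreover have "(One :: 'b \<times> real) \<bullet> (0, 1) = 1"
    using inner_sum_left_Basis[OF i, of "\<lambda>_. 1"] by simp
  ultimately have "y0 / 2 \<le> snd x"
    by (cases x) (simp add: inner_diff_left)
  with assms show "x \<in> half_space" by (simp add: half_space_def)
qed

section \<open>Setting of the energy argument\<close>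

locale half_space_solution =
  fixes p M d y0 h :: real and f :: "real \<Rightarrow> real"
    and u :: "'b::euclidean_space \<times> real \<Rightarrow> real" and G :: "'b \<times> real \<Rightarrow> 'b \<times> real"
  assumes p: "p > 1" and M: "M > 0"
    and wg: "weak_gradient half_space u G"
    and cont: "continuous_on half_space u"
    and GM: "AE x in lebesgue. x \<in> half_space \<longrightarrow> norm (G x) \<le> M"
    and u_nonneg: "\<And>x. x \<in> half_space \<Longrightarrow> 0 \<le> u x"
    and sol: "p_Laplace_solution p f half_space u G"
    and f_nonneg: "\<And>t. 0 \<le> t \<Longrightarrow> 0 \<le> f t"
    and f_cont: "continuous_on {0..} f"
    and y0: "0 < y0" and h: "0 < h" and d: "0 < d"
    and low: "\<And>x t. y0 \<le> t \<Longrightarrow> t \<le> y0 + h \<Longrightarrow> d \<le> u (x, t)"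
begin

text \<open>Versions of \<open>u\<close> and of its gradient that vanish outside the half-space, where the given functions
  are arbitrary; \<open>G0\<close> is moreover bounded everywhere instead of almost everywhere.\<close>

definition u0 :: "'b \<times> real \<Rightarrow> real"
  where "u0 x = indicator half_space x *\<^sub>R u x"

definition G00 :: "'b \<times> real \<Rightarrow> 'b \<times> real"
  where "G00 x = indicator half_space x *\<^sub>R G x"

definition G0 :: "'b \<times> real \<Rightarrow> 'b \<times> real"
  where "G0 x = (if norm (G00 x) \<le> M then G00 x else 0)"

definition A0 :: "'b \<times> real \<Rightarrow> 'b \<times> real"
  where "A0 x = norm (G0 x) powr (p - 2) *\<^sub>R G0 x"

text \<open>This is \<Phi>(u) for \<Phi>(s) = \<open>flat 0 (d - s)\<close>; it vanishes exactly
  where \<open>u0 x \<ge> d\<close>.\<close>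

definition W :: "'b \<times> real \<Rightarrow> real"
  where "W x = flat 0 (d - u0 x)"

text \<open>For the same \<Phi> this is -\<Phi>'(u), as \<open>flat 2\<close> is the derivative of
  \<open>flat 0\<close>.\<close>

definition \<phi> :: "'b \<times> real \<Rightarrow> real"
  where "\<phi> x = flat 2 (d - u0 x)"

abbreviation ct :: "real \<Rightarrow> real \<Rightarrow> 'b \<times> real \<Rightarrow> real"
  where "ct R L \<equiv> cutoff y0 h R L"

text \<open>The height is \<open>2 * L\<close> because the decay in \<open>vcut\<close> ends at
  \<open>y0 + 2 * L\<close>.\<close>

definition cyl :: "real \<Rightarrow> real \<Rightarrow> ('b \<times> real) set"
  where "cyl R L = ball 0 R \<times> {y0..y0 + 2 * L}"

definition vol :: "real \<Rightarrow> real"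
  where "vol R = measure lborel (ball (0::'b) R)"

lemma half_space_sets [measurable]: "(half_space :: ('b \<times> real) set) \<in> sets lebesgue"
  by (intro sets_completionI_sets) (simp add: open_half_space)

lemma u0_nonneg: "0 \<le> u0 x"
  using u_nonneg by (auto simp: u0_def indicator_def)

lemma u0_measurable [measurable]: "u0 \<in> borel_measurable lebesgue"
  and G00_measurable [measurable]: "G00 \<in> borel_measurable lebesgue"
  using wg unfolding weak_gradient_def Lp_loc_def set_borel_measurable_def u0_def[abs_def] G00_def[abs_def]
  by auto

lemma G0_measurable [measurable]: "G0 \<in> borel_measurable lebesgue"
  unfolding G0_def[abs_def] by measurable

lemma A0_measurable [measurable]: "A0 \<in> borel_measurable lebesgue"
  unfolding A0_def[abs_def] by measurable

lemma flat_borel [measurable]: "flat k \<in> borel_measurable borel"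
  by (intro borel_measurable_continuous_onI smooth_continuous_on smooth_flat)

lemma W_measurable [measurable]: "W \<in> borel_measurable lebesgue"
  and \<phi>_measurable [measurable]: "\<phi> \<in> borel_measurable lebesgue"
  unfolding W_def[abs_def] \<phi>_def[abs_def] by measurable

lemma smooth_measurable: "smooth g \<Longrightarrow> g \<in> borel_measurable lebesgue"
  by (intro borel_measurable_lebesgue_continuous smooth_continuous_on)

lemma ct_measurable [measurable]: "ct R L \<in> borel_measurable lebesgue"
  by (intro smooth_measurable smooth_cutoff)

lemma gradient_ct_measurable [measurable]: "gradient (ct R L) \<in> borel_measurable lebesgue"
  by (intro borel_measurable_lebesgue_continuous continuous_on_gradient smooth_cutoff)

lemma G0_le: "norm (G0 x) \<le> M"
  using M by (simp add: G0_def)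

lemma AE_G0: "AE x in lebesgue. G00 x = G0 x"
  using GM by eventually_elim (use M in \<open>auto simp: G0_def G00_def indicator_def\<close>)

lemma norm_A0: "norm (A0 x) = norm (G0 x) powr (p - 1)"
  using powr_mult_base[of "norm (G0 x)" "p - 2"]
  by (cases "G0 x = 0") (auto simp: A0_def mult.commute)

lemma norm_A0_le: "norm (A0 x) \<le> M powr (p - 1)"
  unfolding norm_A0 using G0_le p by (intro powr_mono2) auto

lemma A0_G0: "A0 x \<bullet> G0 x = norm (G0 x) powr p"
proof (cases "G0 x = 0")
  case False
  have "A0 x \<bullet> G0 x = norm (G0 x) powr (p - 2) * norm (G0 x) powr 2"
    using False by (simp add: A0_def power2_norm_eq_inner)
  then show ?thesis unfolding powr_add[symmetric] by simp
qed (simp add: A0_def)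

lemma W_nonneg: "0 \<le> W x" and W_le_1: "W x \<le> 1" and \<phi>_nonneg: "0 \<le> \<phi> x" and \<phi>_le_2: "\<phi> x \<le> 2"
  by (simp_all add: W_def \<phi>_def flat0_le_1 flat2_le_2)

text \<open>Nonnegativity of \<open>u\<close> keeps \<open>d - u0 x\<close> below \<open>d\<close>
  in the quadratic relation between \<open>flat 0\<close> and \<open>flat 2\<close>. This is how the
  right-hand side of the energy inequality can be bounded by energy again.\<close>

lemma W_le_\<phi>: "W x \<le> d\<^sup>2 * \<phi> x"
proof (cases "u0 x \<le> d")
  case True
  then have "W x = (d - u0 x)\<^sup>2 * \<phi> x" by (simp add: W_def \<phi>_def flat0_eq_square_flat2)
  also have "\<dots> \<le> d\<^sup>2 * \<phi> x"
    using True u0_nonneg[of x] d \<phi>_nonneg by (intro mult_right_mono power_mono) auto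
  finally show ?thesis .
qed (use \<phi>_nonneg in \<open>simp add: W_def\<close>)

lemma cyl_sets [measurable]: "L > 0 \<Longrightarrow> cyl R L \<in> sets lebesgue"
  unfolding cyl_def by (rule sets_cylinder) auto

lemma
  assumes L: "L > 0"
  shows integrable_cyl: "integrable lebesgue (\<lambda>x. C * indicator (cyl R L) x)"
    and integral_cyl: "(\<integral>x. C * indicator (cyl R L) x \<partial>lebesgue) = C * (vol R * (2 * L))"
proof -
  have e: "emeasure lebesgue (cyl R L) < \<infinity>"
    unfolding cyl_def by (rule emeasure_cylinder) (use L in auto)
  show "integrable lebesgue (\<lambda>x. C * indicator (cyl R L) x)"
    using e L by (intro integrable_mult_right integrable_real_indicator) auto
  have "measure lebesgue (cyl R L) = vol R * (2 * L)"
    unfolding cyl_def vol_def using measure_cylinder[of "ball 0 R" y0 "y0 + 2 * L"] L by simp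
  then show "(\<integral>x. C * indicator (cyl R L) x \<partial>lebesgue) = C * (vol R * (2 * L))"
    by simp
qed

lemma
  fixes g :: "'b \<times> real \<Rightarrow> real"
  assumes L: "L > 0" and g [measurable]: "g \<in> borel_measurable lebesgue"
    and le: "\<And>x. \<bar>g x\<bar> \<le> C * indicator (cyl R L) x"
  shows integrable_le_cyl: "integrable lebesgue g"
    and integral_le_cyl: "(\<integral>x. g x \<partial>lebesgue) \<le> C * (vol R * (2 * L))"
proof -
  show i: "integrable lebesgue g"
    by (rule Bochner_Integration.integrable_bound[OF integrable_cyl[OF L, of C R] g])
      (use le in \<open>auto intro!: AE_I2 order_trans[OF _ abs_ge_self]\<close>)
  show "(\<integral>x. g x \<partial>lebesgue) \<le> C * (vol R * (2 * L))"
    unfolding integral_cyl[OF L, symmetric]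
    using le by (intro integral_mono i integrable_cyl L) (metis abs_le_D1)
qed

lemma ct_le: "R > 0 \<Longrightarrow> L > 0 \<Longrightarrow> ct R L x \<le> indicator (cyl R L) x"
  using cutoff_zero[OF h, of R L x y0] mult_le_one[OF hcut_le_1 vcut_nonneg vcut_le_1, of R x y0 h L "snd x"]
  by (auto simp: cutoff_def cyl_def indicator_def)

lemma ct_nonneg: "0 \<le> ct R L x"
  by (simp add: cutoff_def hcut_nonneg vcut_nonneg)

text \<open>The field \<open>H\<close> is left open because two choices occur: the flux of the
  p-Laplacian for the energy, and a constant vertical vector for the vertical integration of
  \<open>W\<close>.\<close>

lemma flux_inequality:
  fixes H :: "'b \<times> real \<Rightarrow> 'b \<times> real"
  assumes R: "R > 0" and L: "L > 0"
    and H [measurable]: "H \<in> borel_measurable borel" and HN: "\<And>g. norm g \<le> M \<Longrightarrow> norm (H g) \<le> N"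
    and pos: "\<And>\<psi>. \<psi> \<in> test_functions half_space \<Longrightarrow> (\<And>x. 0 \<le> \<psi> x) \<Longrightarrow>
      0 \<le> (LINT x:half_space|lebesgue. H (G x) \<bullet> gradient \<psi> x)"
  shows "0 \<le> (\<integral>x. W x * (H (G0 x) \<bullet> gradient (ct R L) x) - ct R L x * \<phi> x * (H (G0 x) \<bullet> G0 x) \<partial>lebesgue)"
proof -
  let ?I = "indicat_real half_space"
  have N: "0 \<le> N" using order_trans[OF norm_ge_zero HN[of 0]] M by simp
  have \<Phi>: "smooth (\<lambda>s. flat 0 (d - s))"
    by (rule smooth_compose[OF smooth_flat]) (intro smooth_diff smooth_const smooth_bounded_linear bounded_linear_ident)
  have \<Phi>': "((\<lambda>s. flat 0 (d - s)) has_real_derivative - flat 2 (d - s)) (at s)" for s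
  proof -
    have "((\<lambda>s. d - s) has_real_derivative - 1) (at s)" by (auto intro!: derivative_eq_intros)
    from DERIV_chain2[OF flat0_has_real_derivative this] show ?thesis by simp
  qed
  have "(\<lambda>x. ?I x *\<^sub>R H (G x)) = (\<lambda>x. ?I x *\<^sub>R H (G00 x))"
    by (auto simp: G00_def indicator_def)
  then have mH: "set_borel_measurable lebesgue half_space (\<lambda>x. H (G x))"
    unfolding set_borel_measurable_def by simp
  have "0 \<le> (LINT x:half_space|lebesgue. flat 0 (d - u x) * (H (G x) \<bullet> gradient (ct R L) x)
      + ct R L x * (- flat 2 (d - u x)) * (H (G x) \<bullet> G x))"
  proof (rule nonneg_flux_composition[where B = "\<lambda>x. H (G x)" and N = N, OF open_half_space wg cont GM _ mH _ N pos
        enlarged_cbox_half_space[OF y0] _ smooth_cutoff cutoff_zero_cbox[OF h R L] ct_nonneg \<Phi> _ \<Phi>'])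
    show "AE x in lebesgue. x \<in> half_space \<longrightarrow> norm (H (G x)) \<le> N"
      using GM by eventually_elim (use HN in auto)
    show "continuous_on UNIV (\<lambda>s. - flat 2 (d - s))"
      by (intro continuous_intros continuous_on_compose2[OF smooth_continuous_on[OF smooth_flat, of UNIV]]) auto
  qed (use M y0 in auto)
  also have "\<dots> = (\<integral>x. W x * (H (G00 x) \<bullet> gradient (ct R L) x) - ct R L x * \<phi> x * (H (G00 x) \<bullet> G00 x) \<partial>lebesgue)"
    unfolding set_lebesgue_integral_def
  proof (rule Bochner_Integration.integral_cong[OF refl])
    fix x
    show "?I x *\<^sub>R (flat 0 (d - u x) * (H (G x) \<bullet> gradient (ct R L) x) + ct R L x * (- flat 2 (d - u x)) * (H (G x) \<bullet> G x))
      = W x * (H (G00 x) \<bullet> gradient (ct R L) x) - ct R L x * \<phi> x * (H (G00 x) \<bullet> G00 x)"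
    proof (cases "x \<in> half_space")
      case True
      then show ?thesis by (simp add: W_def \<phi>_def u0_def G00_def)
    next
      case False
      have sub: "cbox (- R *\<^sub>R One, y0) (R *\<^sub>R One, y0 + 2 * L) \<subseteq> (half_space :: ('b \<times> real) set)"
        using y0 by (auto simp: cbox_Pair_eq half_space_def)
      then have "x \<notin> cbox (- R *\<^sub>R One, y0) (R *\<^sub>R One, y0 + 2 * L)"
        using False by blast
      then have "gradient (ct R L) x = 0" "ct R L x = 0"
        using gradient_zero_outside_cbox[of _ _ "ct R L" x, OF cutoff_zero_cbox[OF h R L]]
          cutoff_zero_cbox[OF h R L] by blast+
      with False show ?thesis by simp
    qed
  qed
  also have "\<dots> = (\<integral>x. W x * (H (G0 x) \<bullet> gradient (ct R L) x) - ct R L x * \<phi> x * (H (G0 x) \<bullet> G0 x) \<partial>lebesgue)"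
    by (rule integral_cong_AE) (use AE_G0 in \<open>auto elim: eventually_mono\<close>)
  finally show ?thesis .
qed

end

section \<open>Young-type inequalities for powers\<close>

text \<open>Split at \<open>l * g = 1\<close>: above it the first summand alone suffices, below it
  the second.\<close>

lemma powr_Young:
  fixes g l p :: real
  assumes "p > 1" "0 \<le> g" "0 < l"
  shows "g powr (p - 1) \<le> l * g powr p + l powr (1 - p)"
proof (cases "1 \<le> l * g")
  case True
  then have "g > 0" using assms by (cases "g = 0") auto
  then have "l * g powr p = (l * g) * g powr (p - 1)"
    using powr_mult_base[of g "p - 1"] assms by simp
  moreover have "1 * g powr (p - 1) \<le> (l * g) * g powr (p - 1)"
    using True by (intro mult_right_mono) auto
  ultimately have "g powr (p - 1) \<le> l * g powr p" by (metis mult_1)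
  then show ?thesis by (simp add: add_increasing2)
next
  case False
  then have "g \<le> 1 / l" using assms by (simp add: field_simps)
  then have "g powr (p - 1) \<le> (1 / l) powr (p - 1)"
    using assms by (intro powr_mono2) auto
  also have "\<dots> = l powr (1 - p)"
    using assms by (simp add: powr_divide powr_minus_divide[symmetric])
  finally show ?thesis using assms by (simp add: add_increasing)
qed

text \<open>Split at \<open>g = m\<close>. The bound trades the first power of the gradient for the
  energy density plus a small constant.\<close>

lemma le_powr_Young:
  fixes g m p :: real
  assumes "p > 1" "0 \<le> g" "0 < m"
  shows "g \<le> m powr (1 - p) * g powr p + m"
proof (cases "g \<le> m")
  case False
  then have g: "g > 0" "m < g" using assms by auto
  have "g = m powr (1 - p) * (g * m powr (p - 1))"
    using assms by (simp add: powr_add[symmetric] mult.left_commute)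
  also have "\<dots> \<le> m powr (1 - p) * (g * g powr (p - 1))"
    using g assms by (intro mult_left_mono powr_mono2) auto
  also have "g * g powr (p - 1) = g powr p"
    using powr_mult_base[of g "p - 1"] g by simp
  finally show ?thesis using assms by simp
qed (use assms in \<open>simp add: add_increasing\<close>)

lemma norm_flux: "norm (norm g powr (p - 2) *\<^sub>R g) = norm g powr (p - 1)"
  using powr_mult_base[of "norm g" "p - 2"] by (cases "g = 0") (auto simp: mult.commute)

section \<open>Splitting the gradient of the cutoff\<close>

context half_space_solution
begin

abbreviation a :: real
  where "a \<equiv> M powr (p - 1)"

text \<open>The factor of \<open>- 1 / L\<close> in that part of the vertical derivative of the
  cutoff which comes from the decay.\<close>

definition edge :: "real \<Rightarrow> real \<Rightarrow> 'b \<times> real \<Rightarrow> real"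
  where "edge R L x = hcut R x * (smooth_step ((snd x - y0) / h) * flat 2 (2 - (snd x - y0) / L))"

definition energy :: "real \<Rightarrow> real \<Rightarrow> real"
  where "energy R L = (\<integral>x. \<phi> x * norm (G0 x) powr p * ct R L x \<partial>lebesgue)"

lemma edge_nonneg: "0 \<le> edge R L x"
  by (simp add: edge_def hcut_nonneg smooth_step_nonneg)

lemma smooth_step_below: "t \<le> y0 \<Longrightarrow> smooth_step ((t - y0) / h) = 0"
  using h by (simp add: smooth_step_eq_0 divide_nonpos_pos)

lemma edge_zero:
  assumes "R > 0" "L > 0" "x \<notin> cyl R L" shows "edge R L x = 0"
proof -
  consider "norm (fst x) \<ge> R" | "snd x < y0" | "snd x > y0 + 2 * L"
    using assms(3) by (cases x) (auto simp: cyl_def)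
  then show ?thesis
  proof cases
    case 3
    then have "(snd x - y0) / L \<ge> 2" using assms by (simp add: field_simps)
    then show ?thesis by (simp add: edge_def)
  qed (use assms in \<open>auto simp: edge_def hcut_zero smooth_step_below\<close>)
qed

lemma hcut_step_le_1: "hcut R x * smooth_step t \<le> 1"
  by (intro mult_le_one hcut_le_1 smooth_step_nonneg smooth_step_le_1)

lemma hcut_step_nonneg: "0 \<le> hcut R x * smooth_step t"
  by (intro mult_nonneg_nonneg hcut_nonneg smooth_step_nonneg)

lemma edge_le: "R > 0 \<Longrightarrow> L > 0 \<Longrightarrow> edge R L x \<le> 2 * indicator (cyl R L) x"
proof (cases "x \<in> cyl R L")
  case True
  have "(hcut R x * smooth_step ((snd x - y0) / h)) * flat 2 (2 - (snd x - y0) / L) \<le> 1 * 2"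
    by (intro mult_mono hcut_step_le_1 flat2_le_2) auto
  with True show ?thesis by (simp add: edge_def mult.assoc)
qed (simp add: edge_zero)

lemma W_edge:
  assumes "R > 0" "L > 0"
  shows "0 \<le> W x * edge R L x" "W x * edge R L x \<le> 2 * indicator (cyl R L) x"
  using edge_nonneg[of R L x] W_nonneg[of x] edge_le[OF assms, of x]
    mult_left_le_one_le[OF edge_nonneg[of R L x] W_nonneg[of x] W_le_1]
  by (simp, linarith)

text \<open>On \<open>cyl R L\<close> the decay factor of the cutoff of doubled height is still at
  least \<open>flat 0 1 = exp (- 1)\<close>. The doubling is the reason why the recursion links
  \<open>L\<close> to \<open>2 * L\<close>.\<close>

lemma edge_le_ct:
  assumes "R > 0" "L > 0" shows "edge R L x \<le> 2 * exp 1 * ct R (2 * L) x"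
proof (cases "x \<in> cyl R L")
  case True
  then have "(snd x - y0) / (2 * L) \<le> 1" using assms by (auto simp: cyl_def)
  then have "flat 0 1 \<le> flat 0 (2 - (snd x - y0) / (2 * L))" by (intro flat0_mono) auto
  then have "exp 1 * exp (-1) \<le> exp 1 * flat 0 (2 - (snd x - y0) / (2 * L))"
    by (intro mult_left_mono) (auto simp: flat_def)
  then have "1 \<le> exp 1 * flat 0 (2 - (snd x - y0) / (2 * L))"
    by (simp add: exp_minus)
  then have "flat 2 (2 - (snd x - y0) / L) \<le> 2 * (exp 1 * flat 0 (2 - (snd x - y0) / (2 * L)))"
    using flat2_le_2[of "2 - (snd x - y0) / L"] by linarith
  then have "(hcut R x * smooth_step ((snd x - y0) / h)) * flat 2 (2 - (snd x - y0) / L)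
     \<le> (hcut R x * smooth_step ((snd x - y0) / h)) * (2 * (exp 1 * flat 0 (2 - (snd x - y0) / (2 * L))))"
    by (rule mult_left_mono[OF _ hcut_step_nonneg])
  then show ?thesis by (simp add: edge_def cutoff_def vcut_def mult_ac)
next
  case False
  then show ?thesis using edge_zero[OF assms False] ct_nonneg by simp
qed

text \<open>Here \<open>flat 0 s = s\<^sup>2 * flat 2 s\<close> is used with
  \<open>0 \<le> s \<le> 2\<close>, whence the factor 4.\<close>

lemma ct_le_edge:
  assumes "R > 0" "L > 0" shows "ct R L x \<le> 4 * edge R L x"
proof (cases "x \<in> cyl R L")
  case True
  then have s: "0 \<le> (snd x - y0) / L" "(snd x - y0) / L \<le> 2" using assms by (auto simp: cyl_def field_simps)
  then have "flat 0 (2 - (snd x - y0) / L) = (2 - (snd x - y0) / L)\<^sup>2 * flat 2 (2 - (snd x - y0) / L)"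
    by (intro flat0_eq_square_flat2) auto
  also have "\<dots> \<le> 2\<^sup>2 * flat 2 (2 - (snd x - y0) / L)"
    using s by (intro mult_right_mono power_mono) auto
  finally have "(hcut R x * smooth_step ((snd x - y0) / h)) * flat 0 (2 - (snd x - y0) / L)
     \<le> (hcut R x * smooth_step ((snd x - y0) / h)) * (2\<^sup>2 * flat 2 (2 - (snd x - y0) / L))"
    by (rule mult_left_mono[OF _ hcut_step_nonneg])
  then show ?thesis by (simp add: edge_def cutoff_def vcut_def mult_ac)
next
  case False
  then show ?thesis using ct_le[OF assms, of x] edge_nonneg[of R L x] by simp
qed

lemma ct_mono:
  assumes "0 < T" "T \<le> L" shows "ct R T x \<le> ct R L x"
proof (cases "snd x \<le> y0")
  case True
  then show ?thesis by (simp add: cutoff_def vcut_def smooth_step_below)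
next
  case False
  then have "(snd x - y0) / L \<le> (snd x - y0) / T" using assms by (intro divide_left_mono) auto
  then have "flat 0 (2 - (snd x - y0) / T) \<le> flat 0 (2 - (snd x - y0) / L)"
    by (intro flat0_mono) auto
  then show ?thesis
    by (simp add: cutoff_def vcut_def mult_left_mono hcut_nonneg smooth_step_nonneg)
qed

lemma edge_measurable [measurable]: "edge R L \<in> borel_measurable lebesgue"
proof (rule borel_measurable_lebesgue_continuous)
  have c: "continuous_on UNIV (flat 0)" "continuous_on UNIV (flat 2)" "continuous_on UNIV smooth_step"
    by (intro smooth_continuous_on smooth_flat smooth_smooth_step)+
  have "continuous_on UNIV (\<lambda>x :: 'b \<times> real. 1 - (norm (fst x))\<^sup>2 * inverse (R\<^sup>2))"
    "continuous_on UNIV (\<lambda>x :: 'b \<times> real. (snd x - y0) * inverse h)"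
    "continuous_on UNIV (\<lambda>x :: 'b \<times> real. 2 - (snd x - y0) * inverse L)"
    by (intro continuous_intros)+
  note cs = continuous_on_compose2[OF c(1) this(1) subset_UNIV]
    continuous_on_compose2[OF c(3) this(2) subset_UNIV] continuous_on_compose2[OF c(2) this(3) subset_UNIV]
  show "continuous_on UNIV (edge R L)"
    unfolding edge_def[abs_def] hcut_def divide_inverse
    by (rule continuous_on_mult[OF cs(1) continuous_on_mult[OF cs(2,3)]])
qed

text \<open>The lower transition layer of the cutoff lies where \<open>u \<ge> d\<close>, hence is invisible to \<open>W\<close>.\<close>

lemma W_vcut':
  assumes "L > 0"
  shows "W x * (hcut R x * vcut' y0 h L (snd x)) = - (W x * edge R L x / L)"
proof -
  let ?s = "(snd x - y0) / h"
  have "W x * (flat 2 (flat 0 1 - flat 0 (1 - ?s)) * flat 2 (1 - ?s)) = 0"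
  proof -
    consider "snd x \<le> y0" | "y0 \<le> snd x" "snd x \<le> y0 + h" | "snd x \<ge> y0 + h" by linarith
    then show ?thesis
    proof cases
      case 1
      then have "?s \<le> 0" using h by (simp add: divide_nonpos_pos)
      then have "flat 0 1 \<le> flat 0 (1 - ?s)" by (intro flat0_mono) auto
      then show ?thesis by simp
    next
      case 2
      then have "u0 x = u x" using y0 by (simp add: u0_def half_space_def)
      then have "d \<le> u0 x" using low[OF 2, of "fst x"] by simp
      then show ?thesis by (simp add: W_def)
    next
      case 3
      then have "?s \<ge> 1" using h by (simp add: field_simps)
      then show ?thesis by simp
    qed
  qed
  then show ?thesis
    unfolding vcut'_def edge_def by (auto simp: algebra_simps)
qed

lemma W_gradient_ct:
  assumes "L > 0"
  shows "W x * (B \<bullet> gradient (ct R L) x) =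
    - (W x * edge R L x / L) * (B \<bullet> (0, 1)) + W x * (vcut y0 h L (snd x) * (B \<bullet> hcut_grad R x))"
proof -
  have "W x * (B \<bullet> gradient (ct R L) x) = (W x * (hcut R x * vcut' y0 h L (snd x))) * (B \<bullet> (0, 1))
      + W x * (vcut y0 h L (snd x) * (B \<bullet> hcut_grad R x))"
    using h assms by (subst gradient_cutoff) (auto simp: inner_add_right algebra_simps simp del: scaleR_Pair)
  then show ?thesis unfolding W_vcut'[OF assms] .
qed

lemma vcut_hcut_grad_le:
  assumes "R > 0" "L > 0"
  shows "\<bar>vcut y0 h L (snd x) * (B \<bullet> hcut_grad R x)\<bar> \<le> norm B * (4 / R) * indicator (cyl R L) x"
proof -
  have v: "vcut y0 h L (snd x) \<le> indicator {y0..y0 + 2 * L} (snd x)"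
    using vcut_le_1 vcut_zero[OF h assms(2), of "snd x" y0] by (auto simp: indicator_def)
  have "\<bar>B \<bullet> hcut_grad R x\<bar> \<le> norm B * (4 / R * indicator (ball 0 R) (fst x))"
    by (rule order_trans[OF Cauchy_Schwarz_ineq2] mult_left_mono norm_hcut_grad_le assms norm_ge_zero)+
  then have "vcut y0 h L (snd x) * \<bar>B \<bullet> hcut_grad R x\<bar>
     \<le> indicator {y0..y0 + 2 * L} (snd x) * (norm B * (4 / R * indicator (ball 0 R) (fst x)))"
    using v by (intro mult_mono) (auto simp: vcut_nonneg)
  also have "\<dots> = norm B * (4 / R) * indicator (cyl R L) x"
    by (cases x) (auto simp: cyl_def indicator_def)
  finally show ?thesis by (simp add: abs_mult vcut_nonneg)
qed

text \<open>The first bound keeps \<open>W x * edge R L x\<close>, from which energy can be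
  recovered; the second is crude and serves integrability and the a priori bound.\<close>

lemma W_gradient_ct_le:
  assumes "R > 0" "L > 0"
  shows "W x * (B \<bullet> gradient (ct R L) x) \<le> norm B * (W x * edge R L x) / L + norm B * (4 / R) * indicator (cyl R L) x"
    and "\<bar>W x * (B \<bullet> gradient (ct R L) x)\<bar> \<le> norm B * (2 / L + 4 / R) * indicator (cyl R L) x"
proof -
  note We = W_edge[OF assms, of x]
  have "norm ((0, 1) :: 'b \<times> real) = 1" by (simp add: norm_Pair)
  then have b: "\<bar>B \<bullet> (0, 1)\<bar> \<le> norm B" using Cauchy_Schwarz_ineq2[of B "(0, 1)"] by simp
  have 1: "\<bar>- (W x * edge R L x / L) * (B \<bullet> (0, 1))\<bar> \<le> norm B * (W x * edge R L x) / L"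
  proof -
    have "\<bar>- (W x * edge R L x / L) * (B \<bullet> (0, 1))\<bar> = \<bar>B \<bullet> (0, 1)\<bar> * (W x * edge R L x / L)"
      using We(1) assms W_nonneg edge_nonneg by (simp add: abs_mult)
    also have "\<dots> \<le> norm B * (W x * edge R L x / L)"
      using b We(1) assms by (intro mult_right_mono) auto
    finally show ?thesis by simp
  qed
  have "\<bar>W x\<bar> * \<bar>vcut y0 h L (snd x) * (B \<bullet> hcut_grad R x)\<bar> \<le> 1 * (norm B * (4 / R) * indicator (cyl R L) x)"
    using W_nonneg W_le_1 by (intro mult_mono vcut_hcut_grad_le assms) auto
  then have 2: "\<bar>W x * (vcut y0 h L (snd x) * (B \<bullet> hcut_grad R x))\<bar> \<le> norm B * (4 / R) * indicator (cyl R L) x"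
    by (simp add: abs_mult)
  have eq: "W x * (B \<bullet> gradient (ct R L) x) =
    - (W x * edge R L x / L) * (B \<bullet> (0, 1)) + W x * (vcut y0 h L (snd x) * (B \<bullet> hcut_grad R x))"
    by (rule W_gradient_ct[OF assms(2)])
  show "W x * (B \<bullet> gradient (ct R L) x) \<le> norm B * (W x * edge R L x) / L + norm B * (4 / R) * indicator (cyl R L) x"
    using eq 1 2 by linarith
  have "norm B * (W x * edge R L x) / L \<le> norm B * (2 * indicator (cyl R L) x) / L"
    using We(2) assms by (intro divide_right_mono mult_left_mono) auto
  moreover have "norm B * (2 / L + 4 / R) * indicator (cyl R L) x
      = norm B * (2 * indicator (cyl R L) x) / L + norm B * (4 / R) * indicator (cyl R L) x"
    by (simp add: algebra_simps)
  ultimately show "\<bar>W x * (B \<bullet> gradient (ct R L) x)\<bar> \<le> norm B * (2 / L + 4 / R) * indicator (cyl R L) x"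
    using eq 1 2 by linarith
qed

section \<open>Energy inequality, a priori bound and recursion\<close>

lemma energy_integrable:
  assumes "R > 0" "L > 0"
  shows "integrable lebesgue (\<lambda>x. \<phi> x * norm (G0 x) powr p * ct R L x)"
proof (rule integrable_le_cyl[OF assms(2), where C = "2 * M powr p" and R = R])
  fix x
  have "norm (G0 x) powr p \<le> M powr p" using G0_le p by (intro powr_mono2) auto
  then have "\<phi> x * norm (G0 x) powr p * ct R L x \<le> 2 * M powr p * indicator (cyl R L) x"
    by (intro mult_mono \<phi>_le_2 ct_le assms) (auto simp: \<phi>_nonneg ct_nonneg)
  then show "\<bar>\<phi> x * norm (G0 x) powr p * ct R L x\<bar> \<le> 2 * M powr p * indicator (cyl R L) x"
    by (simp add: abs_mult \<phi>_nonneg ct_nonneg)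
qed measurable

lemma W_A0_gradient_integrable:
  assumes "R > 0" "L > 0"
  shows "integrable lebesgue (\<lambda>x. W x * (A0 x \<bullet> gradient (ct R L) x))"
proof (rule integrable_le_cyl[OF assms(2), where C = "a * (2 / L + 4 / R)" and R = R])
  fix x
  have "norm (A0 x) * (2 / L + 4 / R) * indicator (cyl R L) x \<le> a * (2 / L + 4 / R) * indicator (cyl R L) x"
    using assms norm_A0_le by (intro mult_right_mono) auto
  then show "\<bar>W x * (A0 x \<bullet> gradient (ct R L) x)\<bar> \<le> a * (2 / L + 4 / R) * indicator (cyl R L) x"
    using W_gradient_ct_le(2)[OF assms, of x "A0 x"] by linarith
qed measurable

text \<open>The nonnegative source gives the flux the sign required in
  \<open>flux_inequality\<close>, and the inner product of \<open>A0\<close> with \<open>G0\<close>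
  is the p-th power of the gradient.\<close>

lemma energy_le_flux:
  assumes "R > 0" "L > 0"
  shows "energy R L \<le> (\<integral>x. W x * (A0 x \<bullet> gradient (ct R L) x) \<partial>lebesgue)"
proof -
  have "0 \<le> (\<integral>x. W x * ((norm (G0 x) powr (p - 2) *\<^sub>R G0 x) \<bullet> gradient (ct R L) x)
      - ct R L x * \<phi> x * ((norm (G0 x) powr (p - 2) *\<^sub>R G0 x) \<bullet> G0 x) \<partial>lebesgue)"
  proof (rule flux_inequality[OF assms, where N = a])
    show "(\<lambda>g::'b \<times> real. norm g powr (p - 2) *\<^sub>R g) \<in> borel_measurable borel" by measurable
    show "norm (norm g powr (p - 2) *\<^sub>R g) \<le> a" if "norm g \<le> M" for g :: "'b \<times> real"
      unfolding norm_flux using that p by (intro powr_mono2) auto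
    fix \<psi> :: "'b \<times> real \<Rightarrow> real" assume \<psi>: "\<psi> \<in> test_functions half_space" "\<And>x. 0 \<le> \<psi> x"
    have "0 \<le> (LINT x:half_space|lebesgue. f (u x) * \<psi> x)"
      unfolding set_lebesgue_integral_def using u_nonneg f_nonneg \<psi>(2)
      by (intro Bochner_Integration.integral_nonneg) (auto simp: indicator_def)
    with sol \<psi>(1) show "0 \<le> (LINT x:half_space|lebesgue. (norm (G x) powr (p - 2) *\<^sub>R G x) \<bullet> gradient \<psi> x)"
      by (simp add: p_Laplace_solution_def)
  qed
  then have "0 \<le> (\<integral>x. W x * (A0 x \<bullet> gradient (ct R L) x) - \<phi> x * norm (G0 x) powr p * ct R L x \<partial>lebesgue)"
    unfolding A0_def[symmetric] A0_G0 by (simp add: mult_ac)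
  then show ?thesis
    using Bochner_Integration.integral_diff[OF W_A0_gradient_integrable[OF assms] energy_integrable[OF assms]]
    by (simp add: energy_def)
qed

lemma vol_nonneg: "0 \<le> vol R"
  by (simp add: vol_def)

text \<open>The factor \<open>1 / L\<close> in the vertical derivative cancels the height
  \<open>2 * L\<close> of the cylinder, so the energy per unit of base stays bounded as long as
  \<open>L / R\<close> does.\<close>

lemma energy_bound:
  assumes "R > 0" "L > 0"
  shows "energy R L \<le> a * vol R * (4 + 8 * L / R)"
proof -
  have "(\<integral>x. W x * (A0 x \<bullet> gradient (ct R L) x) \<partial>lebesgue) \<le> a * (2 / L + 4 / R) * (vol R * (2 * L))"
  proof (rule integral_le_cyl[OF assms(2)])
    fix x
    have "norm (A0 x) * (2 / L + 4 / R) * indicator (cyl R L) x \<le> a * (2 / L + 4 / R) * indicator (cyl R L) x"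
      using assms norm_A0_le by (intro mult_right_mono) auto
    then show "\<bar>W x * (A0 x \<bullet> gradient (ct R L) x)\<bar> \<le> a * (2 / L + 4 / R) * indicator (cyl R L) x"
      using W_gradient_ct_le(2)[OF assms, of x "A0 x"] by linarith
  qed measurable
  moreover have "a * (2 / L + 4 / R) * (vol R * (2 * L)) = a * vol R * (4 + 8 * L / R)"
    using assms by (simp add: field_simps)
  ultimately show ?thesis using energy_le_flux[OF assms] by linarith
qed

text \<open>Young's inequality with parameter \<open>l\<close> splits \<open>norm (A0 x)\<close>;
  the part with the p-th power becomes energy at height \<open>2 * L\<close> through
  \<open>W_le_\<phi>\<close> and \<open>edge_le_ct\<close>.\<close>

lemma energy_recursion:
  assumes "R > 0" "L > 0" "l > 0"
  shows "energy R L \<le> 2 * exp 1 * d\<^sup>2 * l / L * energy R (2 * L)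
    + (2 * l powr (1 - p) / L + 4 * a / R) * (vol R * (2 * L))"
proof -
  let ?e = "\<lambda>x. \<phi> x * norm (G0 x) powr p * ct R (2 * L) x"
  let ?c = "2 * exp 1 * d\<^sup>2 * l / L" and ?C = "2 * l powr (1 - p) / L + 4 * a / R"
  have L2: "2 * L > 0" using assms by simp
  have pw: "W x * (A0 x \<bullet> gradient (ct R L) x) \<le> ?c * ?e x + ?C * indicator (cyl R L) x" for x
  proof -
    let ?I = "indicator (cyl R L) x :: real"
    note We = W_edge[OF assms(1,2), of x]
    have "norm (A0 x) * (W x * edge R L x)
       \<le> (l * norm (G0 x) powr p + l powr (1 - p)) * (W x * edge R L x)"
      unfolding norm_A0 using powr_Young[OF p norm_ge_zero assms(3)] We by (intro mult_right_mono) auto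
    also have "\<dots> = l * norm (G0 x) powr p * (W x * edge R L x) + l powr (1 - p) * (W x * edge R L x)"
      by (simp add: algebra_simps)
    also have "\<dots> \<le> l * norm (G0 x) powr p * ((d\<^sup>2 * \<phi> x) * (2 * exp 1 * ct R (2 * L) x)) + l powr (1 - p) * (2 * ?I)"
    proof (rule add_mono)
      show "l powr (1 - p) * (W x * edge R L x) \<le> l powr (1 - p) * (2 * ?I)"
        using We(2) by (rule mult_left_mono) simp
      have "W x * edge R L x \<le> (d\<^sup>2 * \<phi> x) * (2 * exp 1 * ct R (2 * L) x)"
        using \<phi>_nonneg by (intro mult_mono W_le_\<phi> edge_le_ct assms edge_nonneg) auto
      then show "l * norm (G0 x) powr p * (W x * edge R L x)
          \<le> l * norm (G0 x) powr p * ((d\<^sup>2 * \<phi> x) * (2 * exp 1 * ct R (2 * L) x))"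
        using assms(3) by (intro mult_left_mono) auto
    qed
    finally have "norm (A0 x) * (W x * edge R L x) / L
       \<le> (l * norm (G0 x) powr p * ((d\<^sup>2 * \<phi> x) * (2 * exp 1 * ct R (2 * L) x)) + l powr (1 - p) * (2 * ?I)) / L"
      using assms by (intro divide_right_mono) auto
    also have "\<dots> = ?c * ?e x + 2 * l powr (1 - p) / L * ?I"
      by (simp add: add_divide_distrib mult_ac)
    finally have 1: "norm (A0 x) * (W x * edge R L x) / L \<le> ?c * ?e x + 2 * l powr (1 - p) / L * ?I" .
    have "norm (A0 x) * (4 / R) * ?I \<le> a * (4 / R) * ?I"
      using assms norm_A0_le by (intro mult_right_mono) auto
    then have "norm (A0 x) * (4 / R) * ?I \<le> 4 * a / R * ?I" by (simp add: mult_ac)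
    with 1 W_gradient_ct_le(1)[OF assms(1,2), of x "A0 x"]
    show ?thesis by (simp add: distrib_right)
  qed
  have "energy R L \<le> (\<integral>x. W x * (A0 x \<bullet> gradient (ct R L) x) \<partial>lebesgue)"
    by (rule energy_le_flux[OF assms(1,2)])
  also have "\<dots> \<le> (\<integral>x. ?c * ?e x + ?C * indicator (cyl R L) x \<partial>lebesgue)"
    by (intro integral_mono pw W_A0_gradient_integrable[OF assms(1,2)] Bochner_Integration.integrable_add
        integrable_mult_right energy_integrable[OF assms(1) L2] integrable_cyl[OF assms(2)])
  also have "\<dots> = ?c * energy R (2 * L) + ?C * (vol R * (2 * L))"
    unfolding integral_cyl[OF assms(2), symmetric] energy_def
    by (subst Bochner_Integration.integral_add[OF integrable_mult_right[OF energy_integrable[OF assms(1) L2]] integrable_cyl[OF assms(2)]])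
      (simp add: mult.assoc)
  finally show ?thesis .
qed

section \<open>The deficit of the solution below the level \<open>d\<close>\<close>

text \<open>\<open>W\<close> is positive only where \<open>u0 x < d\<close>, so this measures how
  much of the cylinder lies below \<open>d\<close>. The weight is \<open>edge\<close> because the
  vertical derivative of the cutoff produces it.\<close>

definition deficit :: "real \<Rightarrow> real \<Rightarrow> real"
  where "deficit R T = (\<integral>x. W x * edge R T x \<partial>lebesgue)"

lemma W_edge_integrable:
  assumes "R > 0" "T > 0"
  shows "integrable lebesgue (\<lambda>x. W x * edge R T x)"
  by (rule integrable_le_cyl[OF assms(2), where C = 2 and R = R])
    (use W_edge[OF assms] in \<open>auto simp: abs_of_nonneg\<close>)

lemma energy_mono:
  assumes "R > 0" "0 < T" "T \<le> L"
  shows "energy R T \<le> energy R L"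
proof -
  have "L > 0" using assms by simp
  then show ?thesis
    unfolding energy_def using assms \<phi>_nonneg ct_mono
    by (intro integral_mono energy_integrable mult_left_mono) auto
qed

text \<open>A constant vertical field has zero divergence, so testing it with \<zeta> \<Phi>(u)
  integrates \<open>W\<close> vertically from the slab where it vanishes. The vertical derivative of
  \<open>W\<close> is controlled by the energy through Young's inequality with the free parameter
  \<open>m\<close>.\<close>

lemma deficit_bound:
  assumes R: "R > 0" and T: "0 < T" "T \<le> L" and m: "m > 0"
  shows "deficit R T \<le> T * (m powr (1 - p) * energy R L + 4 * m * T * vol R)"
proof -
  let ?e = "(0, 1) :: 'b \<times> real"
  have ne: "norm ?e = 1" by (simp add: norm_Pair)
  have pos: "0 \<le> (LINT x:half_space|lebesgue. ?e \<bullet> gradient \<psi> x)"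
    if "\<psi> \<in> test_functions half_space" for \<psi> :: "'b \<times> real \<Rightarrow> real"
  proof -
    note t = test_functionsD[OF that]
    obtain s where s: "closure {x. \<psi> x \<noteq> 0} \<subseteq> cbox (- s) s"
      using bounded_subset_cbox_symmetric[OF compact_imp_bounded[OF t(2)]] by blast
    have z: "\<psi> x = 0" if "x \<notin> cbox (- s) s" for x
      using that s closure_subset[of "{x. \<psi> x \<noteq> 0}"] by blast
    have "(LINT x:half_space|lebesgue. ?e \<bullet> gradient \<psi> x) = (\<integral>x. gradient \<psi> x \<bullet> ?e \<partial>lebesgue)"
      unfolding set_lebesgue_integral_def
    proof (rule Bochner_Integration.integral_cong[OF refl])
      show "indicat_real half_space x *\<^sub>R (?e \<bullet> gradient \<psi> x) = gradient \<psi> x \<bullet> ?e" for x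
        using gradient_zero_outside[OF t(3), of x] by (cases "x \<in> half_space") (auto simp: inner_commute)
    qed
    also have "\<dots> = 0" by (rule integral_gradient_eq_0[OF t(1) z])
    finally show ?thesis by simp
  qed
  have 0: "0 \<le> (\<integral>x. W x * (?e \<bullet> gradient (ct R T) x) - ct R T x * \<phi> x * (?e \<bullet> G0 x) \<partial>lebesgue)"
    by (rule flux_inequality[OF R T(1), where N = 1 and H = "\<lambda>_. ?e"]) (use pos ne in auto)
  \<comment> \<open>The lateral part of the cutoff gradient is horizontal and drops out, and
    \<open>W\<close> removes the lower layer.\<close>
  have W_eq: "W x * (?e \<bullet> gradient (ct R T) x) = - (1 / T) * (W x * edge R T x)" for x
  proof -
    have "?e \<bullet> hcut_grad R x = 0" by (simp add: hcut_grad_def inner_prod_def)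
    then show ?thesis using W_gradient_ct[OF T(1), of x ?e R] by (simp add: inner_prod_def)
  qed
  have le: "- (ct R T x * \<phi> x * (?e \<bullet> G0 x)) \<le>
      m powr (1 - p) * (\<phi> x * norm (G0 x) powr p * ct R T x) + 2 * m * indicator (cyl R T) x" for x
  proof -
    have c: "0 \<le> ct R T x * \<phi> x" by (simp add: ct_nonneg \<phi>_nonneg)
    have "- (?e \<bullet> G0 x) \<le> norm (G0 x)" using Cauchy_Schwarz_ineq2[of ?e "G0 x"] ne by simp
    also have "\<dots> \<le> m powr (1 - p) * norm (G0 x) powr p + m" by (rule le_powr_Young[OF p norm_ge_zero m])
    finally have "(ct R T x * \<phi> x) * - (?e \<bullet> G0 x) \<le> (ct R T x * \<phi> x) * (m powr (1 - p) * norm (G0 x) powr p + m)"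
      by (rule mult_left_mono[OF _ c])
    moreover have "ct R T x * \<phi> x * m \<le> indicator (cyl R T) x * 2 * m"
      using m by (intro mult_right_mono mult_mono ct_le R T \<phi>_le_2) (auto simp: \<phi>_nonneg)
    ultimately show ?thesis by (simp add: algebra_simps)
  qed
  have i1: "integrable lebesgue (\<lambda>x. - (1 / T) * (W x * edge R T x))"
    by (intro integrable_mult_right W_edge_integrable R T)
  have i2: "integrable lebesgue (\<lambda>x. m powr (1 - p) * (\<phi> x * norm (G0 x) powr p * ct R T x) + 2 * m * indicator (cyl R T) x)"
    by (intro Bochner_Integration.integrable_add integrable_mult_right energy_integrable integrable_cyl R T)
  have i3: "integrable lebesgue (\<lambda>x. ct R T x * \<phi> x * (?e \<bullet> G0 x))"
  proof (rule integrable_le_cyl[OF T(1), where C = "2 * M" and R = R])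
    fix x
    have "\<bar>?e \<bullet> G0 x\<bar> \<le> M" using Cauchy_Schwarz_ineq2[of ?e "G0 x"] ne G0_le[of x] by simp
    then have "ct R T x * \<phi> x * \<bar>?e \<bullet> G0 x\<bar> \<le> indicator (cyl R T) x * 2 * M"
      using M by (intro mult_mono ct_le R T \<phi>_le_2) (auto simp: \<phi>_nonneg ct_nonneg)
    then show "\<bar>ct R T x * \<phi> x * (?e \<bullet> G0 x)\<bar> \<le> 2 * M * indicator (cyl R T) x"
      by (simp add: abs_mult ct_nonneg \<phi>_nonneg mult_ac)
  qed measurable
  have "0 \<le> (\<integral>x. - (1 / T) * (W x * edge R T x) \<partial>lebesgue) - (\<integral>x. ct R T x * \<phi> x * (?e \<bullet> G0 x) \<partial>lebesgue)"
    using 0 unfolding W_eq Bochner_Integration.integral_diff[OF i1 i3] .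
  moreover have "- (\<integral>x. ct R T x * \<phi> x * (?e \<bullet> G0 x) \<partial>lebesgue)
     \<le> m powr (1 - p) * energy R T + 2 * m * (vol R * (2 * T))"
  proof -
    have "- (\<integral>x. ct R T x * \<phi> x * (?e \<bullet> G0 x) \<partial>lebesgue) = (\<integral>x. - (ct R T x * \<phi> x * (?e \<bullet> G0 x)) \<partial>lebesgue)"
      by (rule Bochner_Integration.integral_minus[symmetric])
    also have "\<dots> \<le> (\<integral>x. m powr (1 - p) * (\<phi> x * norm (G0 x) powr p * ct R T x) + 2 * m * indicator (cyl R T) x \<partial>lebesgue)"
      by (rule integral_mono[OF Bochner_Integration.integrable_minus[OF i3] i2 le])
    also have "\<dots> = m powr (1 - p) * energy R T + 2 * m * (vol R * (2 * T))"
      unfolding integral_cyl[OF T(1), symmetric] energy_def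
      by (subst Bochner_Integration.integral_add[OF integrable_mult_right[OF energy_integrable[OF R T(1)]] integrable_cyl[OF T(1)]])
        simp
    finally show ?thesis .
  qed
  moreover have "(\<integral>x. - (1 / T) * (W x * edge R T x) \<partial>lebesgue) = - (deficit R T / T)"
    unfolding deficit_def by simp
  ultimately have "deficit R T / T \<le> m powr (1 - p) * energy R T + 2 * m * (vol R * (2 * T))"
    by linarith
  \<comment> \<open>The energy per unit of base will be small for tall cylinders, hence the passage
    from \<open>T\<close> to \<open>L\<close>.\<close>
  also have "\<dots> \<le> m powr (1 - p) * energy R L + 4 * m * T * vol R"
    using energy_mono[OF R T] by (simp add: mult_left_mono)
  finally show ?thesis using T by (simp add: divide_le_eq mult.commute)
qed

section \<open>Upper and lower bounds for the integrated source\<close>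

text \<open>Without the factor \<open>W\<close> the lower transition layer counts. It lies in
  \<open>cyl R (h / 2)\<close>, whose height is \<open>h\<close>, and contributes a gradient of
  order \<open>1 / h\<close>.\<close>

lemma gradient_ct_le:
  assumes "R > 0" "T > 0"
  shows "B \<bullet> gradient (ct R T) x \<le> norm B * (4 / h * indicator (cyl R (h / 2)) x + (2 / T + 4 / R) * indicator (cyl R T) x)"
proof -
  let ?s = "(snd x - y0) / h" and ?I = "indicator (cyl R T) x :: real" and ?J = "indicator (cyl R (h / 2)) x :: real"
  let ?g = "flat 2 (flat 0 1 - flat 0 (1 - ?s)) * flat 2 (1 - ?s)"
  let ?e = "(0, 1) :: 'b \<times> real"
  have ne: "norm ?e = 1" by (simp add: norm_Pair)
  have be: "\<bar>B \<bullet> ?e\<bar> \<le> norm B" using Cauchy_Schwarz_ineq2[of B ?e] ne by simp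
  have g: "hcut R x * ?g \<le> 4 * ?J"
  proof (cases "x \<in> cyl R (h / 2)")
    case True
    have "?g \<le> 2 * 2" by (intro mult_mono flat2_le_2) auto
    then have "hcut R x * ?g \<le> 1 * 4"
      by (intro mult_mono hcut_le_1) auto
    with True show ?thesis by simp
  next
    case False
    then consider "norm (fst x) \<ge> R" | "snd x < y0" | "snd x > y0 + h"
      by (cases x) (auto simp: cyl_def)
    then have "hcut R x * ?g = 0"
    proof cases
      case 2
      then have "?s \<le> 0" using h by (simp add: divide_nonpos_pos)
      then have "flat 0 1 \<le> flat 0 (1 - ?s)" by (intro flat0_mono) auto
      then show ?thesis by simp
    next
      case 3
      then have "?s \<ge> 1" using h by (simp add: field_simps)
      then show ?thesis by simp
    qed (simp add: hcut_zero[OF assms(1)])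
    then show ?thesis by (simp only:) simp
  qed
  have "\<bar>hcut R x * vcut' y0 h T (snd x)\<bar> \<le> 4 / h * ?J + 2 / T * ?I"
  proof -
    have "hcut R x * vcut' y0 h T (snd x) = (hcut R x * ?g) * flat 0 (2 - (snd x - y0) / T) / h - edge R T x / T"
      by (simp add: vcut'_def edge_def algebra_simps)
    moreover have "(hcut R x * ?g) * flat 0 (2 - (snd x - y0) / T) / h \<le> 4 * ?J * 1 / h"
      using h by (intro divide_right_mono mult_mono g flat0_le_1) (auto simp: hcut_nonneg)
    moreover have "0 \<le> (hcut R x * ?g) * flat 0 (2 - (snd x - y0) / T) / h"
      using h by (simp add: hcut_nonneg)
    moreover have "edge R T x / T \<le> 2 * ?I / T" "0 \<le> edge R T x / T"
      using assms edge_le[OF assms, of x] edge_nonneg[of R T x] by (auto intro: divide_right_mono)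
    ultimately show ?thesis by (simp add: abs_le_iff)
  qed
  then have "\<bar>hcut R x * vcut' y0 h T (snd x)\<bar> * \<bar>B \<bullet> ?e\<bar> \<le> (4 / h * ?J + 2 / T * ?I) * norm B"
    using be assms h by (intro mult_mono) auto
  then have "hcut R x * vcut' y0 h T (snd x) * (B \<bullet> ?e) \<le> (4 / h * ?J + 2 / T * ?I) * norm B"
    unfolding abs_mult[symmetric] by linarith
  moreover have "vcut y0 h T (snd x) * (B \<bullet> hcut_grad R x) \<le> norm B * (4 / R) * ?I"
    using vcut_hcut_grad_le[OF assms, of x B] by linarith
  moreover have "B \<bullet> gradient (ct R T) x =
      hcut R x * vcut' y0 h T (snd x) * (B \<bullet> ?e) + vcut y0 h T (snd x) * (B \<bullet> hcut_grad R x)"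
    using h assms by (subst gradient_cutoff) (auto simp: inner_add_right simp del: scaleR_Pair)
  ultimately show ?thesis by (simp add: algebra_simps)
qed

text \<open>The cutoff alone is already a smooth test function, so the equation applies to it
  directly.\<close>

lemma source_equation:
  assumes R: "R > 0" and T: "T > 0"
  shows "integrable lebesgue (\<lambda>x. f (u0 x) * ct R T x)"
    and "(\<integral>x. A0 x \<bullet> gradient (ct R T) x \<partial>lebesgue) = (\<integral>x. f (u0 x) * ct R T x \<partial>lebesgue)"
proof -
  let ?I = "indicat_real half_space" and ?K = "cbox (- R *\<^sub>R One, y0) (R *\<^sub>R One, y0 + 2 * T) :: ('b \<times> real) set"
  have K: "?K \<subseteq> half_space"
    using y0 by (auto simp: cbox_Pair_eq half_space_def)
  have z: "ct R T x = 0" if "x \<notin> ?K" for x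
    using that by (rule cutoff_zero_cbox[OF h R T])
  have gz: "gradient (ct R T) x = 0" if "x \<notin> ?K" for x
    using gradient_zero_outside_cbox[of _ _ "ct R T" x, OF z that] by blast
  have test: "ct R T \<in> test_functions half_space"
    by (rule test_functionsI[OF smooth_cutoff _ compact_cbox K]) (use z in blast)
  have "continuous_on ?K (\<lambda>x. f (u x) * ct R T x)"
    using K u_nonneg
    by (intro continuous_intros continuous_on_compose2[OF f_cont continuous_on_subset[OF cont K]]
        smooth_continuous_on smooth_cutoff) auto
  then have "integrable lebesgue (\<lambda>x. indicat_real ?K x *\<^sub>R (f (u x) * ct R T x))"
    using absolutely_integrable_continuous unfolding set_integrable_def by blast
  moreover have "(\<lambda>x. indicat_real ?K x *\<^sub>R (f (u x) * ct R T x)) = (\<lambda>x. f (u0 x) * ct R T x)"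
    using K z by (auto simp: fun_eq_iff u0_def indicator_def)
  ultimately show "integrable lebesgue (\<lambda>x. f (u0 x) * ct R T x)" by simp
  have "(\<integral>x. A0 x \<bullet> gradient (ct R T) x \<partial>lebesgue) = (\<integral>x. (norm (G00 x) powr (p - 2) *\<^sub>R G00 x) \<bullet> gradient (ct R T) x \<partial>lebesgue)"
    unfolding A0_def by (rule integral_cong_AE) (use AE_G0 in \<open>auto elim: eventually_mono\<close>)
  also have "\<dots> = (LINT x:half_space|lebesgue. (norm (G x) powr (p - 2) *\<^sub>R G x) \<bullet> gradient (ct R T) x)"
    unfolding set_lebesgue_integral_def
    by (rule Bochner_Integration.integral_cong[OF refl]) (auto simp: G00_def indicator_def)
  also have "\<dots> = (LINT x:half_space|lebesgue. f (u x) * ct R T x)"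
    using sol test by (simp add: p_Laplace_solution_def)
  also have "\<dots> = (\<integral>x. f (u0 x) * ct R T x \<partial>lebesgue)"
    unfolding set_lebesgue_integral_def using K z
    by (intro Bochner_Integration.integral_cong[OF refl]) (auto simp: u0_def indicator_def)
  finally show "(\<integral>x. A0 x \<bullet> gradient (ct R T) x \<partial>lebesgue) = (\<integral>x. f (u0 x) * ct R T x \<partial>lebesgue)" .
qed

text \<open>Each vertical part contributes its gradient bound times its height, \<open>4 / h\<close>
  times \<open>h\<close> and \<open>2 / T\<close> times \<open>2 * T\<close>; the lateral part adds
  \<open>8 * T / R\<close>. Hence the bound does not grow with \<open>T\<close> while
  \<open>T \<le> R\<close>.\<close>

lemma source_bound:
  assumes R: "R > 0" and T: "T > 0"
  shows "(\<integral>x. f (u0 x) * ct R T x \<partial>lebesgue) \<le> a * vol R * (8 + 8 * T / R)"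
proof -
  let ?B = "\<lambda>x. a * (4 / h) * indicator (cyl R (h / 2)) x + a * (2 / T + 4 / R) * indicator (cyl R T) x"
  have h2: "h / 2 > 0" using h by simp
  have B: "integrable lebesgue ?B"
    by (intro Bochner_Integration.integrable_add integrable_cyl h2 T)
  have "A0 x \<bullet> gradient (ct R T) x \<le> ?B x" for x
  proof -
    have "norm (A0 x) * (4 / h * indicator (cyl R (h / 2)) x + (2 / T + 4 / R) * indicator (cyl R T) x)
       \<le> a * (4 / h * indicator (cyl R (h / 2)) x + (2 / T + 4 / R) * indicator (cyl R T) x)"
      using h R T by (intro mult_right_mono norm_A0_le) auto
    with gradient_ct_le[OF R T, of "A0 x" x] show ?thesis by (simp add: algebra_simps)
  qed
  moreover have "0 \<le> ?B x" for x using h R T by simp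
  ultimately have "(\<integral>x. A0 x \<bullet> gradient (ct R T) x \<partial>lebesgue) \<le> (\<integral>x. ?B x \<partial>lebesgue)"
    by (intro integral_mono'[OF B])
  also have "\<dots> = a * (4 / h) * (vol R * (2 * (h / 2))) + a * (2 / T + 4 / R) * (vol R * (2 * T))"
    unfolding integral_cyl[OF h2, symmetric] integral_cyl[OF T, symmetric]
    by (rule Bochner_Integration.integral_add[OF integrable_cyl[OF h2] integrable_cyl[OF T]])
  also have "\<dots> = a * vol R * (8 + 8 * T / R)"
    using h R T by (simp add: field_simps)
  finally show ?thesis using source_equation(2)[OF R T] by simp
qed

text \<open>On the ball of half radius, between \<open>y0 + h\<close> and \<open>y0 + T\<close>,
  each factor of the cutoff is bounded below. The argument \<open>3 / 4\<close> is
  \<open>1 - (1 / 2)\<^sup>2\<close>, and the power of 2 is the volume ratio of the balls.\<close>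

lemma ct_mass:
  assumes R: "R > 0" and T: "h \<le> T"
  shows "flat 0 (3 / 4) * smooth_step 1 * flat 0 1 / 2 ^ DIM('b) * vol R * (T - h)
    \<le> (\<integral>x. ct R T x \<partial>lebesgue)"
proof -
  let ?S = "ball (0::'b) (R / 2) \<times> {y0 + h..y0 + T}"
  let ?k = "flat 0 (3 / 4) * smooth_step 1 * flat 0 1"
  have T0: "T > 0" using T h by simp
  have e: "emeasure lebesgue ?S < \<infinity>" "?S \<in> sets lebesgue"
    using T by (intro emeasure_cylinder sets_cylinder; simp)+
  have k0: "0 \<le> ?k" using smooth_step_nonneg by simp
  have iS: "integrable lebesgue (\<lambda>x. ?k * indicator ?S x)"
    by (intro integrable_mult_right integrable_real_indicator e)
  have ict: "integrable lebesgue (ct R T)"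
    by (rule integrable_le_cyl[OF T0, where C = 1 and R = R])
      (use ct_le[OF R T0] ct_nonneg in \<open>auto simp: abs_of_nonneg\<close>)
  have "(\<integral>x. ?k * indicator ?S x \<partial>lebesgue) = ?k * measure lebesgue ?S"
    by simp
  also have "measure lebesgue ?S = measure lborel (ball (0::'b) (R / 2)) * (T - h)"
    using measure_cylinder[of "ball (0::'b) (R / 2)" "y0 + h" "y0 + T"] T by simp
  also have "measure lborel (ball (0::'b) (R / 2)) = vol R / 2 ^ DIM('b)"
    unfolding vol_def by (rule measure_ball_half[OF R])
  finally have "?k / 2 ^ DIM('b) * vol R * (T - h) = (\<integral>x. ?k * indicator ?S x \<partial>lebesgue)"
    by simp
  also have "\<dots> \<le> (\<integral>x. ct R T x \<partial>lebesgue)"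
  proof (rule integral_mono[OF iS ict])
    fix x
    show "?k * indicator ?S x \<le> ct R T x"
    proof (cases "x \<in> ?S")
      case True
      then have x: "norm (fst x) < R / 2" "y0 + h \<le> snd x" "snd x \<le> y0 + T" by auto
      have "(norm (fst x))\<^sup>2 \<le> (R / 2)\<^sup>2" using x by (intro power_mono) auto
      then have "(norm (fst x))\<^sup>2 / R\<^sup>2 \<le> 1 / 4" using R by (simp add: divide_le_eq power_divide)
      then have 1: "flat 0 (3 / 4) \<le> hcut R x" unfolding hcut_def by (intro flat0_mono) auto
      have 2: "smooth_step ((snd x - y0) / h) = smooth_step 1"
        using x h by (intro smooth_step_ge_1) (simp add: field_simps)
      have "(snd x - y0) / T \<le> 1" using x T0 by simp
      then have 3: "flat 0 1 \<le> flat 0 (2 - (snd x - y0) / T)" by (intro flat0_mono) auto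
      have "flat 0 (3 / 4) * (smooth_step 1 * flat 0 1) \<le> hcut R x * (smooth_step 1 * flat 0 (2 - (snd x - y0) / T))"
        using 1 3 smooth_step_nonneg by (intro mult_mono) (auto simp: hcut_nonneg)
      with True 2 show ?thesis by (simp add: cutoff_def vcut_def)
    qed (simp add: ct_nonneg)
  qed
  finally show ?thesis .
qed

text \<open>Where \<open>u0 x \<ge> d / 2\<close> the source is at least \<open>k\<close>. Elsewhere
  \<open>W x \<ge> flat 0 (d / 2)\<close> and the cutoff is at most \<open>4 * edge R T x\<close>,
  so the subtracted multiple of \<open>W x * edge R T x\<close> is at least \<open>k\<close> times
  the cutoff.\<close>

lemma source_lower_bound:
  assumes R: "R > 0" and T: "T > 0" and k: "k > 0" "\<And>t. d / 2 \<le> t \<Longrightarrow> k \<le> f t"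
  shows "k * (\<integral>x. ct R T x \<partial>lebesgue) - 4 * k / flat 0 (d / 2) * deficit R T
    \<le> (\<integral>x. f (u0 x) * ct R T x \<partial>lebesgue)"
proof -
  let ?F = "flat 0 (d / 2)"
  have F: "?F > 0" using d by simp
  have pw: "k * ct R T x - 4 * k / ?F * (W x * edge R T x) \<le> f (u0 x) * ct R T x" for x
  proof (cases "d / 2 \<le> u0 x")
    case True
    have "k * ct R T x \<le> f (u0 x) * ct R T x" using k(2)[OF True] by (intro mult_right_mono ct_nonneg)
    moreover have "0 \<le> 4 * k / ?F * (W x * edge R T x)"
      using k F W_nonneg edge_nonneg by simp
    ultimately show ?thesis by linarith
  next
    case False
    then have "?F \<le> W x" unfolding W_def by (intro flat0_mono) auto
    then have "1 \<le> W x / ?F" using F by simp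
    then have "1 * ct R T x \<le> W x / ?F * (4 * edge R T x)"
      using ct_le_edge[OF R T] by (intro mult_mono) (auto simp: ct_nonneg)
    then have "k * ct R T x \<le> k * (W x / ?F * (4 * edge R T x))"
      using k by (intro mult_left_mono) auto
    moreover have "0 \<le> f (u0 x) * ct R T x"
      using f_nonneg u0_nonneg ct_nonneg by simp
    ultimately show ?thesis by (simp add: mult_ac)
  qed
  have ict: "integrable lebesgue (ct R T)"
    by (rule integrable_le_cyl[OF T, where C = 1 and R = R])
      (use ct_le[OF R T] ct_nonneg in \<open>auto simp: abs_of_nonneg\<close>)
  have i1: "integrable lebesgue (\<lambda>x. k * ct R T x)" using ict by (rule integrable_mult_right)
  have i2: "integrable lebesgue (\<lambda>x. 4 * k / ?F * (W x * edge R T x))"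
    using W_edge_integrable[OF R T] by (rule integrable_mult_right)
  have "(\<integral>x. k * ct R T x - 4 * k / ?F * (W x * edge R T x) \<partial>lebesgue) \<le> (\<integral>x. f (u0 x) * ct R T x \<partial>lebesgue)"
    by (rule integral_mono[OF Bochner_Integration.integrable_diff[OF i1 i2] source_equation(1)[OF R T] pw])
  then show ?thesis
    unfolding Bochner_Integration.integral_diff[OF i1 i2] deficit_def by simp
qed

section \<open>Choice of the parameters and the contradiction\<close>

lemma vol_pos: "R > 0 \<Longrightarrow> 0 < vol R"
  unfolding vol_def by (simp add: content_ball_pos)

text \<open>With height \<open>s\<^sup>2\<close>, radius \<open>s\<^sup>4\<close> and Young parameter \<open>s\<close>, all terms of the recursion vanish
  as \<open>s \<rightarrow> \<infinity>\<close>.\<close>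

lemma energy_small:
  assumes s: "s \<ge> 1"
  shows "energy (s ^ 4) (s\<^sup>2) \<le>
    vol (s ^ 4) * ((40 * exp 1 * d\<^sup>2 * a + 8 * a) * inverse s + 4 * s powr (1 - p))"
proof -
  let ?R = "s ^ 4" and ?L = "s\<^sup>2"
  have s0: "s > 0" and R: "?R > 0" and L: "?L > 0" and L2: "2 * ?L > 0" using s by auto
  have q: "?L / ?R = inverse s * inverse s"
    using s0 by (simp add: power2_eq_square power4_eq_xxxx field_simps)
  have alg: "(2 * w / L + 4 * b / R) * (V * (2 * L)) = V * (4 * w + 8 * b * (L / R))"
    if "L \<noteq> 0" for L w b R V :: real
    using that by (cases "R = 0") (auto simp: field_simps)
  have i: "0 \<le> inverse s" "inverse s \<le> 1" "inverse s * inverse s \<le> inverse s"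
    using s by (auto simp: inverse_le_1_iff mult_left_le)
  \<comment> \<open>The a priori bound at height \<open>2 * ?L\<close> with
    \<open>?L / ?R \<le> 1\<close> gives the constant \<open>4 + 16 = 20\<close>.\<close>
  have "energy ?R (2 * ?L) \<le> a * vol ?R * (4 + 16 * (?L / ?R))"
    using energy_bound[OF R L2] by simp
  also have "\<dots> \<le> a * vol ?R * 20"
    unfolding q using i vol_nonneg[of ?R] by (intro mult_left_mono) auto
  finally have e: "energy ?R (2 * ?L) \<le> 20 * a * vol ?R" by simp
  \<comment> \<open>With \<open>l = s\<close> the coefficient of the energy is of order
    \<open>s / s\<^sup>2\<close>, and the other Young term carries \<open>s powr (1 - p)\<close>,
    which decays because \<open>p > 1\<close>.\<close>
  have "energy ?R ?L \<le> 2 * exp 1 * d\<^sup>2 * s / ?L * energy ?R (2 * ?L)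
    + (2 * s powr (1 - p) / ?L + 4 * a / ?R) * (vol ?R * (2 * ?L))"
    by (rule energy_recursion[OF R L s0])
  also have "2 * exp 1 * d\<^sup>2 * s / ?L = 2 * exp 1 * d\<^sup>2 * inverse s"
    using s0 by (simp add: power2_eq_square field_simps)
  also have "2 * exp 1 * d\<^sup>2 * inverse s * energy ?R (2 * ?L) \<le> 2 * exp 1 * d\<^sup>2 * inverse s * (20 * a * vol ?R)"
    using i by (intro mult_left_mono e) auto
  also have "(2 * s powr (1 - p) / ?L + 4 * a / ?R) * (vol ?R * (2 * ?L)) = vol ?R * (4 * s powr (1 - p) + 8 * a * (?L / ?R))"
    by (rule alg) (use s0 in simp)
  also have "\<dots> \<le> vol ?R * (4 * s powr (1 - p) + 8 * a * inverse s)"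
    unfolding q using i vol_nonneg[of ?R] by (intro mult_left_mono add_mono) auto
  finally show ?thesis by (simp add: algebra_simps)
qed

text \<open>The parameters are chosen in the order \<open>T\<close>, \<open>m\<close>,
  \<open>s\<close>: the height \<open>T\<close> makes the source too large, then \<open>m\<close>
  and the size \<open>s\<close> of the tall cylinder make the deficit at this fixed height
  harmless.\<close>

lemma no_solution:
  assumes k: "k > 0" "\<And>t. d / 2 \<le> t \<Longrightarrow> k \<le> f t"
  shows False
proof -
  define \<kappa> where "\<kappa> = flat 0 (3 / 4) * smooth_step 1 * flat 0 1 / 2 ^ DIM('b)"
  have \<kappa>: "\<kappa> > 0" using smooth_step_1_pos by (simp add: \<kappa>_def)
  have a0: "a > 0" using M by simp
  \<comment> \<open>Per unit of base, \<open>16 * a\<close> is the upper bound for the source once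
    \<open>T \<le> R\<close>. Of the surplus 2, one unit is given up to the deficit and the other
    yields the contradiction.\<close>
  define T where "T = h + (16 * a + 2) / (k * \<kappa>)"
  have T: "k * \<kappa> * (T - h) = 16 * a + 2" "h \<le> T" "T > 0"
    using k \<kappa> a0 h by (auto simp: T_def add_pos_pos)
  define K where "K = 4 * k / flat 0 (d / 2)"
  have K: "K > 0" using k d by (simp add: K_def)
  \<comment> \<open>Makes the \<open>m\<close>-term of \<open>deficit_bound\<close>, multiplied by
    \<open>K\<close>, equal to \<open>1 / 2\<close> per unit of base.\<close>
  define m where "m = 1 / (8 * K * T\<^sup>2)"
  have m: "m > 0" using K T by (simp add: m_def)
  have Km: "K * (T * (4 * m * T)) = 1 / 2" using K T by (simp add: m_def power2_eq_square)
  define E where "E s = (40 * exp 1 * d\<^sup>2 * a + 8 * a) * inverse s + 4 * s powr (1 - p)" for s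
  have "(E \<longlongrightarrow> (40 * exp 1 * d\<^sup>2 * a + 8 * a) * 0 + 4 * 0) at_top"
    unfolding E_def[abs_def] using p
    by (intro tendsto_intros tendsto_inverse_0_at_top tendsto_neg_powr filterlim_ident) auto
  then have E0: "(E \<longlongrightarrow> 0) at_top" by simp
  \<comment> \<open>The threshold for \<open>E s\<close> below which the energy term contributes at
    most the other \<open>1 / 2\<close>.\<close>
  have Q: "0 < 1 / (2 * K * T * m powr (1 - p))" using K T m by simp
  \<comment> \<open>\<open>s \<ge> 1\<close> and \<open>s \<ge> T\<close> give
    \<open>T \<le> s\<^sup>2\<close> for \<open>deficit_bound\<close> and
    \<open>T \<le> s ^ 4\<close> for the source bound.\<close>
  have "\<forall>\<^sub>F s in at_top. E s < 1 / (2 * K * T * m powr (1 - p)) \<and> 1 \<le> s \<and> T \<le> s"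
    by (intro eventually_conj order_tendstoD(2)[OF E0 Q] eventually_ge_at_top)
  then obtain s where s: "E s < 1 / (2 * K * T * m powr (1 - p))" "1 \<le> s" "T \<le> s"
    by (auto simp: eventually_at_top_linorder)
  let ?R = "s ^ 4" and ?L = "s\<^sup>2"
  have R: "?R > 0" using s by simp
  have TL: "T \<le> ?L" using s self_le_power[of s 2] by simp
  have TR: "T \<le> ?R" using s self_le_power[of s 4] by simp
  let ?V = "vol ?R"
  have V: "?V > 0" by (rule vol_pos[OF R])
  have "energy ?R ?L \<le> ?V * E s"
    unfolding E_def by (rule energy_small[OF s(2)])
  then have "m powr (1 - p) * energy ?R ?L \<le> m powr (1 - p) * (?V * E s)"
    by (intro mult_left_mono) auto
  then have "T * (m powr (1 - p) * energy ?R ?L + 4 * m * T * ?V) \<le> T * (m powr (1 - p) * (?V * E s) + 4 * m * T * ?V)"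
    using T by (intro mult_left_mono) auto
  then have "deficit ?R T \<le> T * (m powr (1 - p) * (?V * E s) + 4 * m * T * ?V)"
    using deficit_bound[OF R T(3) TL m] by linarith
  then have "K * deficit ?R T \<le> K * (T * (m powr (1 - p) * (?V * E s) + 4 * m * T * ?V))"
    using K by (intro mult_left_mono) auto
  also have "\<dots> = ?V * (K * T * m powr (1 - p) * E s + K * (T * (4 * m * T)))"
    by (simp add: algebra_simps)
  also have "\<dots> \<le> ?V * 1"
  proof (rule mult_left_mono)
    have "K * T * m powr (1 - p) * E s \<le> K * T * m powr (1 - p) * (1 / (2 * K * T * m powr (1 - p)))"
      using s(1) K T by (intro mult_left_mono) auto
    also have "\<dots> = 1 / 2" using K T m by simp
    finally show "K * T * m powr (1 - p) * E s + K * (T * (4 * m * T)) \<le> 1" unfolding Km by simp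
  qed (use V in simp)
  finally have KD: "K * deficit ?R T \<le> ?V" by simp
  have "\<kappa> * ?V * (T - h) \<le> (\<integral>x. ct ?R T x \<partial>lebesgue)"
    unfolding \<kappa>_def by (rule ct_mass[OF R T(2)])
  then have "k * (\<kappa> * ?V * (T - h)) \<le> k * (\<integral>x. ct ?R T x \<partial>lebesgue)"
    using k by (intro mult_left_mono) auto
  moreover have "k * (\<kappa> * ?V * (T - h)) = ?V * (16 * a + 2)"
    unfolding T(1)[symmetric] by simp
  ultimately have "?V * (16 * a + 2) - ?V \<le> (\<integral>x. f (u0 x) * ct ?R T x \<partial>lebesgue)"
    using source_lower_bound[OF R T(3) k] KD unfolding K_def by linarith
  also have "\<dots> \<le> a * ?V * (8 + 8 * T / ?R)"
    by (rule source_bound[OF R T(3)])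
  also have "\<dots> \<le> a * ?V * 16"
    using TR R a0 V by (intro mult_left_mono) (auto simp: divide_le_eq)
  finally have "?V * (16 * a + 2) - ?V \<le> a * ?V * 16" .
  then show False using V by (simp add: algebra_simps)
qed

end

section \<open>The Liouville theorem\<close>

text \<open>The Lipschitz bound spreads positivity from one hyperplane to a slab above it, which
  puts the solution into the setting of \<open>half_space_solution\<close>.\<close>

lemma INF_pos_imp_False:
  fixes p q c y0 :: real and f :: "real \<Rightarrow> real" and u :: "(real^'m) \<times> real \<Rightarrow> real"
  assumes p: "p > 1" and q: "q > p - 1"
    and f_nonneg: "\<forall>t\<ge>0. f t \<ge> 0"
    and lip: "local_lipschitz (UNIV :: real set) {0<..} (\<lambda>_. f)"
    and f0: "continuous (at 0 within {0..}) f"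
    and c: "c > 0" and f_ge: "\<forall>t>0. f t \<ge> c * t powr q"
    and sol: "nonneg_nontrivial_solution p q f u"
    and y0: "y0 > 0" and inf: "(INF x'. u (x', y0)) > 0"
  shows False
proof -
  define e where "e = (INF x'. u (x', y0))"
  have nonneg: "\<And>x. x \<in> half_space \<Longrightarrow> 0 \<le> u x" and "continuous_on closed_half_space u"
    using sol by (simp_all add: nonneg_nontrivial_solution_def)
  then have cont: "continuous_on half_space u"
    by (elim continuous_on_subset) (auto simp: half_space_def closed_half_space_def)
  obtain G where wg: "weak_gradient half_space u G" and ess: "essentially_bounded half_space G"
    and lap: "p_Laplace_solution p f half_space u G"
    using sol by (auto simp: nonneg_nontrivial_solution_def W1p_loc_def)
  obtain M0 where M0: "AE x in lebesgue. x \<in> half_space \<longrightarrow> norm (G x) \<le> M0"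
    using ess by (auto simp: essentially_bounded_def)
  \<comment> \<open>The maximum with 1 makes the gradient bound strictly positive, as it is used as
    a divisor.\<close>
  define M where "M = max M0 1"
  have M: "M > 0" "AE x in lebesgue. x \<in> half_space \<longrightarrow> norm (G x) \<le> M"
    using M0 by (auto simp: M_def elim: eventually_mono)
  \<comment> \<open>Over the height \<open>h\<close> the Lipschitz bound loses at most
    \<open>M * h = e / 2\<close>, which leaves \<open>d\<close>.\<close>
  define d h where "d = e / 2" and "h = e / (2 * M)"
  have e: "e > 0" "d > 0" "h > 0" using inf M by (auto simp: e_def d_def h_def)
  have ge: "e \<le> u (x, y0)" for x
    unfolding e_def
    by (rule cINF_lower) (use nonneg y0 in \<open>auto intro!: bdd_belowI2[of _ 0] simp: half_space_def\<close>)
  have low: "d \<le> u (x, t)" if t: "y0 \<le> t" "t \<le> y0 + h" for x t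
  proof -
    \<comment> \<open>The box used here degenerates to a vertical segment, and the constant
      \<open>M\<close> is the same for every \<open>x\<close>.\<close>
    have "\<bar>u (x, t) - u (x, y0)\<bar> \<le> M * norm ((x, t) - (x, y0))"
      by (rule weak_gradient_Lipschitz[OF wg cont M(2) _ enlarged_cbox_half_space[OF y0, of x x "y0 + h"]])
        (use M y0 t e in \<open>auto simp: cbox_Pair_eq\<close>)
    also have "\<dots> \<le> M * h" using t M by (intro mult_left_mono) (auto simp: norm_Pair)
    also have "\<dots> = e / 2" using M by (simp add: h_def)
    finally show ?thesis using ge[of x] unfolding d_def by linarith
  qed
  have f_cont: "continuous_on {0..} f"
  proof -
    have "continuous_on {0<..} f"
      using local_lipschitz_continuous_on[OF lip] by simp
    then have "continuous (at t within {0..}) f" if "t > 0" for t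
      using that by (simp add: continuous_on_eq_continuous_at continuous_at_imp_continuous_within)
    with f0 show ?thesis
      unfolding continuous_on_eq_continuous_within by (metis atLeast_iff less_le)
  qed
  interpret half_space_solution p M d y0 h f u G
    by unfold_locales (use p M wg cont nonneg lap f_nonneg f_cont y0 e low in auto)
  show False
  \<comment> \<open>The growth hypothesis bounds \<open>f\<close> below on the whole half-line from
    \<open>d / 2\<close>, because \<open>q > p - 1 > 0\<close> makes the power increasing.\<close>
  proof (rule no_solution[of "c * (d / 2) powr q"])
    show "0 < c * (d / 2) powr q" using c e by simp
    fix t assume t: "d / 2 \<le> t"
    have "c * (d / 2) powr q \<le> c * t powr q"
      using c e t p q by (intro mult_left_mono powr_mono2) auto
    also have "\<dots> \<le> f t" using f_ge t e by auto
    finally show "c * (d / 2) powr q \<le> f t" .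
  qed
qed

theorem theorem3:
  fixes p q c l :: real and f :: "real \<Rightarrow> real"
  assumes "p > 1" and "q > p - 1"
    and "\<forall>t\<ge>0. f t \<ge> 0"
    and "\<forall>t>0. f t > 0"
    and "local_lipschitz (UNIV :: real set) {0<..} (\<lambda>_. f)"
    and "continuous (at 0 within {0..}) f"
    and "l \<ge> 0" and "((\<lambda>t. f t / t powr (p - 1)) \<longlongrightarrow> l) (at_right 0)"
    and "c > 0" and "\<forall>t>0. f t \<ge> c * t powr q"
  shows "\<not> (\<exists>u :: (real^'m) \<times> real \<Rightarrow> real.
              nonneg_nontrivial_solution p q f u \<and>
              (\<exists>y0>0. (INF x'. u (x', y0)) > 0)) \<and>
         (\<forall>u :: (real^'m) \<times> real \<Rightarrow> real.
              nonneg_nontrivial_solution p q f u \<longrightarrow>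
              (\<forall>y>0. (INF x'. u (x', y)) = 0))"
proof -
  note not_pos = INF_pos_imp_False[OF assms(1-3,5,6,9,10)]
  \<comment> \<open>Since \<open>u\<close> is nonnegative, so is the infimum; excluding positive
    values therefore forces 0.\<close>
  have "(INF x'. u (x', y)) = 0" if u: "nonneg_nontrivial_solution p q f u" and y: "y > 0"
    for u :: "(real^'m) \<times> real \<Rightarrow> real" and y
  proof (rule antisym)
    show "(INF x'. u (x', y)) \<le> 0" using not_pos[OF u y] by (rule leI[OF notI])
    show "0 \<le> (INF x'. u (x', y))"
      using u y by (intro cINF_greatest) (auto simp: nonneg_nontrivial_solution_def half_space_def)
  qed
  with not_pos show ?thesis by blast
qed

end
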